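(* Let $(M,J,h)$ be an almost Hermitian manifold of real dimension $2n$, $n\ge 2$, and let $t\in\mathbb{R}$. Then the two Hermitian scalar curvatures $s_1(t)$, $s_2(t)$ of the canonical Hermitian connection $D^t$ satisfy $$s_1(t)=\frac{s}{2}-\frac{5}{12}|(dF)^-|^2+\frac{1}{16}|N^0|^2+\frac14|(dF)_0^+|^2+\Big[\frac{1}{4(n-1)}+\frac{t-1}{2}\Big]|\alpha_F|^2+\frac{t-2}{2}\,\delta\alpha_F$$ and $$s_2(t)=\frac{s}{2}-\frac{1}{12}|(dF)^-|^2+\frac{1}{32}|N^0|^2-\frac{t^2-2t}{4}|(dF)_0^+|^2-\Big[\frac{t^2-2t}{4(n-1)}+\frac{(t+1)^2}{8}\Big]|\alpha_F|^2-\frac{t+1}{2}\,\delta\alpha_F,$$ where $s$ is the Riemannian scalar curvature of $h$.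
   Context: $(M,J,h)$ almost Hermitian: $J$ is an almost complex structure orthogonal for the Riemannian metric $h=\langle\cdot,\cdot\rangle$; $\nabla$ is the Levi-Civita connection. Fundamental 2-form: $F(X,Y)=h(JX,Y)$. Nijenhuis tensor: $N(X,Y)=[X,Y]+J[JX,Y]+J[X,JY]-[JX,JY]$; write $N(X,Y,Z)=\langle X,N(Y,Z)\rangle$, $\mathfrak{b}N(X,Y,Z)=\frac13[N(X,Y,Z)+N(Y,Z,X)+N(Z,X,Y)]$ and $N^0=N-\mathfrak{b}N$. $\delta=-\ast d\ast$ is the codifferential. The Lee form is $\alpha_F=J\delta F$, where $(J\phi)(X)=-\phi(JX)$ for 1-forms; equivalently $dF=(dF)_0+\frac{1}{n-1}\alpha_F\wedge F$ with $(dF)_0$ primitive. $(dF)^+$ is the $(2,1)+(1,2)$-component and $(dF)^-$ the $(3,0)+(0,3)$-component of $dF$; $(dF)_0^+=(dF)^+-\frac{1}{n-1}\alpha_F\wedge F$ is the primitive part of $(dF)^+$. Norms: $k$-forms carry the inner product for which $e^{A_1}\wedge\dots\wedge e^{A_k}$ ($A_1<\dots<A_k$, orthonormal coframe) are orthonormal; $N^0$ is normed as a $TM$-valued 2-form, i.e. $|N^0|^2=\sum_{A<B}|N^0(e_A,e_B)|^2$. Canonical Hermitian connections (Gauduchon), $t\in\mathbb{R}$: $$h(D^t_XY,Z)=h\big(\nabla_XY-\tfrac12J(\nabla_XJ)Y,Z\big)+\tfrac t4\big[h((\nabla_{JY}J)Z+J(\nabla_YJ)Z,X)-h((\nabla_{JZ}J)Y+J(\nabla_ZJ)Y,X)\big].$$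 Curvature: $K^t(X,Y,Z,W)=\langle D^t_ZD^t_WY-D^t_WD^t_ZY-D^t_{[Z,W]}Y,X\rangle$, extended complex multilinearly. For a local $J$-adapted orthonormal frame $\{e_i,e_{n+i}=Je_i\}_{i=1}^n$ put $u_i=\frac1{\sqrt2}(e_i-\sqrt{-1}e_{n+i})$, $u_{\bar i}=\overline{u_i}$; then $$s_1(t)=\sum_{i,j}K^t(u_{\bar i},u_i,u_j,u_{\bar j}),\qquad s_2(t)=\sum_{i,j}K^t(u_{\bar i},u_j,u_i,u_{\bar j}).$$ Riemannian curvature: $R(X,Y,Z,W)=\langle\nabla_Z\nabla_WY-\nabla_W\nabla_ZY-\nabla_{[Z,W]}Y,X\rangle$, $Ric(X,Y)=\sum_AR(e_A,X,e_A,Y)$, $s=\sum_ARic(e_A,e_A)$ (positive on round spheres). *)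

theory Defs
  imports "HOL-Analysis.Analysis"
begin

section \<open>Smooth maps between Euclidean spaces\<close>

text \<open>The second argument is meant to be open.\<close>

primrec Ck_on :: "nat \<Rightarrow> 'a::euclidean_space set \<Rightarrow> ('a \<Rightarrow> 'b::real_normed_vector) \<Rightarrow> bool" where
  "Ck_on 0 S f \<longleftrightarrow> continuous_on S f"
| "Ck_on (Suc k) S f \<longleftrightarrow> (\<forall>x\<in>S. f differentiable (at x)) \<and>
     (\<forall>v. Ck_on k S (\<lambda>x. frechet_derivative f (at x) v))"

definition smooth_on :: "'a::euclidean_space set \<Rightarrow> ('a \<Rightarrow> 'b::real_normed_vector) \<Rightarrow> bool" where
  "smooth_on S f \<longleftrightarrow> (\<forall>k. Ck_on k S f)"


section \<open>Almost Hermitian manifolds\<close>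

text \<open>A chart is a pair of its domain and its coordinate map, with values in a Euclidean space 'e
  whose dimension is the dimension of the manifold.\<close>

type_synonym ('m, 'e) chart = "'m set \<times> ('m \<Rightarrow> 'e)"

definition chart_image :: "('m, 'e) chart \<Rightarrow> 'e set" where
  "chart_image c = snd c ` fst c"

definition overlap :: "('m, 'e) chart \<Rightarrow> ('m, 'e) chart \<Rightarrow> 'e set" where
  "overlap c d = snd c ` (fst c \<inter> fst d)"

definition transition :: "('m, 'e) chart \<Rightarrow> ('m, 'e) chart \<Rightarrow> 'e \<Rightarrow> 'e" where
  "transition c d = snd d \<circ> inv_into (fst c) (snd c)"

definition smooth_manifold :: "'m topology \<Rightarrow> ('m, 'e::euclidean_space) chart set \<Rightarrow> bool" where
  "smooth_manifold M \<A> \<longleftrightarrow>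
     Hausdorff_space M \<and> second_countable M \<and>
     topspace M = (\<Union>c\<in>\<A>. fst c) \<and>
     (\<forall>c\<in>\<A>. openin M (fst c) \<and> open (chart_image c) \<and>
        homeomorphic_map (subtopology M (fst c)) (top_of_set (chart_image c)) (snd c)) \<and>
     (\<forall>c\<in>\<A>. \<forall>d\<in>\<A>. smooth_on (overlap c d) (transition c d))"

text \<open>A tensor field on the manifold is given by its local expressions, one for each chart of the
  atlas, which transform under coordinate changes by the derivative of the transition map.
  In a chart, a vector field is a map from 'e to 'e, a metric is a field of bilinear forms
  and an almost complex structure is a field of endomorphisms.\<close>

type_synonym 'e vfield = "'e \<Rightarrow> 'e"
type_synonym 'e metric = "'e \<Rightarrow> 'e \<Rightarrow> 'e \<Rightarrow> real"
type_synonym 'e endo = "'e \<Rightarrow> 'e \<Rightarrow> 'e"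

definition riemannian_metric ::
    "('m, 'e::euclidean_space) chart set \<Rightarrow> (('m, 'e) chart \<Rightarrow> 'e metric) \<Rightarrow> bool" where
  "riemannian_metric \<A> h \<longleftrightarrow>
     (\<forall>c\<in>\<A>. (\<forall>v w. smooth_on (chart_image c) (\<lambda>x. h c x v w)) \<and>
        (\<forall>x\<in>chart_image c. bilinear (h c x) \<and> (\<forall>v w. h c x v w = h c x w v) \<and>
           (\<forall>v. v \<noteq> 0 \<longrightarrow> h c x v v > 0))) \<and>
     (\<forall>c\<in>\<A>. \<forall>d\<in>\<A>. \<forall>x\<in>overlap c d. \<forall>v w.
        h d (transition c d x) (frechet_derivative (transition c d) (at x) v)
          (frechet_derivative (transition c d) (at x) w) = h c x v w)"

definition almost_complex_structure ::
    "('m, 'e::euclidean_space) chart set \<Rightarrow> (('m, 'e) chart \<Rightarrow> 'e endo) \<Rightarrow> bool" where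
  "almost_complex_structure \<A> J \<longleftrightarrow>
     (\<forall>c\<in>\<A>. (\<forall>v. smooth_on (chart_image c) (\<lambda>x. J c x v)) \<and>
        (\<forall>x\<in>chart_image c. linear (J c x) \<and> (\<forall>v. J c x (J c x v) = - v))) \<and>
     (\<forall>c\<in>\<A>. \<forall>d\<in>\<A>. \<forall>x\<in>overlap c d. \<forall>v.
        J d (transition c d x) (frechet_derivative (transition c d) (at x) v)
          = frechet_derivative (transition c d) (at x) (J c x v))"

definition almost_hermitian_manifold ::
    "'m topology \<Rightarrow> ('m, 'e::euclidean_space) chart set \<Rightarrow> (('m, 'e) chart \<Rightarrow> 'e endo)
       \<Rightarrow> (('m, 'e) chart \<Rightarrow> 'e metric) \<Rightarrow> bool" where
  "almost_hermitian_manifold M \<A> J h \<longleftrightarrow>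
     smooth_manifold M \<A> \<and> riemannian_metric \<A> h \<and> almost_complex_structure \<A> J \<and>
     (\<forall>c\<in>\<A>. \<forall>x\<in>chart_image c. \<forall>v w. h c x (J c x v) (J c x w) = h c x v w)"


section \<open>Connections and curvature\<close>

text \<open>From here on everything takes place in a single chart: \<open>h\<close> and \<open>J\<close> are the local expressions
  in that chart.\<close>

definition endo_app :: "'e endo \<Rightarrow> 'e vfield \<Rightarrow> 'e vfield" where
  "endo_app J X = (\<lambda>x. J x (X x))"

definition lie_bracket :: "'e::euclidean_space vfield \<Rightarrow> 'e vfield \<Rightarrow> 'e vfield" where
  "lie_bracket X Y = (\<lambda>x. frechet_derivative Y (at x) (X x) - frechet_derivative X (at x) (Y x))"

text \<open>The covariant derivative of \<open>Y\<close> in direction \<open>X\<close>, for the affine connection whose connection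
  form (Christoffel symbols) in the chart is \<open>\<Gamma>\<close>.\<close>

definition cov :: "('e \<Rightarrow> 'e \<Rightarrow> 'e \<Rightarrow> 'e) \<Rightarrow> 'e::euclidean_space vfield \<Rightarrow> 'e vfield \<Rightarrow> 'e vfield" where
  "cov \<Gamma> X Y = (\<lambda>x. frechet_derivative Y (at x) (X x) + \<Gamma> x (X x) (Y x))"

definition levi_civita ::
    "'e set \<Rightarrow> 'e metric \<Rightarrow> ('e::euclidean_space \<Rightarrow> 'e \<Rightarrow> 'e \<Rightarrow> 'e) \<Rightarrow> bool" where
  "levi_civita U h \<Gamma> \<longleftrightarrow>
     (\<forall>v w. smooth_on U (\<lambda>x. \<Gamma> x v w)) \<and> (\<forall>x\<in>U. bilinear (\<Gamma> x)) \<and>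
     (\<forall>X Y. smooth_on U X \<longrightarrow> smooth_on U Y \<longrightarrow>
        (\<forall>x\<in>U. cov \<Gamma> X Y x - cov \<Gamma> Y X x = lie_bracket X Y x)) \<and>
     (\<forall>X Y Z. smooth_on U X \<longrightarrow> smooth_on U Y \<longrightarrow> smooth_on U Z \<longrightarrow>
        (\<forall>x\<in>U. frechet_derivative (\<lambda>y. h y (Y y) (Z y)) (at x) (X x)
           = h x (cov \<Gamma> X Y x) (Z x) + h x (Y x) (cov \<Gamma> X Z x)))"

text \<open>\<open>cov_endo \<Gamma> J X Y\<close> is \<open>(\<nabla>\<^sub>X J) Y\<close>.\<close>

definition cov_endo ::
    "('e \<Rightarrow> 'e \<Rightarrow> 'e \<Rightarrow> 'e) \<Rightarrow> 'e::euclidean_space endo \<Rightarrow> 'e vfield \<Rightarrow> 'e vfield \<Rightarrow> 'e vfield" where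
  "cov_endo \<Gamma> J X Y = (\<lambda>x. cov \<Gamma> X (endo_app J Y) x - J x (cov \<Gamma> X Y x))"

definition gauduchon_form ::
    "'e::euclidean_space metric \<Rightarrow> 'e endo \<Rightarrow> ('e \<Rightarrow> 'e \<Rightarrow> 'e \<Rightarrow> 'e) \<Rightarrow> real
       \<Rightarrow> 'e vfield \<Rightarrow> 'e vfield \<Rightarrow> 'e vfield \<Rightarrow> 'e \<Rightarrow> real" where
  "gauduchon_form h J \<Gamma> t X Y Z x =
     h x (cov \<Gamma> X Y x - (1/2) *\<^sub>R J x (cov_endo \<Gamma> J X Y x)) (Z x)
     + t / 4 *
       (h x (cov_endo \<Gamma> J (endo_app J Y) Z x + J x (cov_endo \<Gamma> J Y Z x)) (X x)
        - h x (cov_endo \<Gamma> J (endo_app J Z) Y x + J x (cov_endo \<Gamma> J Z Y x)) (X x))"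

text \<open>The canonical connection \<open>D\<^sup>t\<close> is given by \<open>h(D\<^sup>t\<^sub>X Y, Z) = gauduchon_form \<dots> X Y Z\<close> for all \<open>Z\<close>.
  Both sides are tensorial in \<open>Z\<close>, so it suffices to let \<open>Z\<close> range over the constant fields.\<close>

definition gauduchon ::
    "'e::euclidean_space metric \<Rightarrow> 'e endo \<Rightarrow> ('e \<Rightarrow> 'e \<Rightarrow> 'e \<Rightarrow> 'e) \<Rightarrow> real
       \<Rightarrow> 'e vfield \<Rightarrow> 'e vfield \<Rightarrow> 'e vfield" where
  "gauduchon h J \<Gamma> t X Y =
     (\<lambda>x. THE w. \<forall>z. h x w z = gauduchon_form h J \<Gamma> t X Y (\<lambda>_. z) x)"

text \<open>The curvature, with the argument order \<open>K(X,Y,Z,W) = \<langle>D\<^sub>Z D\<^sub>W Y - D\<^sub>W D\<^sub>Z Y - D\<^bsub>[Z,W]\<^esub> Y, X\<rangle>\<close>,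
  of the connection given by its covariant derivative \<open>D\<close>.\<close>

definition curvature ::
    "'e::euclidean_space metric \<Rightarrow> ('e vfield \<Rightarrow> 'e vfield \<Rightarrow> 'e vfield)
       \<Rightarrow> 'e vfield \<Rightarrow> 'e vfield \<Rightarrow> 'e vfield \<Rightarrow> 'e vfield \<Rightarrow> 'e \<Rightarrow> real" where
  "curvature h D X Y Z W x =
     h x (D Z (D W Y) x - D W (D Z Y) x - D (lie_bracket Z W) Y x) (X x)"


section \<open>Adapted frames and traces\<close>

text \<open>The frame is indexed from 0: \<open>E i\<close> and \<open>E (n + i)\<close>, for \<open>i < n\<close>, are the fields \<open>e\<^sub>i\<close> and
  \<open>J e\<^sub>i\<close>.\<close>

definition adapted_frame ::
    "nat \<Rightarrow> 'e::euclidean_space set \<Rightarrow> 'e metric \<Rightarrow> 'e endo \<Rightarrow> (nat \<Rightarrow> 'e vfield) \<Rightarrow> bool" where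
  "adapted_frame n V h J E \<longleftrightarrow>
     (\<forall>A<2*n. smooth_on V (E A)) \<and>
     (\<forall>x\<in>V. (\<forall>i<n. E (n + i) x = J x (E i x)) \<and>
        (\<forall>A<2*n. \<forall>B<2*n. h x (E A x) (E B x) = (if A = B then 1 else 0)))"

definition ricci ::
    "nat \<Rightarrow> 'e::euclidean_space metric \<Rightarrow> ('e \<Rightarrow> 'e \<Rightarrow> 'e \<Rightarrow> 'e) \<Rightarrow> (nat \<Rightarrow> 'e vfield)
       \<Rightarrow> 'e vfield \<Rightarrow> 'e vfield \<Rightarrow> 'e \<Rightarrow> real" where
  "ricci n h \<Gamma> E X Y x = (\<Sum>A<2*n. curvature h (cov \<Gamma>) (E A) X (E A) Y x)"

definition riemann_scalar ::
    "nat \<Rightarrow> 'e::euclidean_space metric \<Rightarrow> ('e \<Rightarrow> 'e \<Rightarrow> 'e \<Rightarrow> 'e) \<Rightarrow> (nat \<Rightarrow> 'e vfield) \<Rightarrow> 'e \<Rightarrow> real" where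
  "riemann_scalar n h \<Gamma> E x = (\<Sum>A<2*n. ricci n h \<Gamma> E (E A) (E A) x)"

text \<open>A complexified vector (or vector field) \<open>a + \<i> b\<close> is represented by the pair \<open>(a, b)\<close>.
  A multilinear map is a function of the list of its arguments; \<open>complexify\<close> is its complex
  multilinear extension.\<close>

primrec complexify :: "('v list \<Rightarrow> real) \<Rightarrow> ('v \<times> 'v) list \<Rightarrow> complex" where
  "complexify f [] = of_real (f [])"
| "complexify f (z # zs) =
     complexify (\<lambda>vs. f (fst z # vs)) zs + \<i> * complexify (\<lambda>vs. f (snd z # vs)) zs"

definition u_frame :: "nat \<Rightarrow> (nat \<Rightarrow> 'e::euclidean_space vfield) \<Rightarrow> nat \<Rightarrow> 'e vfield \<times> 'e vfield" where
  "u_frame n E i = ((\<lambda>x. (1 / sqrt 2) *\<^sub>R E i x), (\<lambda>x. - (1 / sqrt 2) *\<^sub>R E (n + i) x))"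

definition ubar_frame :: "nat \<Rightarrow> (nat \<Rightarrow> 'e::euclidean_space vfield) \<Rightarrow> nat \<Rightarrow> 'e vfield \<times> 'e vfield" where
  "ubar_frame n E i = (fst (u_frame n E i), (\<lambda>x. - snd (u_frame n E i) x))"

definition curvature_C ::
    "'e::euclidean_space metric \<Rightarrow> ('e vfield \<Rightarrow> 'e vfield \<Rightarrow> 'e vfield) \<Rightarrow> 'e
       \<Rightarrow> ('e vfield \<times> 'e vfield) list \<Rightarrow> complex" where
  "curvature_C h D x = complexify (\<lambda>Xs. curvature h D (Xs ! 0) (Xs ! 1) (Xs ! 2) (Xs ! 3) x)"

definition hermitian_scalar_1 ::
    "nat \<Rightarrow> 'e::euclidean_space metric \<Rightarrow> 'e endo \<Rightarrow> ('e \<Rightarrow> 'e \<Rightarrow> 'e \<Rightarrow> 'e) \<Rightarrow> (nat \<Rightarrow> 'e vfield)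
       \<Rightarrow> real \<Rightarrow> 'e \<Rightarrow> complex" where
  "hermitian_scalar_1 n h J \<Gamma> E t x = (\<Sum>i<n. \<Sum>j<n. curvature_C h (gauduchon h J \<Gamma> t) x
      [ubar_frame n E i, u_frame n E i, u_frame n E j, ubar_frame n E j])"

definition hermitian_scalar_2 ::
    "nat \<Rightarrow> 'e::euclidean_space metric \<Rightarrow> 'e endo \<Rightarrow> ('e \<Rightarrow> 'e \<Rightarrow> 'e \<Rightarrow> 'e) \<Rightarrow> (nat \<Rightarrow> 'e vfield)
       \<Rightarrow> real \<Rightarrow> 'e \<Rightarrow> complex" where
  "hermitian_scalar_2 n h J \<Gamma> E t x = (\<Sum>i<n. \<Sum>j<n. curvature_C h (gauduchon h J \<Gamma> t) x
      [ubar_frame n E i, u_frame n E j, u_frame n E i, ubar_frame n E j])"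


section \<open>Differential forms\<close>

text \<open>A \<open>k\<close>-form assigns to a point a function of lists of tangent vectors; only its values on lists
  of length \<open>k\<close> are relevant.  The degree is thus read off from the length of the argument list.\<close>

type_synonym 'e form = "'e \<Rightarrow> 'e list \<Rightarrow> real"

text \<open>Constant fields have vanishing brackets, so
  \<open>d\<omega>(v\<^sub>0,\<dots>,v\<^sub>k) = \<Sum>\<^sub>i (-1)\<^sup>i v\<^sub>i(\<omega>(\<dots>,v\<^sub>i omitted,\<dots>))\<close>; no factor \<open>1/(k+1)\<close>.\<close>

definition ext_d :: "'e::euclidean_space form \<Rightarrow> 'e form" where
  "ext_d \<omega> = (\<lambda>x vs. \<Sum>i<length vs. (-1) ^ i *
     frechet_derivative (\<lambda>y. \<omega> y (take i vs @ drop (Suc i) vs)) (at x) (vs ! i))"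

text \<open>The wedge product of a 1-form with a form of arbitrary degree; \<open>e\<^sup>1 \<and> e\<^sup>2\<close> takes the value 1 on
  \<open>(e\<^sub>1, e\<^sub>2)\<close>.\<close>

definition wedge1 :: "'e form \<Rightarrow> 'e form \<Rightarrow> 'e form" where
  "wedge1 \<phi> \<omega> = (\<lambda>x vs. \<Sum>i<length vs. (-1) ^ i *
     \<phi> x [vs ! i] * \<omega> x (take i vs @ drop (Suc i) vs))"

definition frame_list :: "(nat \<Rightarrow> 'e vfield) \<Rightarrow> nat set \<Rightarrow> 'e \<Rightarrow> 'e list" where
  "frame_list E S x = map (\<lambda>A. E A x) (sorted_list_of_set S)"

text \<open>The volume form \<open>e\<^sup>0 \<and> \<dots> \<and> e\<^bsup>2n-1\<^esup>\<close> of an orthonormal frame.  All adapted frames give the same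
  volume form.\<close>

definition vol_form :: "nat \<Rightarrow> 'e metric \<Rightarrow> (nat \<Rightarrow> 'e vfield) \<Rightarrow> 'e form" where
  "vol_form n h E = (\<lambda>x vs. \<Sum>p | p permutes {..<2*n}. of_int (sign p) *
     (\<Prod>A<2*n. h x (E A x) (vs ! p A)))"

text \<open>On basis forms this is \<open>*(e\<^bsup>S\<^esup>) = \<plusminus> e\<^bsup>S'\<^esup>\<close>, with \<open>S'\<close> the complement of \<open>S\<close> and the sign determined
  by \<open>e\<^bsup>S\<^esup> \<and> *(e\<^bsup>S\<^esup>) = vol\<close>; that is, \<open>\<alpha> \<and> *\<beta> = \<langle>\<alpha>,\<beta>\<rangle> vol\<close>.\<close>

definition hodge_star :: "nat \<Rightarrow> 'e metric \<Rightarrow> (nat \<Rightarrow> 'e vfield) \<Rightarrow> 'e form \<Rightarrow> 'e form" where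
  "hodge_star n h E \<omega> = (\<lambda>x vs. \<Sum>S | S \<subseteq> {..<2*n} \<and> card S + length vs = 2*n.
     \<omega> x (frame_list E S x) * vol_form n h E x (frame_list E S x @ vs))"

definition codiff :: "nat \<Rightarrow> 'e::euclidean_space metric \<Rightarrow> (nat \<Rightarrow> 'e vfield) \<Rightarrow> 'e form \<Rightarrow> 'e form" where
  "codiff n h E \<omega> = (\<lambda>x vs. - hodge_star n h E (ext_d (hodge_star n h E \<omega>)) x vs)"

definition form_norm_sq :: "nat \<Rightarrow> (nat \<Rightarrow> 'e vfield) \<Rightarrow> nat \<Rightarrow> 'e form \<Rightarrow> 'e \<Rightarrow> real" where
  "form_norm_sq n E k \<omega> x =
     (\<Sum>S | S \<subseteq> {..<2*n} \<and> card S = k. (\<omega> x (frame_list E S x))\<^sup>2)"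

text \<open>The projections of a real tangent vector to the \<open>\<i>\<close>- and \<open>-\<i>\<close>-eigenspaces of \<open>J\<close>.\<close>

definition proj10 :: "'e::euclidean_space endo \<Rightarrow> 'e \<Rightarrow> 'e \<Rightarrow> 'e \<times> 'e" where
  "proj10 J x v = ((1/2) *\<^sub>R v, - (1/2) *\<^sub>R J x v)"

definition proj01 :: "'e::euclidean_space endo \<Rightarrow> 'e \<Rightarrow> 'e \<Rightarrow> 'e \<times> 'e" where
  "proj01 J x v = ((1/2) *\<^sub>R v, (1/2) *\<^sub>R J x v)"

definition type_part ::
    "'e::euclidean_space endo \<Rightarrow> nat \<Rightarrow> nat \<Rightarrow> 'e form \<Rightarrow> 'e \<Rightarrow> 'e list \<Rightarrow> complex" where
  "type_part J p q \<omega> x vs = (\<Sum>S | S \<subseteq> {..<p+q} \<and> card S = p. complexify (\<omega> x)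
     (map (\<lambda>i. if i \<in> S then proj10 J x (vs ! i) else proj01 J x (vs ! i)) [0..<p+q]))"

definition fund_form :: "'e metric \<Rightarrow> 'e endo \<Rightarrow> 'e form" where
  "fund_form h J = (\<lambda>x vs. h x (J x (vs ! 0)) (vs ! 1))"

text \<open>The two sums of conjugate components of the real form \<open>dF\<close> are real, so \<open>Re\<close> only changes the
  type.\<close>

definition dF_minus :: "'e::euclidean_space metric \<Rightarrow> 'e endo \<Rightarrow> 'e form" where
  "dF_minus h J = (\<lambda>x vs. Re (type_part J 3 0 (ext_d (fund_form h J)) x vs
     + type_part J 0 3 (ext_d (fund_form h J)) x vs))"

definition dF_plus :: "'e::euclidean_space metric \<Rightarrow> 'e endo \<Rightarrow> 'e form" where
  "dF_plus h J = (\<lambda>x vs. Re (type_part J 2 1 (ext_d (fund_form h J)) x vs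
     + type_part J 1 2 (ext_d (fund_form h J)) x vs))"

definition endo_form1 :: "'e endo \<Rightarrow> 'e form \<Rightarrow> 'e form" where
  "endo_form1 J \<phi> = (\<lambda>x vs. - \<phi> x [J x (vs ! 0)])"

definition lee_form :: "nat \<Rightarrow> 'e::euclidean_space metric \<Rightarrow> 'e endo \<Rightarrow> (nat \<Rightarrow> 'e vfield) \<Rightarrow> 'e form" where
  "lee_form n h J E = endo_form1 J (codiff n h E (fund_form h J))"

definition dF_plus_prim ::
    "nat \<Rightarrow> 'e::euclidean_space metric \<Rightarrow> 'e endo \<Rightarrow> (nat \<Rightarrow> 'e vfield) \<Rightarrow> 'e form" where
  "dF_plus_prim n h J E = (\<lambda>x vs. dF_plus h J x vs
     - 1 / (real n - 1) * wedge1 (lee_form n h J E) (fund_form h J) x vs)"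


section \<open>The Nijenhuis tensor\<close>

definition nijenhuis :: "'e::euclidean_space endo \<Rightarrow> 'e vfield \<Rightarrow> 'e vfield \<Rightarrow> 'e vfield" where
  "nijenhuis J X Y = (\<lambda>x. lie_bracket X Y x + J x (lie_bracket (endo_app J X) Y x)
     + J x (lie_bracket X (endo_app J Y) x) - lie_bracket (endo_app J X) (endo_app J Y) x)"

definition nijenhuis3 ::
    "'e::euclidean_space metric \<Rightarrow> 'e endo \<Rightarrow> 'e vfield \<Rightarrow> 'e vfield \<Rightarrow> 'e vfield \<Rightarrow> 'e \<Rightarrow> real" where
  "nijenhuis3 h J X Y Z x = h x (X x) (nijenhuis J Y Z x)"

definition nijenhuis_b ::
    "'e::euclidean_space metric \<Rightarrow> 'e endo \<Rightarrow> 'e vfield \<Rightarrow> 'e vfield \<Rightarrow> 'e vfield \<Rightarrow> 'e \<Rightarrow> real" where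
  "nijenhuis_b h J X Y Z x =
     1/3 * (nijenhuis3 h J X Y Z x + nijenhuis3 h J Y Z X x + nijenhuis3 h J Z X Y x)"

definition nijenhuis_0 ::
    "'e::euclidean_space metric \<Rightarrow> 'e endo \<Rightarrow> 'e vfield \<Rightarrow> 'e vfield \<Rightarrow> 'e vfield \<Rightarrow> 'e \<Rightarrow> real" where
  "nijenhuis_0 h J X Y Z x = nijenhuis3 h J X Y Z x - nijenhuis_b h J X Y Z x"

text \<open>The inner sum is \<open>|N\<^sup>0(e\<^sub>A, e\<^sub>B)|\<^sup>2\<close>: the first slot of \<open>nijenhuis_0\<close> is the one paired with the
  vector value.\<close>

definition nijenhuis_0_norm_sq ::
    "nat \<Rightarrow> 'e::euclidean_space metric \<Rightarrow> 'e endo \<Rightarrow> (nat \<Rightarrow> 'e vfield) \<Rightarrow> 'e \<Rightarrow> real" where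
  "nijenhuis_0_norm_sq n h J E x =
     (\<Sum>B<2*n. \<Sum>A<B. \<Sum>C<2*n. (nijenhuis_0 h J (E C) (E A) (E B) x)\<^sup>2)"

end

theory Submission
  imports Defs "Jordan_Normal_Form.Determinant"
begin

text \<open>All computations take place in the adapted frame, where \<open>J\<close> has constant coefficients.  Write
  \<open>T = \<nabla>F\<close> and \<open>D\<^sup>t = \<nabla> + a\<^sup>t\<close>, with \<open>a\<^sup>t\<close> linear in \<open>T\<close>.  The real forms of the scalars are
  \<open>4 s\<^sub>1 = \<Sum> K(A, JA, B, JB)\<close> and \<open>2 s\<^sub>2 = \<Sum> K(A, B, A, B) = \<Sum> K(A, B, JA, JB)\<close>.

  For \<open>s\<^sub>2\<close> the derivatives of \<open>a\<^sup>t\<close> only enter through the divergence of its trace, which is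
  \<open>(1 + t)/2\<close> times the Lee form.  For \<open>s\<^sub>1\<close> the terms quadratic in the connection coefficients cancel,
  because these commute with \<open>J\<close>; so \<open>s\<^sub>1(t) - s\<^sub>1(0)\<close> is linear in the \<open>J\<close>-trace of \<open>a\<^sup>t\<close>, which is again
  a multiple of the Lee form.  The value \<open>s\<^sub>1(0)\<close> is compared with \<open>s\<^sub>2(0)\<close> through the first Bianchi identity
  \<open>\<Sum> R(A, JA, B, JB) = 2 \<Sum> R(A, B, JA, JB)\<close>.

  There remain quadratic expressions in \<open>T\<close>.  Split \<open>T = T\<^sup>+ + T\<^sup>-\<close> by \<open>T\<^sup>\<plusminus>(JX, JY, Z) = \<plusminus>T\<^sup>\<plusminus>(X, Y, Z)\<close>.  Then
  \<open>(dF)\<^sup>\<plusminus>\<close> is the cyclic sum of \<open>T\<^sup>\<plusminus>\<close> and \<open>N\<close> is determined by \<open>T\<^sup>-\<close>, so everything reduces to \<open>|T\<^sup>+|\<^sup>2\<close>,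
  \<open>|T\<^sup>-|\<^sup>2\<close>, \<open>\<Sum> T\<^sup>-(A, B, C) T\<^sup>-(B, C, A)\<close> and \<open>|\<alpha>\<^sub>F|\<^sup>2\<close>.\<close>

section \<open>Arrays of frame components\<close>

text \<open>Few invariants survive because a sum over the whole frame is unchanged when
  \<open>J\<close> is applied to a summation index, while the factors pick up signs dictated by
  their type. This kills every mixed contraction of T^+ with T^- and the cyclic contraction of T^+
  with itself; for T^- with itself the signs agree and nothing cancels. Write p = |T^+|^2, m =
  |T^-|^2, k for the cyclic contraction of T^-, and a = |\<alpha>_F|^2. Then |(dF)^-|^2 = m/2 + k,
  |N^0|^2 = 4(m - k)/3 and |(dF)_0^+|^2 = p/2 - a/(n-1). The coefficients of the theorem come from
  solving these: in s_2 only -k/8 occurs, which forces -1/12 and 1/32; in s_1 it is -m/8 - k/2,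
  which forces -5/12 and 1/16. The terms with 1/(n-1) undo the removal of the trace in (dF)_0^+. The
  obstacle is that connection coefficients are not tensors: their products with the torsion have to
  assemble into covariant divergences of the Lee form, and in the codifferential, which is defined
  by the Hodge star, the Christoffel symbols of the chart have to cancel.\<close>

text \<open>The almost complex structure acts on an adapted frame by \<open>J E\<^sub>A = eps A * E\<^bsub>sig A\<^esub>\<close>, so inserting
  \<open>J\<close> into a slot of an array of frame components replaces the index by its \<open>sig\<close> and produces a
  factor \<open>eps\<close>.  All identities for arrays are only claimed for indices below \<open>2 * n\<close>.\<close>

definition sig :: "nat \<Rightarrow> nat \<Rightarrow> nat" where
  "sig n A = (if A < n then n + A else A - n)"

definition eps :: "nat \<Rightarrow> nat \<Rightarrow> real" where
  "eps n A = (if A < n then 1 else -1)"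

lemma sig_less [simp]: "A < 2 * n \<Longrightarrow> sig n A < 2 * n"
  by (auto simp: sig_def)

lemma sig_less' [simp]: "A < n * 2 \<Longrightarrow> sig n A < n * 2"
  by (auto simp: sig_def)

lemma sig_sig [simp]: "A < 2 * n \<Longrightarrow> sig n (sig n A) = A"
  by (auto simp: sig_def)

lemma eps_sig [simp]: "A < 2 * n \<Longrightarrow> eps n (sig n A) = - eps n A"
  by (auto simp: sig_def eps_def)

lemma eps_mult_self [simp]: "eps n A * eps n A = 1"
  by (auto simp: eps_def)

lemma eps_mult_self_left [simp]: "eps n A * (eps n A * r) = r"
  by (auto simp: eps_def)

lemma sum_sig: "(\<Sum>A<2*n. f (sig n A)) = (\<Sum>A<2*n. f A)"
  by (rule sum.reindex_bij_witness[of _ "sig n" "sig n"]) auto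

text \<open>The substitution of \<open>J\<close> times a frame vector for that vector, with the sign
  bookkeeping left to \<open>eps\<close>. The instance \<open>g = - f\<close> makes a real sum
  vanish and is used repeatedly.\<close>

lemma sum_sig_eq:
  assumes "\<And>A. A < 2*n \<Longrightarrow> f (sig n A) = g A"
  shows "(\<Sum>A<2*n. f A) = (\<Sum>A<2*n. g A :: 'b::comm_monoid_add)"
proof -
  have "(\<Sum>A<2*n. f A) = (\<Sum>A<2*n. f (sig n A))" by (rule sum_sig [symmetric])
  also have "\<dots> = (\<Sum>A<2*n. g A)" by (rule sum.cong) (auto simp: assms)
  finally show ?thesis .
qed

definition sum3 :: "nat \<Rightarrow> (nat \<Rightarrow> nat \<Rightarrow> nat \<Rightarrow> real) \<Rightarrow> real" where
  "sum3 n f = (\<Sum>A<2*n. \<Sum>B<2*n. \<Sum>C<2*n. f A B C)"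

lemma sum3_cong:
  assumes "\<And>A B C. A < 2*n \<Longrightarrow> B < 2*n \<Longrightarrow> C < 2*n \<Longrightarrow> f A B C = g A B C"
  shows "sum3 n f = sum3 n g"
  unfolding sum3_def by (intro sum.cong refl) (use assms in auto)

lemma sum3_swap12: "sum3 n (\<lambda>A B C. f B A C) = sum3 n f"
  unfolding sum3_def by (rule sum.swap)

lemma sum3_swap23: "sum3 n (\<lambda>A B C. f A C B) = sum3 n f"
  unfolding sum3_def by (intro sum.cong refl sum.swap)

lemma sum3_cyc: "sum3 n (\<lambda>A B C. f B C A) = sum3 n f"
  using sum3_swap12[of n "\<lambda>A B C. f A C B"] sum3_swap23[of n f] by simp

lemma sum3_sig1: "sum3 n (\<lambda>A B C. f (sig n A) B C) = sum3 n f"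
  unfolding sum3_def by (rule sum_sig)

lemma sum3_sig2: "sum3 n (\<lambda>A B C. f A (sig n B) C) = sum3 n f"
  unfolding sum3_def by (intro sum.cong refl sum_sig)

lemma sum3_sig3: "sum3 n (\<lambda>A B C. f A B (sig n C)) = sum3 n f"
  unfolding sum3_def by (intro sum.cong refl sum_sig)

lemma sum3_add: "sum3 n (\<lambda>A B C. f A B C + g A B C) = sum3 n f + sum3 n g"
  by (simp add: sum3_def sum.distrib)

lemma sum3_diff: "sum3 n (\<lambda>A B C. f A B C - g A B C) = sum3 n f - sum3 n g"
  by (simp add: sum3_def sum_subtractf)

lemma sum3_cmult: "sum3 n (\<lambda>A B C. r * f A B C) = r * sum3 n f"
  by (simp add: sum3_def sum_distrib_left)

lemma sum3_minus: "sum3 n (\<lambda>A B C. - f A B C) = - sum3 n f"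
  by (simp add: sum3_def sum_negf)

lemma sum3_zero: "sum3 n (\<lambda>A B C. 0) = 0"
  by (simp add: sum3_def)

lemmas sum3_linear = sum3_add sum3_diff sum3_cmult sum3_minus sum3_zero

text \<open>The symmetries of \<open>\<nabla>F\<close>: \<open>F\<close> is skew, and the covariant
  derivative of \<open>J\<close> anticommutes with \<open>J\<close> because the square of
  \<open>J\<close> is -1. Consequently \<open>J\<close> can be moved between the last two
  slots.\<close>

locale hermitian_array =
  fixes n :: nat and P :: "nat \<Rightarrow> nat \<Rightarrow> nat \<Rightarrow> real"
  assumes skew: "\<lbrakk>A < 2*n; B < 2*n; C < 2*n\<rbrakk> \<Longrightarrow> P A C B = - P A B C"
    and anti: "\<lbrakk>A < 2*n; B < 2*n; C < 2*n\<rbrakk> \<Longrightarrow> P A (sig n B) (sig n C) = - (eps n B * eps n C * P A B C)"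
begin

lemma J_shift:
  assumes "A < 2*n" "B < 2*n" "C < 2*n"
  shows "P A (sig n B) C = eps n B * eps n C * P A B (sig n C)"
  using anti[of A B "sig n C"] assms by simp

end

text \<open>By \<open>anti\<close> the last two slots have equal complex type. For
  \<open>s = -1\<close> the first slot has this type as well, for \<open>s = 1\<close> it has the
  opposite one.\<close>

locale typed_array = hermitian_array +
  fixes s :: real
  assumes typed: "\<lbrakk>A < 2*n; B < 2*n; C < 2*n\<rbrakk> \<Longrightarrow> P (sig n A) (sig n B) C = s * (eps n A * eps n B * P A B C)"

text \<open>Putting \<open>J\<close> into the first two slots of both factors permutes the terms of
  the sum, but multiplies each of them by \<open>s * (- s) = -1\<close>.\<close>

lemma typed_array_ip_zero:
  assumes "typed_array n P s" "typed_array n Q (- s)" "s * s = 1"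
  shows "sum3 n (\<lambda>A B C. P A B C * Q A B C) = 0"
proof -
  interpret P: typed_array n P s by fact
  interpret Q: typed_array n Q "-s" by fact
  have "sum3 n (\<lambda>A B C. P A B C * Q A B C) = sum3 n (\<lambda>A B C. P (sig n A) (sig n B) C * Q (sig n A) (sig n B) C)"
    by (simp add: sum3_sig1[of n "\<lambda>A B C. P A (sig n B) C * Q A (sig n B) C"] sum3_sig2[of n "\<lambda>A B C. P A B C * Q A B C"])
  also have "\<dots> = sum3 n (\<lambda>A B C. - (P A B C * Q A B C))"
    by (rule sum3_cong) (use assms(3) in \<open>simp add: P.typed Q.typed mult_ac\<close>)
  finally show ?thesis by (simp add: sum3_minus)
qed


lemma (in typed_array) typed_shift:
  assumes "A < 2*n" "B < 2*n" "C < 2*n"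
  shows "P (sig n B) C (sig n A) = s * (eps n A * eps n B * P B C A)"
proof -
  have "P (sig n B) C (sig n A) = eps n C * eps n A * P (sig n B) (sig n C) A"
    using J_shift[of "sig n B" C A] assms by (simp add: mult_ac)
  then show ?thesis using assms by (simp add: typed mult_ac)
qed

text \<open>\<open>J\<close> is applied to the indices \<open>A\<close> and \<open>B\<close>. In
  \<open>Q B C A\<close> they occupy the third and the first slot, so \<open>J\<close> is moved from
  the third slot to the second, which is the content of \<open>typed_shift\<close>.\<close>

lemma typed_array_cyc_zero:
  assumes "typed_array n P s" "typed_array n Q (- s)" "s * s = 1"
  shows "sum3 n (\<lambda>A B C. P A B C * Q B C A) = 0"
proof -
  interpret P: typed_array n P s by fact
  interpret Q: typed_array n Q "-s" by fact
  have "sum3 n (\<lambda>A B C. P A B C * Q B C A)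
    = sum3 n (\<lambda>A B C. P (sig n A) (sig n B) C * Q (sig n B) C (sig n A))"
    by (simp add: sum3_sig1[of n "\<lambda>A B C. P A (sig n B) C * Q (sig n B) C A"]
      sum3_sig2[of n "\<lambda>A B C. P A B C * Q B C A"])
  also have "\<dots> = sum3 n (\<lambda>A B C. - (P A B C * Q B C A))"
    by (rule sum3_cong) (use assms(3) in \<open>simp add: P.typed Q.typed_shift mult_ac\<close>)
  finally show ?thesis by (simp add: sum3_minus)
qed

text \<open>\<open>J\<close> is applied to \<open>B\<close> and \<open>C\<close>. These are the last
  two slots of the first factor, which gives -1, and the first two slots of the second, which gives
  +1. For \<open>s = -1\<close> both signs are -1 and nothing follows.\<close>

lemma typed_array_cyc_zero_plus:
  assumes "typed_array n P 1"
  shows "sum3 n (\<lambda>A B C. P A B C * P B C A) = 0"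
proof -
  interpret P: typed_array n P 1 by fact
  have "sum3 n (\<lambda>A B C. P A B C * P B C A)
    = sum3 n (\<lambda>A B C. P A (sig n B) (sig n C) * P (sig n B) (sig n C) A)"
    by (simp add: sum3_sig2[of n "\<lambda>A B C. P A B (sig n C) * P B (sig n C) A"]
      sum3_sig3[of n "\<lambda>A B C. P A B C * P B C A"])
  also have "\<dots> = sum3 n (\<lambda>A B C. - (P A B C * P B C A))"
    by (rule sum3_cong) (simp add: P.typed P.anti mult_ac)
  finally show ?thesis by (simp add: sum3_minus)
qed

text \<open>If \<open>w A B C = \<langle>\<nabla>\<^bsub>E\<^sub>A\<^esub> E\<^sub>B, E\<^sub>C\<rangle>\<close>, this is \<open>(\<nabla>\<^bsub>E\<^sub>A\<^esub> F)(E\<^sub>B, E\<^sub>C)\<close>.\<close>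

definition tors :: "nat \<Rightarrow> (nat \<Rightarrow> nat \<Rightarrow> nat \<Rightarrow> real) \<Rightarrow> nat \<Rightarrow> nat \<Rightarrow> nat \<Rightarrow> real" where
  "tors n w A B C = eps n B * w A (sig n B) C + eps n C * w A B (sig n C)"

definition skew_array :: "nat \<Rightarrow> (nat \<Rightarrow> nat \<Rightarrow> nat \<Rightarrow> real) \<Rightarrow> bool" where
  "skew_array n w \<longleftrightarrow> (\<forall>A<2*n. \<forall>B<2*n. \<forall>C<2*n. w A C B = - w A B C)"

lemma skew_arrayD: "skew_array n w \<Longrightarrow> A < 2*n \<Longrightarrow> B < 2*n \<Longrightarrow> C < 2*n \<Longrightarrow> w A C B = - w A B C"
  unfolding skew_array_def by blast

lemma skew_array_add:
  assumes "skew_array n w" "skew_array n a" shows "skew_array n (\<lambda>A B C. w A B C + a A B C)"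
  unfolding skew_array_def
proof (intro allI impI)
  fix A B C assume "A < 2*n" "B < 2*n" "C < 2*n"
  then show "w A C B + a A C B = - (w A B C + a A B C)"
    using skew_arrayD[OF assms(1), of A B C] skew_arrayD[OF assms(2), of A B C] by simp
qed

lemma hermitian_array_tors:
  assumes "skew_array n w" shows "hermitian_array n (tors n w)"
proof
  fix A B C assume "A < 2*n" "B < 2*n" "C < 2*n"
  then show "tors n w A C B = - tors n w A B C"
    using skew_arrayD[OF assms, of A "sig n B" C] skew_arrayD[OF assms, of A B "sig n C"]
    by (simp add: tors_def)
next
  fix A B C assume "A < 2*n" "B < 2*n" "C < 2*n"
  then show "tors n w A (sig n B) (sig n C) = - (eps n B * eps n C * tors n w A B C)"
    by (simp add: tors_def algebra_simps)
qed

text \<open>For \<open>s = \<plusminus>1\<close>, the part on which applying \<open>J\<close> to the first two slots is multiplication by \<open>s\<close>.\<close>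

definition Jpart :: "nat \<Rightarrow> real \<Rightarrow> (nat \<Rightarrow> nat \<Rightarrow> nat \<Rightarrow> real) \<Rightarrow> nat \<Rightarrow> nat \<Rightarrow> nat \<Rightarrow> real" where
  "Jpart n s P A B C = (P A B C + s * (eps n A * eps n B * P (sig n A) (sig n B) C)) / 2"

lemma Jpart_add: "P A B C = Jpart n 1 P A B C + Jpart n (-1) P A B C"
  by (simp add: Jpart_def field_simps)

text \<open>Applying \<open>J\<close> to the first two slots is an involution on hermitian arrays,
  since \<open>J\<close> may be moved from the second slot to the third. \<open>Jpart n s\<close> is
  the projection to its eigenspace for \<open>s\<close>.\<close>

lemma (in hermitian_array) typed_array_Jpart:
  assumes "s * s = 1" shows "typed_array n (Jpart n s P) s"
proof
  fix A B C assume "A < 2*n" "B < 2*n" "C < 2*n"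
  note r = this
  have "P (sig n A) (sig n C) B = - P (sig n A) B (sig n C)"
    using skew[of "sig n A" B "sig n C"] r by simp
  also have "\<dots> = - (eps n B * eps n C * P (sig n A) (sig n B) C)"
    using J_shift[of "sig n A" B C] r by (simp add: mult_ac)
  finally show "Jpart n s P A C B = - Jpart n s P A B C"
    using r by (simp add: Jpart_def skew[of A B C] algebra_simps)
  have "P (sig n A) B (sig n C) = eps n B * eps n C * P (sig n A) (sig n B) C"
    using J_shift[of "sig n A" B C] r by (simp add: mult_ac)
  then show "Jpart n s P A (sig n B) (sig n C) = - (eps n B * eps n C * Jpart n s P A B C)"
    using r by (simp add: Jpart_def anti algebra_simps)
  show "Jpart n s P (sig n A) (sig n B) C = s * (eps n A * eps n B * Jpart n s P A B C)"
    using r assms by (simp add: Jpart_def algebra_simps)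
qed

text \<open>The difference tensor \<open>\<langle>D\<^sup>t\<^sub>X Y - \<nabla>\<^sub>X Y, Z\<rangle>\<close> in terms of \<open>T = \<nabla>F\<close>; \<open>gau\<close> are the connection
  coefficients of \<open>D\<^sup>t\<close>.\<close>

definition ators :: "nat \<Rightarrow> real \<Rightarrow> (nat \<Rightarrow> nat \<Rightarrow> nat \<Rightarrow> real) \<Rightarrow> nat \<Rightarrow> nat \<Rightarrow> nat \<Rightarrow> real" where
  "ators n t T A B C = 1/2 * (eps n C * T A B (sig n C)) + t/4 *
     (eps n B * T (sig n B) C A - eps n A * T B C (sig n A)
      - eps n C * T (sig n C) B A + eps n A * T C B (sig n A))"

definition gau :: "nat \<Rightarrow> real \<Rightarrow> (nat \<Rightarrow> nat \<Rightarrow> nat \<Rightarrow> real) \<Rightarrow> nat \<Rightarrow> nat \<Rightarrow> nat \<Rightarrow> real" where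
  "gau n t w A B C = w A B C + ators n t (tors n w) A B C"

text \<open>The Lee form: \<delta>F has the components \<open>- (\<Sum>A<2*n. T A A B)\<close>, and
  \<alpha>_F is minus its value on \<open>J\<close> times the vector. The agreement with the
  definition by the Hodge star is \<open>lee_form_frame\<close>.\<close>

definition lee :: "nat \<Rightarrow> (nat \<Rightarrow> nat \<Rightarrow> nat \<Rightarrow> real) \<Rightarrow> nat \<Rightarrow> real" where
  "lee n T B = (\<Sum>A<2*n. eps n B * T A A (sig n B))"

context hermitian_array
begin

lemma skew_ators: "skew_array n (ators n t P)"
  unfolding skew_array_def
proof (intro allI impI)
  fix A B C assume r: "A < 2*n" "B < 2*n" "C < 2*n"
  have "P A C (sig n B) = - (eps n B * eps n C * P A B (sig n C))"
    using J_shift[of A B C] skew[of A C "sig n B"] r by simp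
  then have "eps n B * P A C (sig n B) = - (eps n C * P A B (sig n C))"
    by (simp add: mult_ac)
  then show "ators n t P A C B = - ators n t P A B C"
    by (simp add: ators_def algebra_simps)
qed

lemma trace_sig_zero:
  assumes "A < 2*n" shows "(\<Sum>B<2*n. eps n B * P A B (sig n B)) = 0"
proof -
  have "(\<Sum>B<2*n. eps n B * P A B (sig n B)) = (\<Sum>B<2*n. - (eps n B * P A B (sig n B)))"
  proof (rule sum_sig_eq)
    fix B assume "B < 2*n"
    then show "eps n (sig n B) * P A (sig n B) (sig n (sig n B)) = - (eps n B * P A B (sig n B))"
      using anti[of A B "sig n B"] assms by simp
  qed
  then show ?thesis unfolding sum_negf by linarith
qed


lemma trace_sig:
  assumes "A < 2*n" shows "(\<Sum>B<2*n. P B B A) = - (eps n A * lee n P (sig n A))"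
  using assms by (simp add: lee_def sum_distrib_left sum_negf)

lemma trace_sig1:
  assumes "A < 2*n" shows "(\<Sum>B<2*n. eps n B * P (sig n B) A B) = lee n P A"
  unfolding lee_def
proof (rule sum_sig_eq)
  fix B assume r: "B < 2*n"
  have "eps n B * P B A (sig n B) = eps n A * P B (sig n A) B"
    using J_shift[of B A B] assms r by (simp add: mult_ac)
  also have "\<dots> = - (eps n A * P B B (sig n A))"
    using skew[of B B "sig n A"] assms r by simp
  finally show "eps n (sig n B) * P (sig n (sig n B)) A (sig n B) = eps n A * P B B (sig n A)"
    using r by simp
qed

lemma trace_sig2:
  assumes "A < 2*n" shows "(\<Sum>B<2*n. eps n B * P B A (sig n B)) = - lee n P A"
proof -
  have "(\<Sum>B<2*n. eps n B * P (sig n B) A B) = (\<Sum>B<2*n. - (eps n B * P B A (sig n B)))"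
    by (rule sum_sig_eq) simp
  then show ?thesis using trace_sig1[OF assms] unfolding sum_negf by linarith
qed

lemma trace_sig3:
  assumes "A < 2*n" shows "(\<Sum>B<2*n. eps n B * P (sig n B) B A) = - lee n P A"
proof -
  have "(\<Sum>B<2*n. eps n B * P (sig n B) B A) = (\<Sum>B<2*n. - (eps n B * P (sig n B) A B))"
  proof (rule sum.cong)
    fix B assume "B \<in> {..<2*n}"
    then show "eps n B * P (sig n B) B A = - (eps n B * P (sig n B) A B)"
      using skew[of "sig n B" A B] assms by simp
  qed simp
  then show ?thesis using trace_sig1[OF assms] unfolding sum_negf by linarith
qed

text \<open>The summand without \<open>t\<close> contributes half the Lee form. Of the four summands
  with \<open>t/4\<close>, two contribute the Lee form each; of the others, one vanishes by skewness
  and one by \<open>trace_sig_zero\<close>.\<close>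

lemma trace_ators:
  assumes "A < 2*n" shows "(\<Sum>B<2*n. ators n t P B B A) = (1 + t) / 2 * lee n P A"
proof -
  have 0: "P (sig n A) B B = 0" if "B < 2*n" for B
    using skew[of "sig n A" B B] assms that by simp
  have "(\<Sum>B<2*n. ators n t P B B A) = 1/2 * (\<Sum>B<2*n. eps n A * P B B (sig n A))
     + t/4 * ((\<Sum>B<2*n. eps n B * P (sig n B) A B) - (\<Sum>B<2*n. eps n B * P B A (sig n B))
      - (\<Sum>B<2*n. eps n A * P (sig n A) B B) + (\<Sum>B<2*n. eps n B * P A B (sig n B)))"
    by (simp only: ators_def sum.distrib sum_subtractf sum_distrib_left [symmetric])
  also have "\<dots> = (1 + t) / 2 * lee n P A"
  proof -
    have "(\<Sum>B<2*n. eps n A * P (sig n A) B B) = 0"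
      by (rule sum.neutral) (simp add: 0)
    then show ?thesis
      unfolding trace_sig1[OF assms] trace_sig2[OF assms] trace_sig_zero[OF assms] lee_def[symmetric]
      by (simp add: field_simps)
  qed
  finally show ?thesis .
qed

text \<open>The summand of \<open>ators\<close> without \<open>t\<close> drops out because it has
  the same index in both skew slots. The four summands with \<open>t/4\<close> contribute equally,
  so the trace is linear in \<open>t\<close>.\<close>

lemma trace_J_ators:
  assumes "K < 2*n"
  shows "(\<Sum>A<2*n. eps n A * ators n t P K (sig n A) A) = t * (eps n K * lee n P (sig n K))"
proof -
  have 0: "P K (sig n A) (sig n A) = 0" if "A < 2*n" for A
    using skew[of K "sig n A" "sig n A"] assms that by simp
  have 1: "P A (sig n A) (sig n K) = - (eps n A * eps n K * P A A K)" if "A < 2*n" for A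
    using anti[of A A K] assms that by simp
  have "(\<Sum>A<2*n. eps n A * ators n t P K (sig n A) A)
    = (\<Sum>A<2*n. t/4 * (- P A A K - eps n K * (eps n A * P (sig n A) A (sig n K))
       - P (sig n A) (sig n A) K - P A A K))"
    by (rule sum.cong) (auto simp: ators_def 0 1 algebra_simps)
  also have "\<dots> = t/4 * (- (\<Sum>A<2*n. P A A K) - eps n K * (\<Sum>A<2*n. eps n A * P (sig n A) A (sig n K))
       - (\<Sum>A<2*n. P (sig n A) (sig n A) K) - (\<Sum>A<2*n. P A A K))"
    by (simp add: sum_distrib_left sum.distrib sum_subtractf sum_negf algebra_simps)
  also have "\<dots> = t * (eps n K * lee n P (sig n K))"
    using assms by (simp add: sum_sig[of "\<lambda>A. P A A K"] trace_sig trace_sig3)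
  finally show ?thesis .
qed

end

section \<open>Traces of the curvature\<close>

text \<open>The components \<open>K(E\<^sub>A, E\<^sub>B, E\<^sub>C, E\<^sub>D)\<close> for a connection with coefficients \<open>g\<close>, where \<open>dg D A B C\<close> stands
  for the derivative of \<open>g A B C\<close> along \<open>E\<^sub>D\<close>.  The Levi-Civita coefficients \<open>w\<close> enter through the
  bracket \<open>[E\<^sub>C, E\<^sub>D]\<close>.\<close>

definition curv :: "nat \<Rightarrow> (nat \<Rightarrow> nat \<Rightarrow> nat \<Rightarrow> real) \<Rightarrow> (nat \<Rightarrow> nat \<Rightarrow> nat \<Rightarrow> real)
    \<Rightarrow> (nat \<Rightarrow> nat \<Rightarrow> nat \<Rightarrow> nat \<Rightarrow> real) \<Rightarrow> nat \<Rightarrow> nat \<Rightarrow> nat \<Rightarrow> nat \<Rightarrow> real" where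
  "curv n w g dg A B C D = dg C D B A - dg D C B A +
     (\<Sum>K<2*n. g D B K * g C K A - g C B K * g D K A - (w C D K - w D C K) * g K B A)"

text \<open>The divergence of the 1-form with frame components \<open>v\<close>, where
  \<open>dv D A\<close> stands for the derivative of \<open>v A\<close> along the frame vector with
  index \<open>D\<close>.\<close>

definition dvg :: "nat \<Rightarrow> (nat \<Rightarrow> nat \<Rightarrow> nat \<Rightarrow> real) \<Rightarrow> (nat \<Rightarrow> real) \<Rightarrow> (nat \<Rightarrow> nat \<Rightarrow> real) \<Rightarrow> real" where
  "dvg n w v dv = (\<Sum>A<2*n. dv A A) - (\<Sum>A<2*n. \<Sum>B<2*n. w A A B * v B)"

definition atr :: "nat \<Rightarrow> (nat \<Rightarrow> nat \<Rightarrow> nat \<Rightarrow> real) \<Rightarrow> nat \<Rightarrow> real" where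
  "atr n g A = (\<Sum>B<2*n. g B B A)"

lemma atr_add: "atr n (\<lambda>A B C. g A B C + h A B C) A = atr n g A + atr n h A"
  by (simp add: atr_def sum.distrib)

lemma sum3_trace_prod:
  "sum3 n (\<lambda>A B C. g B B C * h A A C) = (\<Sum>C<2*n. atr n g C * atr n h C)"
proof -
  have "sum3 n (\<lambda>A B C. g B B C * h A A C) = sum3 n (\<lambda>A B C. g A A C * h B B C)"
    by (rule sum3_swap12[of n "\<lambda>A B C. g A A C * h B B C"])
  also have "\<dots> = sum3 n (\<lambda>A B C. g B B A * h C C A)"
    by (rule sum3_cyc[of n "\<lambda>A B C. g A A C * h B B C", symmetric])
  finally show ?thesis
    by (simp add: sum3_def atr_def sum_product)
qed

lemma curv_trace:
  assumes g: "skew_array n g" and dg: "\<And>D. D < 2*n \<Longrightarrow> skew_array n (dg D)"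
  shows "(\<Sum>A<2*n. \<Sum>B<2*n. curv n w g dg A B A B) = 2 * (\<Sum>A<2*n. atr n (dg A) A)
    - (\<Sum>C<2*n. atr n g C * atr n g C) - sum3 n (\<lambda>A B C. g A B C * g B C A)
    - sum3 n (\<lambda>A B C. (w A B C - w B A C) * g C B A)"
proof -
  have d: "(\<Sum>A<2*n. \<Sum>B<2*n. dg B A B A) = - (\<Sum>A<2*n. \<Sum>B<2*n. dg A B B A)"
  proof -
    have "(\<Sum>A<2*n. \<Sum>B<2*n. dg B A B A) = (\<Sum>A<2*n. \<Sum>B<2*n. dg A B A B)" by (rule sum.swap)
    also have "\<dots> = (\<Sum>A<2*n. \<Sum>B<2*n. - dg A B B A)"
      by (intro sum.cong refl) (use skew_arrayD[OF dg] in \<open>metis lessThan_iff\<close>)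
    finally show ?thesis by (simp add: sum_negf)
  qed
  have t: "sum3 n (\<lambda>A B C. g B B C * g A C A) = - (\<Sum>C<2*n. atr n g C * atr n g C)"
    unfolding sum3_trace_prod [symmetric] sum3_minus [symmetric]
    by (rule sum3_cong) (use skew_arrayD[OF g] in \<open>metis mult_minus_right\<close>)
  have "(\<Sum>A<2*n. \<Sum>B<2*n. curv n w g dg A B A B)
    = (\<Sum>A<2*n. \<Sum>B<2*n. dg A B B A) - (\<Sum>A<2*n. \<Sum>B<2*n. dg B A B A)
     + sum3 n (\<lambda>A B C. g B B C * g A C A) - sum3 n (\<lambda>A B C. g A B C * g B C A)
     - sum3 n (\<lambda>A B C. (w A B C - w B A C) * g C B A)"
    by (simp add: curv_def sum3_def sum.distrib sum_subtractf)
  then show ?thesis unfolding d t by (simp add: atr_def)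
qed

text \<open>In the expansion of \<open>curv_trace\<close>, the mixed products of \<open>w\<close>
  and \<open>a\<close> other than products of traces are all, up to sign, the sum over
  \<open>w A B C * a C A B\<close>, and they cancel. The product of the traces of \<open>w\<close>
  and \<open>a\<close> that remains is the connection term in the divergence of
  \<open>atr n a\<close>.\<close>

lemma curv_trace_add:
  assumes w: "skew_array n w" and a: "skew_array n a"
    and dw: "\<And>D. D < 2*n \<Longrightarrow> skew_array n (dw D)" and da: "\<And>D. D < 2*n \<Longrightarrow> skew_array n (da D)"
  shows "(\<Sum>A<2*n. \<Sum>B<2*n. curv n w (\<lambda>A B C. w A B C + a A B C) (\<lambda>D A B C. dw D A B C + da D A B C) A B A B)
    = (\<Sum>A<2*n. \<Sum>B<2*n. curv n w w dw A B A B) + 2 * dvg n w (atr n a) (\<lambda>D. atr n (da D))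
     - (\<Sum>C<2*n. atr n a C * atr n a C) - sum3 n (\<lambda>A B C. a A B C * a B C A)"
proof -
  have 1: "sum3 n (\<lambda>A B C. w A B C * a B C A) = sum3 n (\<lambda>A B C. w A B C * a C A B)"
  proof -
    have "sum3 n (\<lambda>A B C. w A B C * a B C A) = sum3 n (\<lambda>A B C. w A C B * a C B A)"
      by (rule sum3_swap23 [symmetric])
    also have "\<dots> = sum3 n (\<lambda>A B C. w A B C * a C A B)"
    proof (rule sum3_cong)
      fix A B C assume r: "A < 2*n" "B < 2*n" "C < 2*n"
      show "w A C B * a C B A = w A B C * a C A B"
        using skew_arrayD[OF w, of A B C] skew_arrayD[OF a, of C A B] r by simp
    qed
    finally show ?thesis .
  qed
  have 2: "sum3 n (\<lambda>A B C. a A B C * w B C A) = sum3 n (\<lambda>A B C. w A B C * a C A B)"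
    using sum3_cyc[of n "\<lambda>A B C. w A B C * a C A B"] by (simp add: mult.commute)
  have 3: "sum3 n (\<lambda>A B C. w A B C * a C B A) = - sum3 n (\<lambda>A B C. w A B C * a C A B)"
    unfolding sum3_minus [symmetric]
  proof (rule sum3_cong)
    fix A B C assume r: "A < 2*n" "B < 2*n" "C < 2*n"
    show "w A B C * a C B A = - (w A B C * a C A B)"
      using skew_arrayD[OF a, of C A B] r by simp
  qed
  have 4: "sum3 n (\<lambda>A B C. w B A C * a C B A) = sum3 n (\<lambda>A B C. w A B C * a C A B)"
    using sum3_swap12[of n "\<lambda>A B C. w A B C * a C A B"] .
  have g: "skew_array n (\<lambda>A B C. w A B C + a A B C)"
    by (rule skew_array_add[OF w a])
  have dg: "skew_array n (\<lambda>A B C. dw D A B C + da D A B C)" if "D < 2*n" for D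
    by (rule skew_array_add[OF dw[OF that] da[OF that]])
  have e1: "sum3 n (\<lambda>A B C. (w A B C + a A B C) * (w B C A + a B C A))
    = sum3 n (\<lambda>A B C. w A B C * w B C A) + sum3 n (\<lambda>A B C. w A B C * a B C A)
     + sum3 n (\<lambda>A B C. a A B C * w B C A) + sum3 n (\<lambda>A B C. a A B C * a B C A)"
    by (simp add: sum3_add [symmetric] distrib_left distrib_right add_ac)
  have e2: "sum3 n (\<lambda>A B C. (w A B C - w B A C) * (w C B A + a C B A))
    = sum3 n (\<lambda>A B C. (w A B C - w B A C) * w C B A)
     + sum3 n (\<lambda>A B C. w A B C * a C B A) - sum3 n (\<lambda>A B C. w B A C * a C B A)"
    by (simp add: sum3_add [symmetric] sum3_diff [symmetric] algebra_simps)
  have e3: "(\<Sum>C<2*n. atr n (\<lambda>A B C. w A B C + a A B C) C * atr n (\<lambda>A B C. w A B C + a A B C) C)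
    = (\<Sum>C<2*n. atr n w C * atr n w C) + 2 * (\<Sum>C<2*n. atr n w C * atr n a C) + (\<Sum>C<2*n. atr n a C * atr n a C)"
    by (simp add: atr_add sum.distrib sum_distrib_left algebra_simps)
  have e4: "(\<Sum>A<2*n. atr n (\<lambda>B C D. dw A B C D + da A B C D) A)
     = (\<Sum>A<2*n. atr n (dw A) A) + (\<Sum>A<2*n. atr n (da A) A)"
    by (simp add: atr_add sum.distrib)
  have e5: "(\<Sum>A<2*n. \<Sum>B<2*n. w A A B * atr n a B) = (\<Sum>C<2*n. atr n w C * atr n a C)"
    by (subst sum.swap) (simp add: atr_def[of n w] sum_distrib_right)
  have c: "(\<Sum>A<2*n. \<Sum>B<2*n. curv n w (\<lambda>A B C. w A B C + a A B C) (\<lambda>D A B C. dw D A B C + da D A B C) A B A B)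
    = 2 * (\<Sum>A<2*n. atr n (\<lambda>B C D. dw A B C D + da A B C D) A)
     - (\<Sum>C<2*n. atr n (\<lambda>A B C. w A B C + a A B C) C * atr n (\<lambda>A B C. w A B C + a A B C) C)
     - sum3 n (\<lambda>A B C. (w A B C + a A B C) * (w B C A + a B C A))
     - sum3 n (\<lambda>A B C. (w A B C - w B A C) * (w C B A + a C B A))"
    by (rule curv_trace[OF g dg])
  have c0: "(\<Sum>A<2*n. \<Sum>B<2*n. curv n w w dw A B A B) = 2 * (\<Sum>A<2*n. atr n (dw A) A)
    - (\<Sum>C<2*n. atr n w C * atr n w C) - sum3 n (\<lambda>A B C. w A B C * w B C A)
    - sum3 n (\<lambda>A B C. (w A B C - w B A C) * w C B A)"
    by (rule curv_trace[OF w dw])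
  show ?thesis
    unfolding c c0 dvg_def e1 e2 e3 e4 e5 1 2 3 4
    by (simp add: right_diff_distrib)
qed

lemma sum3_swap13: "sum3 n (\<lambda>A B C. f C B A) = sum3 n f"
  using sum3_swap12[of n "\<lambda>A B C. f C A B"] sum3_cyc[of n "\<lambda>A B C. f C A B"] by simp

text \<open>For a connection preserving \<open>J\<close> these are \<open>4 s\<^sub>1\<close> and \<open>2 s\<^sub>2\<close>; for the Levi-Civita connection they are
  related by the first Bianchi identity.\<close>

definition ricJ :: "nat \<Rightarrow> (nat \<Rightarrow> nat \<Rightarrow> nat \<Rightarrow> real) \<Rightarrow> (nat \<Rightarrow> nat \<Rightarrow> nat \<Rightarrow> real)
    \<Rightarrow> (nat \<Rightarrow> nat \<Rightarrow> nat \<Rightarrow> nat \<Rightarrow> real) \<Rightarrow> real" where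
  "ricJ n w g dg = (\<Sum>A<2*n. \<Sum>B<2*n. eps n A * eps n B * curv n w g dg A (sig n A) B (sig n B))"

definition starJ :: "nat \<Rightarrow> (nat \<Rightarrow> nat \<Rightarrow> nat \<Rightarrow> real) \<Rightarrow> (nat \<Rightarrow> nat \<Rightarrow> nat \<Rightarrow> real)
    \<Rightarrow> (nat \<Rightarrow> nat \<Rightarrow> nat \<Rightarrow> nat \<Rightarrow> real) \<Rightarrow> real" where
  "starJ n w g dg = (\<Sum>A<2*n. \<Sum>B<2*n. eps n A * eps n B * curv n w g dg A B (sig n A) (sig n B))"

text \<open>The quadratic part of \<open>ricJ\<close>.  It is a sum of traces of \<open>[g\<^bsub>B\<^esub>, g\<^bsub>JB\<^esub>] J\<close>, hence vanishes if \<open>g\<close>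
  commutes with \<open>J\<close>.\<close>

definition Om :: "nat \<Rightarrow> (nat \<Rightarrow> nat \<Rightarrow> nat \<Rightarrow> real) \<Rightarrow> (nat \<Rightarrow> nat \<Rightarrow> nat \<Rightarrow> real) \<Rightarrow> real" where
  "Om n g h = sum3 n (\<lambda>A B C. eps n A * eps n B * (g B (sig n A) C * h (sig n B) C A))"

definition phi :: "nat \<Rightarrow> (nat \<Rightarrow> nat \<Rightarrow> nat \<Rightarrow> real) \<Rightarrow> nat \<Rightarrow> real" where
  "phi n g K = (\<Sum>A<2*n. eps n A * g K (sig n A) A)"

text \<open>Exchanging \<open>B\<close> with \<open>sig n B\<close> identifies the two derivative
  terms, the two quadratic terms and the two bracket terms with each other up to sign, whence the
  factors 2.\<close>

lemma ricJ_eq: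
  "ricJ n w g dg = 2 * (\<Sum>B<2*n. eps n B * phi n (dg B) (sig n B))
     - 2 * (\<Sum>B<2*n. \<Sum>K<2*n. eps n B * w B (sig n B) K * phi n g K) - 2 * Om n g g"
proof -
  have d: "(\<Sum>A<2*n. \<Sum>B<2*n. eps n A * eps n B * dg (sig n B) B (sig n A) A)
     = - (\<Sum>A<2*n. \<Sum>B<2*n. eps n A * eps n B * dg B (sig n B) (sig n A) A)"
    unfolding sum_negf [symmetric] by (intro sum.cong refl sum_sig_eq) simp
  have o: "sum3 n (\<lambda>A B K. eps n A * eps n B * (g (sig n B) (sig n A) K * g B K A)) = - Om n g g"
    unfolding Om_def sum3_def sum_negf [symmetric] by (intro sum.cong refl sum_sig_eq) simp
  have c: "sum3 n (\<lambda>A B K. eps n A * eps n B * (w (sig n B) B K * g K (sig n A) A))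
    = - sum3 n (\<lambda>A B K. eps n A * eps n B * (w B (sig n B) K * g K (sig n A) A))"
    unfolding sum3_def sum_negf [symmetric] by (intro sum.cong refl sum_sig_eq) simp
  have c': "sum3 n (\<lambda>A B K. eps n A * eps n B * (w B (sig n B) K * g K (sig n A) A))
    = (\<Sum>B<2*n. \<Sum>K<2*n. eps n B * w B (sig n B) K * phi n g K)"
  proof -
    have "sum3 n (\<lambda>A B K. eps n A * eps n B * (w B (sig n B) K * g K (sig n A) A))
      = sum3 n (\<lambda>A B K. eps n K * eps n A * (w A (sig n A) B * g B (sig n K) K))"
      by (rule sum3_cyc[of n "\<lambda>A B K. eps n K * eps n A * (w A (sig n A) B * g B (sig n K) K)"])
    then show ?thesis by (simp add: sum3_def phi_def sum_distrib_left mult_ac)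
  qed
  have d': "(\<Sum>A<2*n. \<Sum>B<2*n. eps n A * eps n B * dg B (sig n B) (sig n A) A)
    = (\<Sum>B<2*n. eps n B * phi n (dg B) (sig n B))"
    by (subst sum.swap) (simp add: phi_def sum_distrib_left mult_ac)
  have "ricJ n w g dg = (\<Sum>A<2*n. \<Sum>B<2*n. eps n A * eps n B * dg B (sig n B) (sig n A) A)
    - (\<Sum>A<2*n. \<Sum>B<2*n. eps n A * eps n B * dg (sig n B) B (sig n A) A)
    + sum3 n (\<lambda>A B K. eps n A * eps n B * (g (sig n B) (sig n A) K * g B K A))
    - sum3 n (\<lambda>A B K. eps n A * eps n B * (g B (sig n A) K * g (sig n B) K A))
    - sum3 n (\<lambda>A B K. eps n A * eps n B * (w B (sig n B) K * g K (sig n A) A))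
    + sum3 n (\<lambda>A B K. eps n A * eps n B * (w (sig n B) B K * g K (sig n A) A))"
    by (simp add: ricJ_def curv_def sum3_def sum.distrib sum_subtractf ring_distribs sum_distrib_left mult.assoc)
  then show ?thesis
    unfolding d o c c' d' Om_def [symmetric] by linarith
qed

text \<open>For \<open>r = 1\<close> the endomorphisms given by the last two slots commute with
  \<open>J\<close>, for \<open>r = -1\<close> they anticommute with it.\<close>

definition J_comm :: "nat \<Rightarrow> real \<Rightarrow> (nat \<Rightarrow> nat \<Rightarrow> nat \<Rightarrow> real) \<Rightarrow> bool" where
  "J_comm n r g \<longleftrightarrow> (\<forall>A<2*n. \<forall>B<2*n. \<forall>C<2*n. g A (sig n B) (sig n C) = r * (eps n B * eps n C * g A B C))"

lemma J_commD:
  "J_comm n r g \<Longrightarrow> A < 2*n \<Longrightarrow> B < 2*n \<Longrightarrow> C < 2*n \<Longrightarrow> g A (sig n B) (sig n C) = r * (eps n B * eps n C * g A B C)"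
  unfolding J_comm_def by blast

text \<open>For fixed \<open>B\<close>, the sum over \<open>A\<close> and \<open>C\<close> is a
  trace of \<open>J\<close> times two endomorphisms. Conjugation with \<open>J\<close> preserves the
  trace and multiplies it by \<open>r * s\<close>.\<close>

lemma Om_zero_mixed:
  assumes g: "J_comm n r g" and h: "J_comm n s h" and rs: "r * s = -1"
  shows "Om n g h = 0"
proof -
  have "Om n g h = sum3 n (\<lambda>A B C. - (eps n A * eps n B * (g B A (sig n C) * h (sig n B) (sig n C) (sig n A))))"
    unfolding Om_def sum3_def
    by (rule sum_sig_eq, rule sum.cong[OF refl], rule sum_sig_eq) simp
  also have "\<dots> = - Om n g h"
    unfolding Om_def sum3_minus [symmetric]
  proof (rule sum3_cong)
    fix A B C assume r: "A < 2*n" "B < 2*n" "C < 2*n"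
    have 1: "g B A (sig n C) = - (r * (eps n A * eps n C * g B (sig n A) C))"
      using J_commD[OF g, of B "sig n A" C] r by simp
    have 2: "h (sig n B) (sig n C) (sig n A) = s * (eps n C * eps n A * h (sig n B) C A)"
      using J_commD[OF h, of "sig n B" C A] r by simp
    have "- (eps n A * eps n B * (g B A (sig n C) * h (sig n B) (sig n C) (sig n A)))
      = (r * s) * (eps n A * eps n B * (g B (sig n A) C * h (sig n B) C A))"
      unfolding 1 2 by (simp add: mult_ac)
    then show "- (eps n A * eps n B * (g B A (sig n C) * h (sig n B) (sig n C) (sig n A)))
      = - (eps n A * eps n B * (g B (sig n A) C * h (sig n B) C A))"
      unfolding rs by simp
  qed
  finally show ?thesis by linarith
qed

text \<open>Exchanging \<open>B\<close> with \<open>sig n B\<close> interchanges the two factors at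
  the cost of a sign. Cyclicity of the trace, together with commutation with \<open>J\<close>,
  interchanges them without a sign.\<close>

lemma Om_zero:
  assumes g: "J_comm n 1 g"
  shows "Om n g g = 0"
proof -
  have 1: "Om n g g = - sum3 n (\<lambda>A B C. eps n A * eps n B * (g (sig n B) (sig n A) C * g B C A))"
    unfolding Om_def sum3_def sum_negf [symmetric]
    by (intro sum.cong refl sum_sig_eq) simp
  have "Om n g g = sum3 n (\<lambda>A B C. eps n C * eps n B * (g B (sig n C) A * g (sig n B) A C))"
    unfolding Om_def by (rule sum3_swap13 [symmetric])
  also have "\<dots> = sum3 n (\<lambda>A B C. - (eps n A * eps n B * (g B C (sig n A) * g (sig n B) A C)))"
  proof (rule sum3_cong)
    fix A B C assume r: "A < 2*n" "B < 2*n" "C < 2*n"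
    show "eps n C * eps n B * (g B (sig n C) A * g (sig n B) A C) = - (eps n A * eps n B * (g B C (sig n A) * g (sig n B) A C))"
      using J_commD[OF g, of B C "sig n A"] r by (simp add: mult_ac)
  qed
  also have "\<dots> = sum3 n (\<lambda>A B C. eps n A * eps n B * (g B C A * g (sig n B) (sig n A) C))"
    unfolding sum3_def by (rule sum_sig_eq) simp
  finally show ?thesis using 1 by (simp add: mult_ac)
qed

lemma curv_J_comm:
  assumes g: "J_comm n 1 g" and dg: "\<And>D. D < 2*n \<Longrightarrow> J_comm n 1 (dg D)"
    and r: "A < 2*n" "B < 2*n" "C < 2*n" "D < 2*n"
  shows "curv n w g dg (sig n A) (sig n B) C D = eps n A * eps n B * curv n w g dg A B C D"
proof -
  have "(\<Sum>K<2*n. g D (sig n B) K * g C K (sig n A) - g C (sig n B) K * g D K (sig n A)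
       - (w C D K - w D C K) * g K (sig n B) (sig n A))
    = (\<Sum>K<2*n. g D (sig n B) K * g C K (sig n A) - g C (sig n B) K * g D K (sig n A))
       - (\<Sum>K<2*n. (w C D K - w D C K) * g K (sig n B) (sig n A))"
    by (simp add: sum_subtractf)
  also have "(\<Sum>K<2*n. g D (sig n B) K * g C K (sig n A) - g C (sig n B) K * g D K (sig n A))
    = (\<Sum>K<2*n. eps n A * eps n B * (g D B K * g C K A - g C B K * g D K A))"
    by (rule sum_sig_eq) (use r in \<open>simp add: J_commD[OF g] algebra_simps\<close>)
  also have "(\<Sum>K<2*n. (w C D K - w D C K) * g K (sig n B) (sig n A))
    = (\<Sum>K<2*n. eps n A * eps n B * ((w C D K - w D C K) * g K B A))"
    by (rule sum.cong) (use r in \<open>auto simp: J_commD[OF g] mult_ac\<close>)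
  finally have e: "(\<Sum>K<2*n. g D (sig n B) K * g C K (sig n A) - g C (sig n B) K * g D K (sig n A)
       - (w C D K - w D C K) * g K (sig n B) (sig n A))
    = (\<Sum>K<2*n. eps n A * eps n B * (g D B K * g C K A - g C B K * g D K A))
       - (\<Sum>K<2*n. eps n A * eps n B * ((w C D K - w D C K) * g K B A))" .
  show ?thesis
    unfolding curv_def e using r
    by (simp add: J_commD[OF dg] sum_subtractf sum_distrib_left right_diff_distrib distrib_left mult_ac)
qed

lemma starJ_J_comm:
  assumes g: "J_comm n 1 g" and dg: "\<And>D. D < 2*n \<Longrightarrow> J_comm n 1 (dg D)"
  shows "starJ n w g dg = (\<Sum>A<2*n. \<Sum>B<2*n. curv n w g dg A B A B)"
proof -
  have "starJ n w g dg = (\<Sum>A<2*n. \<Sum>B<2*n. eps n A * eps n B * curv n w g dg (sig n A) (sig n B) A B)"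
    unfolding starJ_def by (rule sum_sig_eq, rule sum_sig_eq) simp
  also have "\<dots> = (\<Sum>A<2*n. \<Sum>B<2*n. curv n w g dg A B A B)"
    by (intro sum.cong refl) (simp add: curv_J_comm[OF g dg] mult_ac)
  finally show ?thesis .
qed

text \<open>\<open>D^t\<close> preserves \<open>J\<close> for two separate reasons: the summand
  without \<open>t\<close> replaces \<open>w\<close> by its part commuting with \<open>J\<close>,
  and the bracket multiplied by \<open>t/4\<close> commutes with \<open>J\<close> on its
  own.\<close>

lemma J_comm_gau:
  assumes "skew_array n w" shows "J_comm n 1 (gau n t w)"
  unfolding J_comm_def
proof (intro allI impI)
  interpret T: hermitian_array n "tors n w" by (rule hermitian_array_tors[OF assms])
  fix A B C assume r: "A < 2*n" "B < 2*n" "C < 2*n"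
  have 1: "w A (sig n B) (sig n C) + 1/2 * (eps n (sig n C) * tors n w A (sig n B) (sig n (sig n C)))
    = eps n B * eps n C * (w A B C + 1/2 * (eps n C * tors n w A B (sig n C)))"
    using r by (simp add: tors_def field_simps)
  have 2: "eps n (sig n B) * tors n w (sig n (sig n B)) (sig n C) A - eps n A * tors n w (sig n B) (sig n C) (sig n A)
      - eps n (sig n C) * tors n w (sig n (sig n C)) (sig n B) A + eps n A * tors n w (sig n C) (sig n B) (sig n A)
    = eps n B * eps n C * (eps n B * tors n w (sig n B) C A - eps n A * tors n w B C (sig n A)
      - eps n C * tors n w (sig n C) B A + eps n A * tors n w C B (sig n A))"
    using r by (simp add: T.anti T.J_shift algebra_simps)
  show "gau n t w A (sig n B) (sig n C) = 1 * (eps n B * eps n C * gau n t w A B C)"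
    unfolding gau_def ators_def 2 using 1 by (simp add: algebra_simps)
qed

lemma atr_ators:
  assumes "hermitian_array n P" "A < 2*n"
  shows "atr n (ators n t P) A = (1 + t) / 2 * lee n P A"
  unfolding atr_def using hermitian_array.trace_ators[OF assms] .

lemma phi_ators:
  assumes "hermitian_array n P" "K < 2*n"
  shows "phi n (ators n t P) K = t * (eps n K * lee n P (sig n K))"
  unfolding phi_def using hermitian_array.trace_J_ators[OF assms] .

lemma phi_add: "phi n (\<lambda>A B C. g A B C + h A B C) K = phi n g K + phi n h K"
  by (simp add: phi_def sum.distrib distrib_left)

lemma Om_add: "Om n (\<lambda>A B C. g A B C + h A B C) (\<lambda>A B C. g A B C + h A B C)
   = Om n g g + Om n g h + Om n h g + Om n h h"
  by (simp add: Om_def sum3_add [symmetric] distrib_left distrib_right add_ac)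

text \<open>Turns the partial divergences in \<open>scal1\<close> and \<open>starJ_gau0\<close> into covariant ones.\<close>

lemma trace_J_connection:
  assumes "skew_array n w" and K: "K < 2*n"
  shows "(\<Sum>B<2*n. eps n B * eps n K * w B (sig n B) (sig n K)) = atr n w K + lee n (tors n w) K"
proof -
  have "eps n B * eps n K * w B (sig n B) (sig n K) = w B B K + eps n K * tors n w B B (sig n K)" if "B < 2*n" for B
    using K that by (simp add: tors_def algebra_simps)
  then show ?thesis by (simp add: atr_def lee_def sum.distrib)
qed

locale connection_array =
  fixes n :: nat and w :: "nat \<Rightarrow> nat \<Rightarrow> nat \<Rightarrow> real" and dw :: "nat \<Rightarrow> nat \<Rightarrow> nat \<Rightarrow> nat \<Rightarrow> real"
  assumes skew_w: "skew_array n w" and skew_dw: "\<And>D. D < 2*n \<Longrightarrow> skew_array n (dw D)"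
begin

abbreviation "T \<equiv> tors n w"
abbreviation "\<alpha> \<equiv> lee n T"
abbreviation "dT \<equiv> \<lambda>D. tors n (dw D)"
abbreviation "\<alpha>2 \<equiv> (\<Sum>A<2*n. (\<alpha> A)\<^sup>2)"
abbreviation "div\<alpha> \<equiv> dvg n w \<alpha> (\<lambda>D. lee n (dT D))"
abbreviation "wa \<equiv> (\<Sum>A<2*n. atr n w A * \<alpha> A)"
abbreviation "dd\<alpha> \<equiv> (\<Sum>A<2*n. lee n (dT A) A)"
abbreviation "scal \<equiv> (\<Sum>A<2*n. \<Sum>B<2*n. curv n w w dw A B A B)"
abbreviation "gd t \<equiv> (\<lambda>D. gau n t (dw D))"

sublocale T: hermitian_array n T by (rule hermitian_array_tors[OF skew_w])

lemma hermitian_dT: "D < 2*n \<Longrightarrow> hermitian_array n (dT D)"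
  by (rule hermitian_array_tors[OF skew_dw])

lemma div_eq: "div\<alpha> = dd\<alpha> - wa"
  unfolding dvg_def by (subst sum.swap) (simp add: atr_def sum_distrib_right)

lemma gau_eta: "gau n t v = (\<lambda>A B C. v A B C + ators n t (tors n v) A B C)"
  by (intro ext) (simp add: gau_def)

theorem scal2:
  "(\<Sum>A<2*n. \<Sum>B<2*n. curv n w (gau n t w) (gd t) A B A B)
    = scal + (1 + t) * div\<alpha> - (1 + t)\<^sup>2 / 4 * \<alpha>2
      - sum3 n (\<lambda>A B C. ators n t T A B C * ators n t T B C A)"
proof -
  have sd: "skew_array n (ators n t (dT D))" if "D < 2*n" for D
    by (rule hermitian_array.skew_ators[OF hermitian_dT[OF that]])
  have "(\<Sum>A<2*n. \<Sum>B<2*n. curv n w (\<lambda>A B C. w A B C + ators n t T A B C)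
       (\<lambda>D A B C. dw D A B C + ators n t (dT D) A B C) A B A B)
    = scal + 2 * dvg n w (atr n (ators n t T)) (\<lambda>D. atr n (ators n t (dT D)))
     - (\<Sum>C<2*n. atr n (ators n t T) C * atr n (ators n t T) C)
     - sum3 n (\<lambda>A B C. ators n t T A B C * ators n t T B C A)"
    by (rule curv_trace_add[OF skew_w T.skew_ators skew_dw sd])
  moreover have "dvg n w (atr n (ators n t T)) (\<lambda>D. atr n (ators n t (dT D))) = (1 + t) / 2 * div\<alpha>"
    unfolding dvg_def right_diff_distrib sum_distrib_left
    by (intro arg_cong2[of _ _ _ _ "(-)"] sum.cong refl)
      (simp_all add: atr_ators[OF hermitian_dT] atr_ators[OF T.hermitian_array_axioms])
  moreover have "(\<Sum>C<2*n. atr n (ators n t T) C * atr n (ators n t T) C) = (1 + t)\<^sup>2 / 4 * \<alpha>2"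
    unfolding sum_distrib_left
    by (intro sum.cong refl) (simp add: atr_ators[OF T.hermitian_array_axioms] power2_eq_square)
  ultimately show ?thesis
    unfolding gau_eta by simp
qed

text \<open>Here \<open>w\<close> is split into the coefficients of \<open>D^0\<close>, which
  commute with \<open>J\<close>, and the negative of \<open>ators n 0 T\<close>, which anticommutes
  with it. The mixed terms vanish by \<open>Om_zero_mixed\<close> and the commuting term by
  \<open>Om_zero\<close>.\<close>

lemma Om_gau_zero: "Om n w w = Om n (ators n 0 T) (ators n 0 T)"
proof -
  let ?g = "gau n 0 w" and ?b = "\<lambda>A B C. - ators n 0 T A B C"
  have w: "w = (\<lambda>A B C. ?g A B C + ?b A B C)" by (simp add: gau_eta)
  have b: "J_comm n (-1) ?b"
    unfolding J_comm_def
  proof (intro allI impI)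
    fix A B C assume "A < 2*n" "B < 2*n" "C < 2*n"
    then show "- ators n 0 T A (sig n B) (sig n C) = -1 * (eps n B * eps n C * - ators n 0 T A B C)"
      by (simp add: ators_def T.J_shift mult_ac)
  qed
  note g = J_comm_gau[OF skew_w, of 0]
  have "Om n w w = Om n ?g ?g + Om n ?g ?b + Om n ?b ?g + Om n ?b ?b"
    by (subst (1 2) w) (rule Om_add)
  also have "\<dots> = Om n ?b ?b"
    using Om_zero[OF g] Om_zero_mixed[OF g b] Om_zero_mixed[OF b g] by simp
  finally show ?thesis by (simp add: Om_def)
qed

text \<open>\<open>ricJ_eq\<close> is applied to both connections. The quadratic part vanishes for
  \<open>D^t\<close>, so that of \<open>w\<close> enters with the opposite sign. In the linear part,
  \<open>trace_J_connection\<close> yields the connection term of the divergence and an additional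
  Lee form, which is the origin of \<open>\<alpha>2\<close>.\<close>

theorem scal1:
  "ricJ n w (gau n t w) (gd t) = ricJ n w w dw + 2 * Om n (ators n 0 T) (ators n 0 T)
     - 2 * t * (div\<alpha> - \<alpha>2)"
proof -
  have 1: "(\<Sum>B<2*n. eps n B * phi n (gd t B) (sig n B))
    = (\<Sum>B<2*n. eps n B * phi n (dw B) (sig n B)) - t * dd\<alpha>"
    unfolding sum_distrib_left sum_subtractf [symmetric]
    by (intro sum.cong refl) (simp add: gau_eta phi_add phi_ators[OF hermitian_dT] algebra_simps)
  have 2: "(\<Sum>B<2*n. \<Sum>K<2*n. eps n B * w B (sig n B) K * (t * (eps n K * \<alpha> (sig n K))))
    = - t * (wa + \<alpha>2)"
  proof -
    have "(\<Sum>B<2*n. \<Sum>K<2*n. eps n B * w B (sig n B) K * (t * (eps n K * \<alpha> (sig n K))))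
      = (\<Sum>K<2*n. \<Sum>B<2*n. eps n B * w B (sig n B) K * (t * (eps n K * \<alpha> (sig n K))))"
      by (rule sum.swap)
    also have "\<dots> = (\<Sum>K<2*n. - t * (\<alpha> K * (\<Sum>B<2*n. eps n B * eps n K * w B (sig n B) (sig n K))))"
      by (rule sum_sig_eq) (simp add: sum_distrib_left sum_negf [symmetric] mult_ac)
    also have "\<dots> = (\<Sum>K<2*n. - t * (\<alpha> K * (atr n w K + \<alpha> K)))"
      by (intro sum.cong refl) (simp add: trace_J_connection[OF skew_w])
    finally show ?thesis
      by (simp add: sum_distrib_left sum.distrib sum_negf sum_subtractf power2_eq_square algebra_simps)
  qed
  have 3: "(\<Sum>B<2*n. \<Sum>K<2*n. eps n B * w B (sig n B) K * phi n (gau n t w) K)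
    = (\<Sum>B<2*n. \<Sum>K<2*n. eps n B * w B (sig n B) K * phi n w K) - t * (wa + \<alpha>2)"
  proof -
    have "(\<Sum>B<2*n. \<Sum>K<2*n. eps n B * w B (sig n B) K * phi n (gau n t w) K)
      = (\<Sum>B<2*n. \<Sum>K<2*n. eps n B * w B (sig n B) K * phi n w K
          + eps n B * w B (sig n B) K * (t * (eps n K * \<alpha> (sig n K))))"
      by (intro sum.cong refl)
        (simp add: gau_eta phi_add phi_ators[OF T.hermitian_array_axioms] distrib_left)
    then show ?thesis using 2 by (simp add: sum.distrib)
  qed
  show ?thesis
    unfolding ricJ_eq 1 3 Om_zero[OF J_comm_gau[OF skew_w]] Om_gau_zero [symmetric] div_eq
    by (simp add: algebra_simps)
qed

end

section \<open>The contraction \<open>starJ\<close> for the Levi-Civita connection and for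
  \<open>D^0\<close>\<close>

definition atrJ :: "nat \<Rightarrow> (nat \<Rightarrow> nat \<Rightarrow> nat \<Rightarrow> real) \<Rightarrow> nat \<Rightarrow> real" where
  "atrJ n g C = (\<Sum>B<2*n. eps n B * g (sig n B) B C)"

lemma sum3_traceJ_prod:
  assumes "skew_array n h"
  shows "sum3 n (\<lambda>A B C. eps n A * eps n B * (g (sig n B) B C * h (sig n A) C A))
    = - (\<Sum>C<2*n. atrJ n g C * atrJ n h C)"
proof -
  have "sum3 n (\<lambda>A B C. eps n A * eps n B * (g (sig n B) B C * h (sig n A) C A))
    = sum3 n (\<lambda>A B C. eps n A * eps n B * (g (sig n A) A C * h (sig n B) C B))"
    using sum3_swap12[of n "\<lambda>A B C. eps n A * eps n B * (g (sig n A) A C * h (sig n B) C B)"]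
    by (simp add: mult_ac)
  also have "\<dots> = sum3 n (\<lambda>A B C. eps n B * eps n C * (g (sig n B) B A * h (sig n C) A C))"
    by (rule sum3_cyc[of n "\<lambda>A B C. eps n A * eps n B * (g (sig n A) A C * h (sig n B) C B)", symmetric])
  also have "\<dots> = sum3 n (\<lambda>A B C. - ((eps n B * g (sig n B) B A) * (eps n C * h (sig n C) C A)))"
  proof (rule sum3_cong)
    fix A B C assume "A < 2*n" "B < 2*n" "C < 2*n"
    then show "eps n B * eps n C * (g (sig n B) B A * h (sig n C) A C)
      = - ((eps n B * g (sig n B) B A) * (eps n C * h (sig n C) C A))"
      using skew_arrayD[OF assms, of "sig n C" C A] by simp
  qed
  finally show ?thesis
    by (simp add: sum3_def atrJ_def sum_product sum_negf)
qed

lemma (in hermitian_array) hermitian_array_ators0: "hermitian_array n (ators n 0 P)"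
proof
  fix A B C assume r: "A < 2*n" "B < 2*n" "C < 2*n"
  show "ators n 0 P A C B = - ators n 0 P A B C"
    using skew_arrayD[OF skew_ators r] .
  show "ators n 0 P A (sig n B) (sig n C) = - (eps n B * eps n C * ators n 0 P A B C)"
    using r by (simp add: ators_def J_shift mult_ac)
qed

lemma (in hermitian_array) atrJ_ators0:
  "C < 2*n \<Longrightarrow> atrJ n (ators n 0 P) C = - (eps n C * lee n P (sig n C)) / 2"
  using trace_sig3[of "sig n C"]
  by (simp add: atrJ_def ators_def sum_distrib_left [symmetric] sum_divide_distrib [symmetric] mult.left_commute[of "eps n _" "eps n C"])

context connection_array
begin

text \<open>None of the four sums is tensorial. Relabelling and skewness give
  \<open>?D1 = ?D2\<close> and \<open>?D4 = - ?D3\<close>, and in \<open>?D1 + ?D3\<close> the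
  coefficients \<open>w\<close> combine to their commutator with \<open>J\<close>, which is the
  tensor \<open>T\<close>.\<close>

lemma starJ_cross:
  assumes a: "hermitian_array n a"
  shows "sum3 n (\<lambda>A B C. eps n A * eps n B * (w (sig n A) B C * a (sig n B) C A))
     + sum3 n (\<lambda>A B C. eps n A * eps n B * (a (sig n A) B C * w (sig n B) C A))
     + sum3 n (\<lambda>A B C. eps n A * eps n B * (w (sig n A) (sig n B) C * a C B A))
     - sum3 n (\<lambda>A B C. eps n A * eps n B * (w (sig n B) (sig n A) C * a C B A))
    = 2 * sum3 n (\<lambda>A B C. eps n A * eps n B * eps n C * (T (sig n A) B (sig n C) * a C (sig n B) A))"
    (is "?D1 + ?D2 + ?D3 - ?D4 = 2 * ?Q")
proof -
  interpret a: hermitian_array n a by fact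
  have D1: "?D1 = ?D2"
  proof -
    have "?D1 = sum3 n (\<lambda>A B C. eps n A * eps n C * (w (sig n A) C B * a (sig n C) B A))"
      by (rule sum3_swap23 [symmetric])
    also have "\<dots> = sum3 n (\<lambda>A B C. eps n C * eps n A * (a (sig n C) A B * w (sig n A) B C))"
    proof (rule sum3_cong)
      fix A B C assume "A < 2*n" "B < 2*n" "C < 2*n"
      then show "eps n A * eps n C * (w (sig n A) C B * a (sig n C) B A)
         = eps n C * eps n A * (a (sig n C) A B * w (sig n A) B C)"
        using skew_arrayD[OF skew_w, of "sig n A" B C] a.skew[of "sig n C" A B] by simp
    qed
    also have "\<dots> = ?D2"
      by (rule sum3_cyc[of n "\<lambda>A B C. eps n C * eps n A * (a (sig n C) A B * w (sig n A) B C)", symmetric])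
    finally show ?thesis .
  qed
  have D3: "?D3 = - sum3 n (\<lambda>A B C. eps n A * eps n B * (w (sig n A) B C * a C (sig n B) A))"
    unfolding sum3_def sum_negf [symmetric]
    by (rule sum.cong[OF refl], rule sum_sig_eq) (simp add: sum_negf)
  have D4: "?D4 = - ?D3"
  proof -
    have "?D4 = sum3 n (\<lambda>A B C. eps n B * eps n A * (w (sig n A) (sig n B) C * a C A B))"
      by (rule sum3_swap12 [symmetric])
    also have "\<dots> = sum3 n (\<lambda>A B C. - (eps n A * eps n B * (w (sig n A) (sig n B) C * a C B A)))"
    proof (rule sum3_cong)
      fix A B C assume "A < 2*n" "B < 2*n" "C < 2*n"
      then show "eps n B * eps n A * (w (sig n A) (sig n B) C * a C A B)
         = - (eps n A * eps n B * (w (sig n A) (sig n B) C * a C B A))"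
        using a.skew[of C B A] by simp
    qed
    finally show ?thesis by (simp add: sum3_minus)
  qed
  have D1': "?D1 = ?Q - ?D3"
  proof -
    have "?D2 = sum3 n (\<lambda>A B C. eps n C * eps n A * (a (sig n C) A B * w (sig n A) B C))"
      by (rule sum3_cyc[of n "\<lambda>A B C. eps n C * eps n A * (a (sig n C) A B * w (sig n A) B C)"])
    also have "\<dots> = sum3 n (\<lambda>A B C. - (eps n C * eps n A * (a C A (sig n B) * w (sig n A) (sig n B) (sig n C))))"
      unfolding sum3_def
      by (rule sum.cong[OF refl], rule sum_sig_eq, rule sum_sig_eq) simp
    also have "\<dots> = sum3 n (\<lambda>A B C. eps n A * eps n B * eps n C * (T (sig n A) B (sig n C) * a C (sig n B) A)
       + eps n A * eps n B * (w (sig n A) B C * a C (sig n B) A))"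
    proof (rule sum3_cong)
      fix A B C assume "A < 2*n" "B < 2*n" "C < 2*n"
      then show "- (eps n C * eps n A * (a C A (sig n B) * w (sig n A) (sig n B) (sig n C)))
        = eps n A * eps n B * eps n C * (T (sig n A) B (sig n C) * a C (sig n B) A)
          + eps n A * eps n B * (w (sig n A) B C * a C (sig n B) A)"
        using a.skew[of C "sig n B" A] by (simp add: tors_def algebra_simps)
    qed
    finally show ?thesis using D1 D3 by (simp add: sum3_add)
  qed
  show ?thesis using D1 D1' D4 by linarith
qed

text \<open>The two mixed products of traces give \<open>(wa + \<alpha>2) / 2\<close> each;
  \<open>wa\<close> completes the derivative term to \<open>- div\<alpha>\<close>. The product of
  the two traces of \<open>ators n 0 T\<close> subtracts \<open>\<alpha>2 / 4\<close>, which leaves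
  the coefficient 3/4.\<close>

lemma starJ_gau0:
  "starJ n w (gau n 0 w) (gd 0) = starJ n w w dw - div\<alpha> + 3/4 * \<alpha>2
    - 2 * sum3 n (\<lambda>A B C. eps n A * eps n B * eps n C * (T (sig n A) B (sig n C) * ators n 0 T C (sig n B) A))
    - sum3 n (\<lambda>A B C. eps n A * eps n B * (ators n 0 T (sig n A) B C * ators n 0 T (sig n B) C A))"
proof -
  let ?a = "ators n 0 T" and ?da = "\<lambda>D. ators n 0 (dT D)"
  note ha = T.hermitian_array_ators0
  interpret a: hermitian_array n ?a by (rule ha)
  note sa = T.skew_ators[of 0]
  have da: "(\<Sum>A<2*n. \<Sum>B<2*n. eps n A * eps n B * (?da (sig n A) (sig n B) B A - ?da (sig n B) (sig n A) B A))
    = - dd\<alpha>"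
  proof -
    have 1: "(\<Sum>A<2*n. \<Sum>B<2*n. eps n A * eps n B * ?da (sig n B) (sig n A) B A)
      = - (\<Sum>A<2*n. \<Sum>B<2*n. eps n A * eps n B * ?da (sig n A) (sig n B) B A)"
    proof -
      have "(\<Sum>A<2*n. \<Sum>B<2*n. eps n A * eps n B * ?da (sig n B) (sig n A) B A)
       = (\<Sum>A<2*n. \<Sum>B<2*n. eps n B * eps n A * ?da (sig n A) (sig n B) A B)" by (rule sum.swap)
      also have "\<dots> = (\<Sum>A<2*n. \<Sum>B<2*n. - (eps n A * eps n B * ?da (sig n A) (sig n B) B A))"
      proof (intro sum.cong refl)
        fix A B assume "A \<in> {..<2*n}" "B \<in> {..<2*n}"
        then show "eps n B * eps n A * ?da (sig n A) (sig n B) A B = - (eps n A * eps n B * ?da (sig n A) (sig n B) B A)"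
          using hermitian_array.skew[OF hermitian_array.hermitian_array_ators0[OF hermitian_dT], of "sig n A" "sig n B" B A]
          by simp
      qed
      finally show ?thesis by (simp add: sum_negf)
    qed
    have 2: "(\<Sum>A<2*n. \<Sum>B<2*n. eps n A * eps n B * ?da (sig n A) (sig n B) B A) = - dd\<alpha> / 2"
    proof -
      have "(\<Sum>A<2*n. \<Sum>B<2*n. eps n A * eps n B * ?da (sig n A) (sig n B) B A)
        = (\<Sum>A<2*n. eps n A * atrJ n (?da (sig n A)) A)"
        by (simp add: atrJ_def sum_distrib_left mult_ac)
      also have "\<dots> = (\<Sum>A<2*n. - lee n (dT A) A / 2)"
        by (rule sum_sig_eq) (simp add: hermitian_array.atrJ_ators0[OF hermitian_dT])
      finally show ?thesis by (simp add: sum_divide_distrib sum_negf)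
    qed
    show ?thesis using 1 2 by (simp add: right_diff_distrib sum_subtractf)
  qed
  have tr: "(\<Sum>C<2*n. atrJ n w C * atrJ n ?a C) = - (wa + \<alpha>2) / 2"
  proof -
    have "(\<Sum>C<2*n. atrJ n w C * atrJ n ?a C) = (\<Sum>C<2*n. - (\<alpha> C * (\<Sum>B<2*n. eps n B * eps n C * w B (sig n B) (sig n C))) / 2)"
    proof (rule sum_sig_eq)
      fix C assume C: "C < 2*n"
      have "atrJ n w (sig n C) = (\<Sum>B<2*n. - (eps n B * w B (sig n B) (sig n C)))"
        unfolding atrJ_def by (rule sum_sig_eq) simp
      then have "eps n C * atrJ n w (sig n C) = - (\<Sum>B<2*n. eps n B * eps n C * w B (sig n B) (sig n C))"
        by (simp add: sum_distrib_left sum_negf mult_ac)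
      moreover have "atrJ n ?a (sig n C) = eps n C * \<alpha> C / 2"
        using C by (simp add: T.atrJ_ators0)
      ultimately show "atrJ n w (sig n C) * atrJ n ?a (sig n C)
        = - (\<alpha> C * (\<Sum>B<2*n. eps n B * eps n C * w B (sig n B) (sig n C))) / 2"
        by (metis (no_types, lifting) minus_mult_right mult.assoc mult.commute times_divide_eq_right)
    qed
    also have "\<dots> = (\<Sum>C<2*n. - (\<alpha> C * (atr n w C + \<alpha> C)) / 2)"
      by (intro sum.cong refl) (simp add: trace_J_connection[OF skew_w])
    finally show ?thesis
      by (simp add: sum_divide_distrib [symmetric] sum_negf sum.distrib sum_subtractf power2_eq_square distrib_left mult.commute)
  qed
  have tr2: "(\<Sum>C<2*n. atrJ n ?a C * atrJ n ?a C) = \<alpha>2 / 4"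
  proof -
    have "(\<Sum>C<2*n. atrJ n ?a C * atrJ n ?a C) = (\<Sum>C<2*n. (\<alpha> C)\<^sup>2 / 4)"
      by (rule sum_sig_eq) (simp add: T.atrJ_ators0 power2_eq_square)
    then show ?thesis by (simp add: sum_divide_distrib)
  qed
  have tr': "(\<Sum>C<2*n. atrJ n ?a C * atrJ n w C) = - (wa + \<alpha>2) / 2"
    using tr by (simp add: mult.commute)
  have ex: "starJ n w (\<lambda>A B C. w A B C + ?a A B C) (\<lambda>D A B C. dw D A B C + ?da D A B C)
    = starJ n w w dw
    + (\<Sum>A<2*n. \<Sum>B<2*n. eps n A * eps n B * (?da (sig n A) (sig n B) B A - ?da (sig n B) (sig n A) B A))
    + sum3 n (\<lambda>A B C. eps n A * eps n B * (w (sig n B) B C * ?a (sig n A) C A))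
    + sum3 n (\<lambda>A B C. eps n A * eps n B * (?a (sig n B) B C * w (sig n A) C A))
    + sum3 n (\<lambda>A B C. eps n A * eps n B * (?a (sig n B) B C * ?a (sig n A) C A))
    - sum3 n (\<lambda>A B C. eps n A * eps n B * (?a (sig n A) B C * ?a (sig n B) C A))
    - (sum3 n (\<lambda>A B C. eps n A * eps n B * (w (sig n A) B C * ?a (sig n B) C A))
     + sum3 n (\<lambda>A B C. eps n A * eps n B * (?a (sig n A) B C * w (sig n B) C A))
     + sum3 n (\<lambda>A B C. eps n A * eps n B * (w (sig n A) (sig n B) C * ?a C B A))
     - sum3 n (\<lambda>A B C. eps n A * eps n B * (w (sig n B) (sig n A) C * ?a C B A)))"
    unfolding starJ_def curv_def sum3_def
    by (simp only: sum.distrib [symmetric] sum_subtractf [symmetric] sum_distrib_left distrib_left [symmetric]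
       right_diff_distrib [symmetric])
      (intro sum.cong refl, simp add: sum.distrib sum_subtractf sum_distrib_left [symmetric] algebra_simps)
  show ?thesis
    unfolding gau_eta ex da sum3_traceJ_prod[OF sa] sum3_traceJ_prod[OF skew_w] tr tr' tr2 starJ_cross[OF ha] div_eq
    by (simp add: field_simps)
qed

end

lemma (in hermitian_array) J_swap:
  assumes r: "A < 2*n" "B < 2*n" "C < 2*n"
  shows "P A C (sig n B) = - (eps n B * eps n C * P A B (sig n C))"
  using J_shift[of A B C] skew[of A C "sig n B"] r by simp

section \<open>Quadratic invariants of the torsion\<close>

text \<open>\<open>ators n 0 P\<close> is half of this array. Inserting \<open>J\<close> into the
  last slot keeps the type, the norm and the cyclic contraction, so the quadratic sums can be
  evaluated on \<open>P\<close> itself.\<close>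

definition Jtw :: "nat \<Rightarrow> (nat \<Rightarrow> nat \<Rightarrow> nat \<Rightarrow> real) \<Rightarrow> nat \<Rightarrow> nat \<Rightarrow> nat \<Rightarrow> real" where
  "Jtw n P A B C = eps n C * P A B (sig n C)"

lemma typed_array_Jtw:
  assumes "typed_array n P s" shows "typed_array n (Jtw n P) s"
proof -
  interpret P: typed_array n P s by fact
  show ?thesis
  proof
    fix A B C assume r: "A < 2*n" "B < 2*n" "C < 2*n"
    show "Jtw n P A C B = - Jtw n P A B C"
      using P.J_swap[OF r] by (simp add: Jtw_def mult_ac)
    show "Jtw n P A (sig n B) (sig n C) = - (eps n B * eps n C * Jtw n P A B C)"
      using P.J_shift[of A B C] r by (simp add: Jtw_def mult_ac)
    show "Jtw n P (sig n A) (sig n B) C = s * (eps n A * eps n B * Jtw n P A B C)"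
      using r by (simp add: Jtw_def P.typed)
  qed
qed

lemma sum3_Jtw_sq: "sum3 n (\<lambda>A B C. Jtw n P A B C * Jtw n P A B C) = sum3 n (\<lambda>A B C. P A B C * P A B C)"
  using sum3_sig3[of n "\<lambda>A B C. P A B C * P A B C"] by (simp add: Jtw_def mult_ac)

lemma (in hermitian_array) sum3_Jtw_cyc:
  "sum3 n (\<lambda>A B C. Jtw n P A B C * Jtw n P B C A) = sum3 n (\<lambda>A B C. P A B C * P B C A)"
proof -
  have "sum3 n (\<lambda>A B C. Jtw n P A B C * Jtw n P B C A)
    = sum3 n (\<lambda>A B C. - (eps n C * eps n A * (P A B C * P B (sig n C) (sig n A))))"
    unfolding sum3_def Jtw_def by (intro sum.cong[OF refl] sum_sig_eq) simp
  also have "\<dots> = sum3 n (\<lambda>A B C. P A B C * P B C A)"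
    by (rule sum3_cong) (simp add: anti mult_ac)
  finally show ?thesis .
qed

definition cyc3 :: "(nat \<Rightarrow> nat \<Rightarrow> nat \<Rightarrow> real) \<Rightarrow> nat \<Rightarrow> nat \<Rightarrow> nat \<Rightarrow> real" where
  "cyc3 Q A B C = Q A B C + Q B C A + Q C A B"

lemma sum3_cyc3_sq:
  "sum3 n (\<lambda>A B C. (cyc3 Q A B C)\<^sup>2) = 3 * sum3 n (\<lambda>A B C. Q A B C * Q A B C) + 6 * sum3 n (\<lambda>A B C. Q A B C * Q B C A)"
proof -
  have c: "sum3 n (\<lambda>A B C. f C A B) = sum3 n f" for f :: "nat \<Rightarrow> nat \<Rightarrow> nat \<Rightarrow> real"
    using sum3_cyc[of n "\<lambda>A B C. f C A B"] by simp
  have "sum3 n (\<lambda>A B C. (cyc3 Q A B C)\<^sup>2)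
    = sum3 n (\<lambda>A B C. Q A B C * Q A B C + Q B C A * Q B C A + Q C A B * Q C A B
      + 2 * (Q A B C * Q B C A) + 2 * (Q B C A * Q C A B) + 2 * (Q C A B * Q A B C))"
    by (rule sum3_cong) (simp add: cyc3_def power2_eq_square algebra_simps)
  then show ?thesis
    using sum3_cyc[of n "\<lambda>A B C. Q A B C * Q A B C"] sum3_cyc[of n "\<lambda>A B C. Q A B C * Q B C A"]
      c[of "\<lambda>A B C. Q A B C * Q A B C"] c[of "\<lambda>A B C. Q A B C * Q B C A"]
    by (simp add: sum3_linear)
qed

context hermitian_array
begin

abbreviation "Pp \<equiv> Jpart n 1 P"
abbreviation "Pm \<equiv> Jpart n (-1) P"
abbreviation "pp2 \<equiv> sum3 n (\<lambda>A B C. Pp A B C * Pp A B C)"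
abbreviation "pm2 \<equiv> sum3 n (\<lambda>A B C. Pm A B C * Pm A B C)"
abbreviation "pmc \<equiv> sum3 n (\<lambda>A B C. Pm A B C * Pm B C A)"

lemma typed_Pp: "typed_array n Pp 1" and typed_Pm: "typed_array n Pm (-1)"
  by (rule typed_array_Jpart; simp)+

lemma P_sig_sig: "eps n A * eps n B * P (sig n A) (sig n B) C = Pp A B C - Pm A B C"
  by (simp add: Jpart_def field_simps)

text \<open>After these vanishing statements, \<open>pp2\<close>, \<open>pm2\<close> and
  \<open>pmc\<close> are the only quadratic contractions of \<open>Pp\<close> and \<open>Pm\<close>
  left in the sums below.\<close>

lemma cyc_prods:
  "sum3 n (\<lambda>A B C. Pp A B C * Pp B C A) = 0"
  "sum3 n (\<lambda>A B C. Pp A B C * Pm B C A) = 0"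
  "sum3 n (\<lambda>A B C. Pm A B C * Pp B C A) = 0"
  "sum3 n (\<lambda>A B C. Pp A B C * Pm A B C) = 0"
  using typed_array_cyc_zero_plus[OF typed_Pp] typed_array_cyc_zero[OF typed_Pp typed_Pm]
    typed_array_cyc_zero[of n Pm "-1" Pp] typed_array_ip_zero[OF typed_Pp typed_Pm] typed_Pp typed_Pm
  by simp_all

lemma quad_ators0_1:
  "sum3 n (\<lambda>A B C. eps n A * eps n B * eps n C * (P (sig n A) B (sig n C) * ators n 0 P C (sig n B) A)) = - pmc / 2"
proof -
  have "sum3 n (\<lambda>A B C. eps n A * eps n B * eps n C * (P (sig n A) B (sig n C) * ators n 0 P C (sig n B) A))
     = sum3 n (\<lambda>A B C. 1/2 * ((eps n A * eps n C * P (sig n A) (sig n C) B) * P C B A))"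
  proof (rule sum3_cong)
    fix A B C assume r: "A < 2*n" "B < 2*n" "C < 2*n"
    then have "P (sig n A) B (sig n C) = - P (sig n A) (sig n C) B"
      using skew[of "sig n A" "sig n C" B] by simp
    then show "eps n A * eps n B * eps n C * (P (sig n A) B (sig n C) * ators n 0 P C (sig n B) A)
      = 1/2 * ((eps n A * eps n C * P (sig n A) (sig n C) B) * P C B A)"
      using r by (simp add: ators_def anti mult_ac)
  qed
  also have "\<dots> = sum3 n (\<lambda>A B C. 1/2 * ((Pp A B C - Pm A B C) * (Pp B C A + Pm B C A)))"
    unfolding P_sig_sig Jpart_add[of P, symmetric]
    by (rule sum3_swap23[of n "\<lambda>A B C. 1/2 * ((Pp A B C - Pm A B C) * P B C A)"])
  also have "\<dots> = 1/2 * (sum3 n (\<lambda>A B C. Pp A B C * Pp B C A) + sum3 n (\<lambda>A B C. Pp A B C * Pm B C A)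
       - sum3 n (\<lambda>A B C. Pm A B C * Pp B C A) - pmc)"
    by (simp only: sum3_linear [symmetric] ring_distribs)
      (rule sum3_cong, simp add: algebra_simps)
  finally show ?thesis unfolding cyc_prods by simp
qed

lemma quad_ators0_2:
  "sum3 n (\<lambda>A B C. eps n A * eps n B * (ators n 0 P (sig n A) B C * ators n 0 P (sig n B) C A)) = pmc / 4"
proof -
  have "sum3 n (\<lambda>A B C. eps n A * eps n B * (ators n 0 P (sig n A) B C * ators n 0 P (sig n B) C A))
    = sum3 n (\<lambda>A B C. 1/4 * ((Pp A B C - Pm A B C) * (Pp B C A - Pm B C A)))"
  proof (rule sum3_cong)
    fix A B C assume r: "A < 2*n" "B < 2*n" "C < 2*n"
    have 1: "P (sig n A) B (sig n C) = eps n B * eps n C * P (sig n A) (sig n B) C"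
      and 2: "P (sig n B) C (sig n A) = eps n C * eps n A * P (sig n B) (sig n C) A"
      using J_shift[of "sig n A" B C] J_shift[of "sig n B" C A] r by (simp_all add: mult_ac)
    show "eps n A * eps n B * (ators n 0 P (sig n A) B C * ators n 0 P (sig n B) C A)
      = 1/4 * ((Pp A B C - Pm A B C) * (Pp B C A - Pm B C A))"
      unfolding P_sig_sig [symmetric] by (simp add: ators_def 1 2 mult_ac)
  qed
  also have "\<dots> = 1/4 * (sum3 n (\<lambda>A B C. Pp A B C * Pp B C A) - sum3 n (\<lambda>A B C. Pp A B C * Pm B C A)
       - sum3 n (\<lambda>A B C. Pm A B C * Pp B C A) + pmc)"
    by (simp only: sum3_linear [symmetric] ring_distribs)
      (rule sum3_cong, simp add: algebra_simps)
  finally show ?thesis unfolding cyc_prods by simp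
qed

lemma quad_ators0_3: "Om n (ators n 0 P) (ators n 0 P) = (pp2 - pm2) / 4"
proof -
  have "Om n (ators n 0 P) (ators n 0 P) = sum3 n (\<lambda>A B C. 1/4 * ((Pp B C A - Pm B C A) * (Pp B C A + Pm B C A)))"
    unfolding Om_def
  proof (rule sum3_cong)
    fix A B C assume r: "A < 2*n" "B < 2*n" "C < 2*n"
    have 1: "P B (sig n A) (sig n C) = eps n A * eps n C * P B C A"
      using anti[of B A C] skew[of B C A] r by simp
    have 2: "P (sig n B) C (sig n A) = eps n C * eps n A * P (sig n B) (sig n C) A"
      using J_shift[of "sig n B" C A] r by (simp add: mult_ac)
    show "eps n A * eps n B * (ators n 0 P B (sig n A) C * ators n 0 P (sig n B) C A)
      = 1/4 * ((Pp B C A - Pm B C A) * (Pp B C A + Pm B C A))"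
      unfolding P_sig_sig [symmetric] Jpart_add[of P, symmetric] using r by (simp add: ators_def 1 2 mult_ac)
  qed
  also have "\<dots> = sum3 n (\<lambda>A B C. 1/4 * ((Pp A B C - Pm A B C) * (Pp A B C + Pm A B C)))"
    by (rule sum3_cyc[of n "\<lambda>A B C. 1/4 * ((Pp A B C - Pm A B C) * (Pp A B C + Pm A B C))"])
  also have "\<dots> = 1/4 * (pp2 - pm2)"
    by (simp only: sum3_linear [symmetric] ring_distribs)
      (rule sum3_cong, simp add: algebra_simps)
  finally show ?thesis by simp
qed

text \<open>The \<open>Pm\<close> parts of the four summands with \<open>t/4\<close> cancel, so
  \<open>D^t\<close> depends on \<open>t\<close> only through \<open>Pp\<close>. This makes the
  quadratic sum in \<open>quad_ators\<close> a matter of cyclic shifts.\<close>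

lemma ators_Jtw:
  assumes r: "A < 2*n" "B < 2*n" "C < 2*n"
  shows "ators n t P A B C = 1/2 * Jtw n Pp A B C + 1/2 * Jtw n Pm A B C
     - t/2 * (Jtw n Pp B C A + Jtw n Pp C A B)"
proof -
  have 1: "P (sig n B) (sig n C) (sig n A) = - (eps n C * eps n A * P (sig n B) C A)"
    using anti[of "sig n B" C A] r by simp
  have 2: "P (sig n C) (sig n A) (sig n B) = eps n A * eps n B * P (sig n C) B A"
    using anti[of "sig n C" A B] skew[of "sig n C" B A] r by simp
  have 3: "P C A (sig n B) = - (eps n A * eps n B * P C B (sig n A))"
    using J_swap[of C B A] r by (simp add: mult_ac)
  show ?thesis
    by (simp add: ators_def Jtw_def Jpart_def 1 2 3 field_simps)
qed

text \<open>With \<open>x\<close> and \<open>y\<close> as below, \<open>pp2\<close> arises twice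
  with coefficient \<open>- t/4\<close>, from products of \<open>x\<close> with equal index order,
  and once with \<open>t\<^sup>2/4\<close>. The contraction of \<open>y\<close> with its shift has
  coefficient 1/4, and everything else vanishes by type.\<close>

lemma quad_ators:
  "sum3 n (\<lambda>A B C. ators n t P A B C * ators n t P B C A) = (t\<^sup>2 - 2*t)/4 * pp2 + pmc / 4"
proof -
  define x where "x = Jtw n Pp"
  define y where "y = Jtw n Pm"
  have tx: "typed_array n x 1" and ty: "typed_array n y (-1)"
    unfolding x_def y_def by (rule typed_array_Jtw typed_Pp typed_Pm)+
  interpret m: typed_array n Pm "-1" by (rule typed_Pm)
  have s0: "sum3 n (\<lambda>A B C. x A B C * x A B C) = pp2"
    unfolding x_def by (rule sum3_Jtw_sq)
  have sy: "sum3 n (\<lambda>A B C. y A B C * y B C A) = pmc"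
    unfolding y_def by (rule m.sum3_Jtw_cyc)
  have z: "sum3 n (\<lambda>A B C. x A B C * x B C A) = 0" "sum3 n (\<lambda>A B C. x A B C * y B C A) = 0"
    "sum3 n (\<lambda>A B C. y A B C * x B C A) = 0" "sum3 n (\<lambda>A B C. y A B C * x A B C) = 0"
    using typed_array_cyc_zero_plus[OF tx] typed_array_cyc_zero[OF tx ty] typed_array_cyc_zero[of n y "-1" x]
      typed_array_ip_zero[of n y "-1" x] tx ty by simp_all
  have z2: "sum3 n (\<lambda>A B C. x A B C * x C A B) = 0" "sum3 n (\<lambda>A B C. y A B C * x C A B) = 0"
    "sum3 n (\<lambda>A B C. x B C A * x C A B) = 0" "sum3 n (\<lambda>A B C. x B C A * x B C A) = pp2"
    "sum3 n (\<lambda>A B C. x B C A * y B C A) = 0" "sum3 n (\<lambda>A B C. x C A B * y B C A) = 0"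
    "sum3 n (\<lambda>A B C. x C A B * x C A B) = pp2"
  proof -
    have c: "sum3 n (\<lambda>A B C. f C A B) = sum3 n f" for f :: "nat \<Rightarrow> nat \<Rightarrow> nat \<Rightarrow> real"
      using sum3_cyc[of n "\<lambda>A B C. f C A B"] by simp
    show "sum3 n (\<lambda>A B C. x A B C * x C A B) = 0"
      using c[of "\<lambda>A B C. x A B C * x B C A"] z(1) by (simp add: mult.commute)
    show "sum3 n (\<lambda>A B C. y A B C * x C A B) = 0"
      using c[of "\<lambda>A B C. x A B C * y B C A"] z(2) by (simp add: mult.commute)
    show "sum3 n (\<lambda>A B C. x B C A * x C A B) = 0"
      using sum3_cyc[of n "\<lambda>A B C. x A B C * x B C A"] z(1) by simp
    show "sum3 n (\<lambda>A B C. x B C A * x B C A) = pp2"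
      using sum3_cyc[of n "\<lambda>A B C. x A B C * x A B C"] s0 by simp
    show "sum3 n (\<lambda>A B C. x B C A * y B C A) = 0"
      using sum3_cyc[of n "\<lambda>A B C. x A B C * y A B C"] z(4) by (simp add: mult.commute)
    show "sum3 n (\<lambda>A B C. x C A B * y B C A) = 0"
      using sum3_cyc[of n "\<lambda>A B C. y A B C * x B C A"] z(3) by (simp add: mult.commute)
    show "sum3 n (\<lambda>A B C. x C A B * x C A B) = pp2"
      using c[of "\<lambda>A B C. x A B C * x A B C"] s0 by simp
  qed
  have "sum3 n (\<lambda>A B C. ators n t P A B C * ators n t P B C A)
    = sum3 n (\<lambda>A B C. 1/4 * (x A B C * x B C A) + 1/4 * (x A B C * y B C A)
        + 1/4 * (y A B C * x B C A) + 1/4 * (y A B C * y B C A)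
        - t/4 * (x A B C * x C A B) - t/4 * (x A B C * x A B C)
        - t/4 * (y A B C * x C A B) - t/4 * (y A B C * x A B C)
        - t/4 * (x B C A * x B C A) - t/4 * (x B C A * y B C A)
        - t/4 * (x B C A * x C A B) - t/4 * (x C A B * y B C A)
        + t\<^sup>2/4 * (x B C A * x C A B) + t\<^sup>2/4 * (x A B C * x B C A)
        + t\<^sup>2/4 * (x C A B * x C A B) + t\<^sup>2/4 * (x A B C * x C A B))"
    by (rule sum3_cong) (simp add: ators_Jtw x_def [symmetric] y_def [symmetric] power2_eq_square field_simps)
  also have "\<dots> = (t\<^sup>2 - 2*t)/4 * pp2 + pmc / 4"
    unfolding sum3_linear z z2 s0 sy by (simp add: field_simps)
  finally show ?thesis .
qed

text \<open>On the left stands the real projection of the 3-form to types (3,0) and (0,3): twice the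
  real part of the product of three projectors (1 - iJ)/2 is a quarter of the form minus its three
  values with \<open>J\<close> in two slots.\<close>

lemma cyc3_minus:
  assumes r: "A < 2*n" "B < 2*n" "C < 2*n"
  shows "(cyc3 P A B C - eps n A * eps n B * cyc3 P (sig n A) (sig n B) C
     - eps n B * eps n C * cyc3 P A (sig n B) (sig n C)
     - eps n A * eps n C * cyc3 P (sig n A) B (sig n C)) / 4 = cyc3 Pm A B C"
proof -
  have s: "P (sig n X) Y (sig n Z) = eps n Y * eps n Z * P (sig n X) (sig n Y) Z"
    if "X < 2*n" "Y < 2*n" "Z < 2*n" for X Y Z
    using J_shift[of "sig n X" Y Z] that by (simp add: mult_ac)
  show ?thesis
    using r by (simp add: cyc3_def Jpart_def s anti field_simps)
qed

end

text \<open>The components of \<open>F\<close>, which are constant.\<close>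

definition Fd :: "nat \<Rightarrow> nat \<Rightarrow> nat \<Rightarrow> real" where
  "Fd n B C = (if C = sig n B then eps n B else 0)"

lemma sum_Fd: "B < 2*n \<Longrightarrow> (\<Sum>C<2*n. Fd n B C * f C) = eps n B * f (sig n B)"
  by (simp add: Fd_def if_distrib [of "\<lambda>x. x * _"] sum.delta cong: if_cong)

lemma Fd_skew: "B < 2*n \<Longrightarrow> C < 2*n \<Longrightarrow> Fd n C B = - Fd n B C"
  by (auto simp: Fd_def sig_def eps_def)

lemma sum3_cyc3_prod:
  "sum3 n (\<lambda>A B C. cyc3 P A B C * cyc3 Q A B C) = 3 * sum3 n (\<lambda>A B C. cyc3 P A B C * Q A B C)"
proof -
  have c: "sum3 n (\<lambda>A B C. f C A B) = sum3 n f" for f :: "nat \<Rightarrow> nat \<Rightarrow> nat \<Rightarrow> real"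
    using sum3_cyc[of n "\<lambda>A B C. f C A B"] by simp
  have "sum3 n (\<lambda>A B C. cyc3 P A B C * cyc3 Q A B C)
    = sum3 n (\<lambda>A B C. cyc3 P A B C * Q A B C + cyc3 P B C A * Q B C A + cyc3 P C A B * Q C A B)"
    by (rule sum3_cong) (simp add: cyc3_def algebra_simps)
  then show ?thesis
    using sum3_cyc[of n "\<lambda>A B C. cyc3 P A B C * Q A B C"] c[of "\<lambda>A B C. cyc3 P A B C * Q A B C"]
    by (simp add: sum3_linear)
qed

context hermitian_array
begin

text \<open>Applying \<open>J\<close> to the index of the trace reverses the sign by
  \<open>typed\<close>. So the Lee form only sees \<open>Pp\<close>.\<close>

lemma lee_Pm: assumes "B < 2*n" shows "lee n Pm B = 0"
proof -
  interpret m: typed_array n Pm "-1" by (rule typed_Pm)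
  have "lee n Pm B = (\<Sum>A<2*n. - (eps n B * Pm A A (sig n B)))"
    unfolding lee_def by (rule sum_sig_eq) (use assms in \<open>simp add: m.typed\<close>)
  then show ?thesis unfolding lee_def sum_negf by linarith
qed

lemma lee_Pp: assumes "B < 2*n" shows "lee n Pp B = lee n P B"
  using lee_Pm[OF assms]
  by (simp add: lee_def Jpart_add[of P _ _ _ n] sum.distrib distrib_left)

abbreviation "lee2 \<equiv> (\<Sum>A<2*n. (lee n P A)\<^sup>2)"

lemma norm_cyc3_Pm: "sum3 n (\<lambda>A B C. (cyc3 Pm A B C)\<^sup>2) = 3 * pm2 + 6 * pmc"
  by (rule sum3_cyc3_sq)

text \<open>This contraction with \<open>F\<close> is needed for the inner product with \<alpha>_F
  \<and> F. One of the three cyclic terms vanishes, the other two give the Lee form each.\<close>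

lemma trace_cyc3_Pp:
  assumes A: "A < 2*n" shows "(\<Sum>B<2*n. eps n B * cyc3 Pp A B (sig n B)) = 2 * lee n P A"
proof -
  interpret p: typed_array n Pp 1 by (rule typed_Pp)
  have "(\<Sum>B<2*n. eps n B * Pp B (sig n B) A) = (\<Sum>B<2*n. - (eps n B * Pp B A (sig n B)))"
    by (intro sum.cong refl) (use A p.skew[of _ A "sig n _"] in simp)
  then show ?thesis
    using p.trace_sig_zero[OF A] p.trace_sig1[OF A] p.trace_sig2[OF A]
    by (simp add: cyc3_def distrib_left sum.distrib sum_negf lee_Pp[OF A])
qed

text \<open>The cyclic sum of \<open>lee n P A * Fd n B C\<close> is \<alpha>_F \<and> F. Its square
  sum is \<open>3 * (2 * real n * lee2) - 6 * lee2\<close>, hence the factor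
  \<open>6 * (real n - 1)\<close>; the mixed sum is \<open>6 * lee2\<close>. For
  \<open>c = 1 / (real n - 1)\<close> the two terms in \<open>c\<close> combine to
  \<open>- 6 * c * lee2\<close>.\<close>

lemma norm_primitive:
  "sum3 n (\<lambda>A B C. (cyc3 Pp A B C - c * cyc3 (\<lambda>A B C. lee n P A * Fd n B C) A B C)\<^sup>2)
    = 3 * pp2 - 12 * c * lee2 + 6 * c\<^sup>2 * (real n - 1) * lee2"
proof -
  let ?W = "\<lambda>A B C. lee n P A * Fd n B C"
  have 1: "sum3 n (\<lambda>A B C. cyc3 Pp A B C * cyc3 ?W A B C) = 6 * lee2"
  proof -
    have "sum3 n (\<lambda>A B C. cyc3 Pp A B C * ?W A B C) = (\<Sum>A<2*n. lee n P A * (\<Sum>B<2*n. \<Sum>C<2*n. Fd n B C * cyc3 Pp A B C))"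
      by (simp add: sum3_def sum_distrib_left mult_ac)
    also have "\<dots> = (\<Sum>A<2*n. 2 * (lee n P A)\<^sup>2)"
      by (intro sum.cong refl) (simp add: sum_Fd trace_cyc3_Pp power2_eq_square)
    also have "\<dots> = 2 * lee2" by (rule sum_distrib_left [symmetric])
    finally show ?thesis by (simp add: sum3_cyc3_prod)
  qed
  have 2: "sum3 n (\<lambda>A B C. ?W A B C * ?W A B C) = 2 * real n * lee2"
  proof -
    have "sum3 n (\<lambda>A B C. ?W A B C * ?W A B C) = (\<Sum>A<2*n. (lee n P A)\<^sup>2 * (\<Sum>B<2*n. \<Sum>C<2*n. Fd n B C * Fd n B C))"
      by (simp add: sum3_def sum_distrib_left mult_ac power2_eq_square)
    also have "(\<Sum>B<2*n. \<Sum>C<2*n. Fd n B C * Fd n B C) = 2 * real n"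
      by (simp add: sum_Fd) (simp add: Fd_def)
    finally show ?thesis by (simp add: sum_distrib_left mult.commute)
  qed
  have 3: "sum3 n (\<lambda>A B C. ?W A B C * ?W B C A) = - lee2"
  proof -
    have "sum3 n (\<lambda>A B C. ?W A B C * ?W B C A) = (\<Sum>A<2*n. \<Sum>B<2*n. lee n P A * lee n P B * (\<Sum>C<2*n. Fd n B C * Fd n C A))"
      by (simp add: sum3_def sum_distrib_left mult_ac)
    also have "\<dots> = (\<Sum>A<2*n. \<Sum>B<2*n. if A = B then - (lee n P A * lee n P B) else 0)"
      by (intro sum.cong refl) (simp add: sum_Fd, auto simp: Fd_def)
    also have "\<dots> = - lee2"
      by (simp add: sum.delta power2_eq_square sum_negf)
    finally show ?thesis .
  qed
  have "sum3 n (\<lambda>A B C. (cyc3 Pp A B C - c * cyc3 ?W A B C)\<^sup>2)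
    = sum3 n (\<lambda>A B C. (cyc3 Pp A B C)\<^sup>2 - 2 * c * (cyc3 Pp A B C * cyc3 ?W A B C) + c\<^sup>2 * (cyc3 ?W A B C)\<^sup>2)"
    by (rule sum3_cong) (simp add: power2_eq_square algebra_simps)
  also have "\<dots> = (3 * pp2 + 6 * 0) - 2 * c * (6 * lee2) + c\<^sup>2 * (3 * (2 * real n * lee2) + 6 * (- lee2))"
    unfolding sum3_linear sum3_cyc3_sq cyc_prods 1 2 3 ..
  finally show ?thesis by (simp add: algebra_simps)
qed

lemma norm_nijenhuis0:
  assumes NN: "\<And>A B C. A < 2*n \<Longrightarrow> B < 2*n \<Longrightarrow> C < 2*n \<Longrightarrow>
     NN A B C = -2 * Jtw n Pm B C A + 2 * Jtw n Pm C B A"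
  shows "sum3 n (\<lambda>C A B. (NN C A B - cyc3 NN C A B / 3)\<^sup>2) = 8/3 * (pm2 - pmc)"
proof -
  interpret m: typed_array n Pm "-1" by (rule typed_Pm)
  define y where "y = Jtw n Pm"
  interpret y: typed_array n y "-1" unfolding y_def by (rule typed_array_Jtw[OF typed_Pm])
  have sq: "sum3 n (\<lambda>A B C. y A B C * y A B C) = pm2"
    unfolding y_def by (rule sum3_Jtw_sq)
  have cy: "sum3 n (\<lambda>A B C. y A B C * y B C A) = pmc"
    unfolding y_def by (rule m.sum3_Jtw_cyc)
  have c: "sum3 n (\<lambda>A B C. f C A B) = sum3 n f" for f :: "nat \<Rightarrow> nat \<Rightarrow> nat \<Rightarrow> real"
    using sum3_cyc[of n "\<lambda>A B C. f C A B"] by simp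
  have "sum3 n (\<lambda>C A B. (NN C A B - cyc3 NN C A B / 3)\<^sup>2)
    = sum3 n (\<lambda>C A B. (4/3 * y C A B - 2/3 * y A B C - 2/3 * y B C A)\<^sup>2)"
  proof (rule sum3_cong)
    fix C A B assume r: "C < 2*n" "A < 2*n" "B < 2*n"
    have n: "NN X Y Z = -2 * y Y Z X - 2 * y Z X Y" if "X < 2*n" "Y < 2*n" "Z < 2*n" for X Y Z
      using NN[OF that] y.skew[of Z X Y] that by (simp add: y_def)
    \<comment> \<open>In short, \<open>NN\<close> is \<open>2 y - 2 cyc3 y\<close>. Its cyclic mean
      is \<open>-4/3 cyc3 y\<close>, so the difference is \<open>2 y - 2/3 cyc3 y\<close>, which
      explains the coefficients 4/3, -2/3 and -2/3.\<close>
    have "NN C A B - cyc3 NN C A B / 3 = 4/3 * y C A B - 2/3 * y A B C - 2/3 * y B C A"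
      using r by (simp add: n cyc3_def field_simps)
    then show "(NN C A B - cyc3 NN C A B / 3)\<^sup>2 = (4/3 * y C A B - 2/3 * y A B C - 2/3 * y B C A)\<^sup>2"
      by simp
  qed
  also have "\<dots> = sum3 n (\<lambda>C A B. 16/9 * (y C A B * y C A B) + 4/9 * (y A B C * y A B C) + 4/9 * (y B C A * y B C A)
     - 16/9 * (y C A B * y A B C) - 16/9 * (y B C A * y C A B) + 8/9 * (y A B C * y B C A))"
    by (rule sum3_cong) (simp add: power2_eq_square field_simps)
  also have "\<dots> = 24/9 * pm2 - 24/9 * pmc"
    using c[of "\<lambda>A B C. y A B C * y A B C"] c[of "\<lambda>A B C. y A B C * y B C A"]
      sum3_cyc[of n "\<lambda>A B C. y A B C * y A B C"] sum3_cyc[of n "\<lambda>A B C. y A B C * y B C A"] sq cy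
    unfolding sum3_linear by simp
  finally show ?thesis by simp
qed

end

context connection_array
begin

text \<open>The left-hand side is the component of the Nijenhuis tensor along the frame vector
  \<open>C\<close>, with the brackets written by the torsion-free connection and the outer
  \<open>J\<close> moved to the slot of \<open>C\<close>. Collecting terms by the differentiating
  vector gives commutators with \<open>J\<close>, and only the part \<open>T.Pm\<close> of
  \<open>T\<close> remains.\<close>

lemma nijenhuis_connection:
  assumes r: "A < 2*n" "B < 2*n" "C < 2*n"
  shows "(w A B C - w B A C) - eps n A * eps n C * (w (sig n A) B (sig n C) - w B (sig n A) (sig n C))
     - eps n B * eps n C * (w A (sig n B) (sig n C) - w (sig n B) A (sig n C))
     - eps n A * eps n B * (w (sig n A) (sig n B) C - w (sig n B) (sig n A) C)
   = -2 * Jtw n T.Pm A B C + 2 * Jtw n T.Pm B A C"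
  using r by (simp add: Jtw_def Jpart_def tors_def field_simps)

theorem hermitian_scal2:
  "(\<Sum>A<2*n. \<Sum>B<2*n. curv n w (gau n t w) (gd t) A B A B)
    = scal + (1 + t) * div\<alpha> - (1 + t)\<^sup>2 / 4 * \<alpha>2 - (t\<^sup>2 - 2*t)/4 * T.pp2 - T.pmc / 4"
  unfolding scal2 T.quad_ators by simp

theorem hermitian_scal1:
  assumes bianchi: "ricJ n w w dw = 2 * starJ n w w dw"
  shows "ricJ n w (gau n t w) (gd t)
    = 2 * scal + 4 * div\<alpha> - 2 * \<alpha>2 - 2 * T.pmc + (T.pp2 - T.pm2) / 2 - 2 * t * (div\<alpha> - \<alpha>2)"
proof -
  \<comment> \<open>Since \<open>D^0\<close> preserves \<open>J\<close>, its \<open>starJ\<close> is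
    also the trace known from \<open>hermitian_scal2\<close> at \<open>t = 0\<close>. Equating this
    with \<open>starJ_gau0\<close> determines \<open>starJ\<close> of the Levi-Civita
    connection.\<close>
  have "starJ n w (gau n 0 w) (gd 0) = (\<Sum>A<2*n. \<Sum>B<2*n. curv n w (gau n 0 w) (gd 0) A B A B)"
    by (rule starJ_J_comm[OF J_comm_gau[OF skew_w] J_comm_gau[OF skew_dw]])
  then have "starJ n w w dw = scal + 2 * div\<alpha> - \<alpha>2 - T.pmc"
    unfolding hermitian_scal2 starJ_gau0 T.quad_ators0_1 T.quad_ators0_2 by simp
  then show ?thesis
    unfolding scal1 bianchi T.quad_ators0_3 by simp
qed

end

section \<open>Derivatives of linear families and symmetry of second derivatives\<close>

abbreviation fder :: "('a::real_normed_vector \<Rightarrow> 'b::real_normed_vector) \<Rightarrow> 'a \<Rightarrow> 'a \<Rightarrow> 'b" where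
  "fder f y \<equiv> frechet_derivative f (at y)"

lemma fder_has_derivative: "f differentiable at y \<Longrightarrow> (f has_derivative fder f y) (at y)"
  by (simp add: frechet_derivative_works)

lemma fder_eqI: "(f has_derivative f') (at y) \<Longrightarrow> fder f y = f'"
  by (rule frechet_derivative_at [symmetric])

lemma fder_const: "fder (\<lambda>_. c) y = (\<lambda>_. 0)"
  by (rule fder_eqI) simp

lemma has_derivative_cong_open:
  assumes "open V" "y \<in> V" "\<And>z. z \<in> V \<Longrightarrow> f z = g z"
  shows "(f has_derivative f') (at y) \<longleftrightarrow> (g has_derivative f') (at y)"
  using has_derivative_transform_within_open[of f f' y UNIV V g]
    has_derivative_transform_within_open[of g f' y UNIV V f] assms by auto

lemma fder_cong_open:
  assumes "open V" "y \<in> V" "\<And>z. z \<in> V \<Longrightarrow> f z = g z"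
  shows "fder f y = fder g y"
  unfolding frechet_derivative_def using has_derivative_cong_open[OF assms] by simp

lemma differentiable_cong_open:
  assumes "open V" "y \<in> V" "\<And>z. z \<in> V \<Longrightarrow> f z = g z"
  shows "f differentiable at y \<longleftrightarrow> g differentiable at y"
  unfolding differentiable_def using has_derivative_cong_open[OF assms] by simp

lemma linear_fder: "f differentiable at y \<Longrightarrow> linear (fder f y)"
  by (rule linear_frechet_derivative)

lemma fder_scaleR: "f differentiable at y \<Longrightarrow> fder (\<lambda>z. c *\<^sub>R f z) y v = c *\<^sub>R fder f y v"
  by (subst fder_eqI[OF has_derivative_scaleR_right[OF fder_has_derivative]]) auto

lemma fder_sum:
  assumes "\<And>i. i \<in> I \<Longrightarrow> f i differentiable at y"
  shows "fder (\<lambda>z. \<Sum>i\<in>I. f i z) y v = (\<Sum>i\<in>I. fder (f i) y v)"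
  using fder_eqI[OF has_derivative_sum[of I f "\<lambda>i. fder (f i) y" "at y"]] assms
  by (simp add: fder_has_derivative)

lemma linear_euclidean_sum:
  fixes L :: "'e::euclidean_space \<Rightarrow> 'b::real_vector"
  assumes "linear L" shows "L v = (\<Sum>i\<in>Basis. (v \<bullet> i) *\<^sub>R L i)"
  using linear_sum[OF assms, of "\<lambda>i. (v \<bullet> i) *\<^sub>R i" Basis] linear_scale[OF assms]
  by (simp add: euclidean_representation)

text \<open>Tensor fields are only known to be differentiable on each fixed argument. Expanding the
  argument in the finite basis reduces the product rule to that of scalar multiples.\<close>

lemma has_derivative_linear_family:
  fixes L :: "'e::euclidean_space \<Rightarrow> 'f::euclidean_space \<Rightarrow> 'b::real_normed_vector"
  assumes V: "open V" "y \<in> V" and lin: "\<And>z. z \<in> V \<Longrightarrow> linear (L z)"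
    and diff: "\<And>v. (\<lambda>z. L z v) differentiable at y" and u: "u differentiable at y"
  shows "((\<lambda>z. L z (u z)) has_derivative (\<lambda>v. fder (\<lambda>z. L z (u y)) y v + L y (fder u y v))) (at y)"
proof -
  have ud: "((\<lambda>z. u z \<bullet> i) has_derivative (\<lambda>v. fder u y v \<bullet> i)) (at y)" for i
    by (rule has_derivative_inner_left[OF fder_has_derivative[OF u]])
  have d: "((\<lambda>z. \<Sum>i\<in>Basis. (u z \<bullet> i) *\<^sub>R L z i) has_derivative
     (\<lambda>v. \<Sum>i\<in>Basis. (u y \<bullet> i) *\<^sub>R fder (\<lambda>z. L z i) y v + (fder u y v \<bullet> i) *\<^sub>R L y i)) (at y)"
    by (intro has_derivative_sum has_derivative_scaleR ud fder_has_derivative diff)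
  have c: "fder (\<lambda>z. L z (u y)) y v = (\<Sum>i\<in>Basis. (u y \<bullet> i) *\<^sub>R fder (\<lambda>z. L z i) y v)" for v
  proof -
    have "fder (\<lambda>z. L z (u y)) y = fder (\<lambda>z. \<Sum>i\<in>Basis. (u y \<bullet> i) *\<^sub>R L z i) y"
      by (rule fder_cong_open[OF V]) (rule linear_euclidean_sum[OF lin])
    then show ?thesis
      by (simp add: fder_sum fder_scaleR diff)
  qed
  have "(\<lambda>v. \<Sum>i\<in>Basis. (u y \<bullet> i) *\<^sub>R fder (\<lambda>z. L z i) y v + (fder u y v \<bullet> i) *\<^sub>R L y i)
     = (\<lambda>v. fder (\<lambda>z. L z (u y)) y v + L y (fder u y v))"
    by (intro ext) (simp add: c sum.distrib linear_euclidean_sum[OF lin[OF V(2)], symmetric])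
  with d show ?thesis
    by (subst has_derivative_cong_open[OF V linear_euclidean_sum[OF lin]]) simp_all
qed

lemma linear_fder_family:
  fixes L :: "'e::euclidean_space \<Rightarrow> 'f::euclidean_space \<Rightarrow> 'b::real_normed_vector"
  assumes V: "open V" "y \<in> V" and lin: "\<And>z. z \<in> V \<Longrightarrow> linear (L z)"
    and diff: "\<And>v. (\<lambda>z. L z v) differentiable at y"
  shows "linear (\<lambda>w. fder (\<lambda>z. L z w) y v)"
proof (rule linearI)
  fix a b :: 'f and r :: real
  have "fder (\<lambda>z. L z (a + b)) y = fder (\<lambda>z. L z a + L z b) y"
    by (rule fder_cong_open[OF V]) (simp add: linear_add[OF lin])
  also have "\<dots> = (\<lambda>v. fder (\<lambda>z. L z a) y v + fder (\<lambda>z. L z b) y v)"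
    by (rule fder_eqI) (intro has_derivative_add fder_has_derivative diff)
  finally show "fder (\<lambda>z. L z (a + b)) y v = fder (\<lambda>z. L z a) y v + fder (\<lambda>z. L z b) y v" by simp
  have "fder (\<lambda>z. L z (r *\<^sub>R a)) y = fder (\<lambda>z. r *\<^sub>R L z a) y"
    by (rule fder_cong_open[OF V]) (simp add: linear_scale[OF lin])
  then show "fder (\<lambda>z. L z (r *\<^sub>R a)) y v = r *\<^sub>R fder (\<lambda>z. L z a) y v"
    by (simp add: fder_scaleR diff)
qed

lemma bilinear_linear1: "bilinear B \<Longrightarrow> linear (\<lambda>v. B v w)"
  and bilinear_linear2: "bilinear B \<Longrightarrow> linear (B v)"
  by (auto simp: bilinear_def)

lemma has_derivative_bilinear_family:
  fixes B :: "'e::euclidean_space \<Rightarrow> 'f::euclidean_space \<Rightarrow> 'g::euclidean_space \<Rightarrow> 'b::real_normed_vector"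
  assumes V: "open V" "y \<in> V" and bil: "\<And>z. z \<in> V \<Longrightarrow> bilinear (B z)"
    and diff: "\<And>v w. (\<lambda>z. B z v w) differentiable at y"
    and u: "u differentiable at y" and w: "w differentiable at y"
  shows "((\<lambda>z. B z (u z) (w z)) has_derivative
    (\<lambda>v. fder (\<lambda>z. B z (u y) (w y)) y v + B y (fder u y v) (w y) + B y (u y) (fder w y v))) (at y)"
proof -
  have 1: "((\<lambda>z. B z a (w z)) has_derivative (\<lambda>v. fder (\<lambda>z. B z a (w y)) y v + B y a (fder w y v))) (at y)" for a
    by (rule has_derivative_linear_family[OF V bilinear_linear2[OF bil] diff w])
  have "((\<lambda>z. B z (u z) (w z)) has_derivative (\<lambda>v. fder (\<lambda>z. B z (u y) (w z)) y v + B y (fder u y v) (w y))) (at y)"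
    by (rule has_derivative_linear_family[OF V, of "\<lambda>z v. B z v (w z)"])
      (use bil bilinear_linear1 1 u differentiableI in blast)+
  then show ?thesis
    unfolding fder_eqI[OF 1] by (simp add: add_ac)
qed

lemma smooth_on_differentiable: "smooth_on S f \<Longrightarrow> y \<in> S \<Longrightarrow> f differentiable at y"
  unfolding smooth_on_def by (metis Ck_on.simps(2))

lemma smooth_on_fder: "smooth_on S f \<Longrightarrow> smooth_on S (\<lambda>z. fder f z v)"
  unfolding smooth_on_def by (metis Ck_on.simps(2))

lemma smooth_on_continuous: "smooth_on S f \<Longrightarrow> continuous_on S f"
  unfolding smooth_on_def by (metis Ck_on.simps(1))

lemma smooth_on_const: "smooth_on S (\<lambda>_. c)"
proof -
  have "Ck_on k S (\<lambda>_. c)" for k and c :: 'b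
    by (induction k arbitrary: c) (simp_all add: fder_const)
  then show ?thesis by (simp add: smooth_on_def)
qed

text \<open>Two applications of the mean value theorem; the left-hand side is symmetric in \<open>u\<close> and \<open>v\<close>.\<close>

lemma second_difference_mvt:
  fixes f :: "'e::real_normed_vector \<Rightarrow> real"
  assumes S: "ball x r \<subseteq> S" and r: "r > 0" and t: "t > 0" "t * (norm u + norm v) < r"
    and f: "\<And>z. z \<in> S \<Longrightarrow> f differentiable at z"
    and fu: "\<And>z. z \<in> S \<Longrightarrow> (\<lambda>z. fder f z u) differentiable at z"
  shows "\<exists>a b. 0 < a \<and> a < t \<and> 0 < b \<and> b < t \<and>
    f (x + t *\<^sub>R u + t *\<^sub>R v) - f (x + t *\<^sub>R u) - f (x + t *\<^sub>R v) + f x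
      = t * t * fder (\<lambda>z. fder f z u) (x + a *\<^sub>R u + b *\<^sub>R v) v"
proof -
  have inS: "x + a *\<^sub>R u + b *\<^sub>R v \<in> S" if "0 \<le> a" "a \<le> t" "0 \<le> b" "b \<le> t" for a b
  proof -
    have "norm (a *\<^sub>R u + b *\<^sub>R v) \<le> a * norm u + b * norm v"
      using norm_triangle_ineq[of "a *\<^sub>R u" "b *\<^sub>R v"] that by simp
    also have "\<dots> \<le> t * norm u + t * norm v"
      using that by (intro add_mono mult_right_mono) auto
    also have "\<dots> < r" using t by (simp add: distrib_left)
    finally have "dist (x + a *\<^sub>R u + b *\<^sub>R v) x < r"
      by (simp add: dist_norm add.assoc)
    then show ?thesis using S by (auto simp: dist_commute)
  qed
  define g where "g s = f (x + s *\<^sub>R u + t *\<^sub>R v) - f (x + s *\<^sub>R u)" for s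
  have d1: "((\<lambda>s. f (x + s *\<^sub>R u + c *\<^sub>R v)) has_real_derivative fder f (x + a *\<^sub>R u + c *\<^sub>R v) u) (at a)"
    if "0 \<le> a" "a \<le> t" "0 \<le> c" "c \<le> t" for a c
  proof -
    have "((\<lambda>s. f (x + s *\<^sub>R u + c *\<^sub>R v)) has_derivative (\<lambda>h. fder f (x + a *\<^sub>R u + c *\<^sub>R v) (h *\<^sub>R u))) (at a)"
      by (rule has_derivative_compose[of "\<lambda>s. x + s *\<^sub>R u + c *\<^sub>R v", OF _ fder_has_derivative[OF f[OF inS[OF that]]]])
        (auto intro!: derivative_eq_intros)
    moreover have "(\<lambda>h. fder f (x + a *\<^sub>R u + c *\<^sub>R v) (h *\<^sub>R u)) = (*) (fder f (x + a *\<^sub>R u + c *\<^sub>R v) u)"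
      by (intro ext) (simp add: linear_scale[OF linear_fder[OF f[OF inS[OF that]]]] mult.commute)
    ultimately show ?thesis unfolding has_field_derivative_def by simp
  qed
  have "\<exists>a. 0 < a \<and> a < t \<and> g t - g 0 = (t - 0) * (fder f (x + a *\<^sub>R u + t *\<^sub>R v) u - fder f (x + a *\<^sub>R u) u)"
  proof (rule MVT2[OF t(1)])
    fix a assume a: "0 \<le> a" "a \<le> t"
    show "DERIV g a :> fder f (x + a *\<^sub>R u + t *\<^sub>R v) u - fder f (x + a *\<^sub>R u) u"
      unfolding g_def using d1[of a t] d1[of a 0] a t by (auto intro!: DERIV_diff)
  qed
  then obtain a where a: "0 < a" "a < t"
    and ga: "g t - g 0 = t * (fder f (x + a *\<^sub>R u + t *\<^sub>R v) u - fder f (x + a *\<^sub>R u) u)" by auto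
  define k where "k s = fder f (x + a *\<^sub>R u + s *\<^sub>R v) u" for s
  have "\<exists>b. 0 < b \<and> b < t \<and> k t - k 0 = (t - 0) * fder (\<lambda>z. fder f z u) (x + a *\<^sub>R u + b *\<^sub>R v) v"
  proof (rule MVT2[OF t(1)])
    fix b assume b: "0 \<le> b" "b \<le> t"
    have z: "x + a *\<^sub>R u + b *\<^sub>R v \<in> S" using inS a b by auto
    have "((\<lambda>s. fder f (x + a *\<^sub>R u + s *\<^sub>R v) u) has_derivative
       (\<lambda>h. fder (\<lambda>z. fder f z u) (x + a *\<^sub>R u + b *\<^sub>R v) (h *\<^sub>R v))) (at b)"
      by (rule has_derivative_compose[of "\<lambda>s. x + a *\<^sub>R u + s *\<^sub>R v", OF _ fder_has_derivative[OF fu[OF z]]])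
        (auto intro!: derivative_eq_intros)
    moreover have "(\<lambda>h. fder (\<lambda>z. fder f z u) (x + a *\<^sub>R u + b *\<^sub>R v) (h *\<^sub>R v))
      = (*) (fder (\<lambda>z. fder f z u) (x + a *\<^sub>R u + b *\<^sub>R v) v)"
      by (intro ext) (simp add: linear_scale[OF linear_fder[OF fu[OF z]]] mult.commute)
    ultimately show "DERIV k b :> fder (\<lambda>z. fder f z u) (x + a *\<^sub>R u + b *\<^sub>R v) v"
      unfolding has_field_derivative_def k_def by simp
  qed
  then obtain b where b: "0 < b" "b < t"
    and kb: "k t - k 0 = t * fder (\<lambda>z. fder f z u) (x + a *\<^sub>R u + b *\<^sub>R v) v" by auto
  have "f (x + t *\<^sub>R u + t *\<^sub>R v) - f (x + t *\<^sub>R u) - f (x + t *\<^sub>R v) + f x = g t - g 0"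
    by (simp add: g_def)
  also have "\<dots> = t * (k t - k 0)" using ga by (simp add: k_def)
  finally show ?thesis using a b kb by (auto simp: mult.assoc)
qed

text \<open>If the two mixed derivatives differed at \<open>x\<close>, continuity would keep each
  within half the gap of its value near \<open>x\<close>, whereas
  \<open>second_difference_mvt\<close> gives nearby points at which they agree.\<close>

lemma second_derivative_symmetric_real:
  fixes f :: "'e::real_normed_vector \<Rightarrow> real"
  assumes S: "open S" "x \<in> S"
    and f: "\<And>z. z \<in> S \<Longrightarrow> f differentiable at z"
    and fu: "\<And>z w. z \<in> S \<Longrightarrow> (\<lambda>z. fder f z w) differentiable at z"
    and cont: "\<And>w w'. continuous_on S (\<lambda>z. fder (\<lambda>z. fder f z w) z w')"
  shows "fder (\<lambda>z. fder f z u) x v = fder (\<lambda>z. fder f z v) x u"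
proof (rule ccontr)
  let ?p = "\<lambda>z. fder (\<lambda>z. fder f z u) z v" and ?q = "\<lambda>z. fder (\<lambda>z. fder f z v) z u"
  assume ne: "?p x \<noteq> ?q x"
  define e where "e = \<bar>?p x - ?q x\<bar> / 2"
  have e: "e > 0" using ne by (simp add: e_def)
  have "\<forall>\<^sub>F z in at x. dist (?p z) (?p x) < e" "\<forall>\<^sub>F z in at x. dist (?q z) (?q x) < e"
    using cont S e by (auto simp: continuous_on_eq_continuous_at isCont_def dest!: tendstoD)
  moreover have "\<forall>\<^sub>F z in at x. z \<in> S" using S eventually_at_topological by blast
  ultimately have "\<forall>\<^sub>F z in at x. dist (?p z) (?p x) < e \<and> dist (?q z) (?q x) < e \<and> z \<in> S"
    by eventually_elim simp
  then obtain r where r: "r > 0"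
    and near: "\<And>z. dist z x < r \<Longrightarrow> dist (?p z) (?p x) < e \<and> dist (?q z) (?q x) < e \<and> z \<in> S"
    unfolding eventually_at using e S by (metis UNIV_I dist_self)
  have ball: "ball x r \<subseteq> S" using near by (auto simp: dist_commute)
  \<comment> \<open>The summand 1 keeps the denominator of \<open>t\<close> positive when
    \<open>u\<close> and \<open>v\<close> are both zero.\<close>
  define m where "m = norm u + norm v + 1"
  define t where "t = r / (2 * m)"
  have den: "m > 0" by (simp add: m_def add_nonneg_pos)
  have t: "t > 0" using r den by (simp add: t_def)
  have tr: "t * (norm u + norm v) < r"
  proof -
    have "t * (norm u + norm v) \<le> t * m" using t by (simp add: m_def)
    also have "\<dots> = r / 2" using den by (simp add: t_def)
    also have "\<dots> < r" using r by simp
    finally show ?thesis .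
  qed
  have close: "dist (x + a *\<^sub>R c + b *\<^sub>R d) x < r"
    if "0 < a" "a < t" "0 < b" "b < t" "norm c + norm d = norm u + norm v" for a b and c d :: 'e
  proof -
    have "norm (a *\<^sub>R c + b *\<^sub>R d) \<le> a * norm c + b * norm d"
      using norm_triangle_ineq[of "a *\<^sub>R c" "b *\<^sub>R d"] that by simp
    also have "\<dots> \<le> t * norm c + t * norm d"
      using that by (intro add_mono mult_right_mono) auto
    also have "\<dots> < r" using tr that by (simp add: distrib_left [symmetric])
    finally show ?thesis by (simp add: dist_norm add.assoc)
  qed
  obtain a b where ab: "0 < a" "a < t" "0 < b" "b < t"
    and 1: "f (x + t *\<^sub>R u + t *\<^sub>R v) - f (x + t *\<^sub>R u) - f (x + t *\<^sub>R v) + f x = t * t * ?p (x + a *\<^sub>R u + b *\<^sub>R v)"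
    using second_difference_mvt[OF ball r t tr f fu] by auto
  obtain c d where cd: "0 < c" "c < t" "0 < d" "d < t"
    and 2: "f (x + t *\<^sub>R v + t *\<^sub>R u) - f (x + t *\<^sub>R v) - f (x + t *\<^sub>R u) + f x = t * t * ?q (x + c *\<^sub>R v + d *\<^sub>R u)"
    using second_difference_mvt[OF ball r t _ f fu, of v u] tr by (auto simp: add.commute)
  have "t * t * ?p (x + a *\<^sub>R u + b *\<^sub>R v) = t * t * ?q (x + c *\<^sub>R v + d *\<^sub>R u)"
  proof -
    have "x + t *\<^sub>R v + t *\<^sub>R u = x + t *\<^sub>R u + t *\<^sub>R v" by (simp add: add_ac)
    then show ?thesis unfolding 1 [symmetric] 2 [symmetric] by (simp add: algebra_simps)
  qed
  then have "?p (x + a *\<^sub>R u + b *\<^sub>R v) = ?q (x + c *\<^sub>R v + d *\<^sub>R u)" using t by simp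
  moreover have "dist (?p (x + a *\<^sub>R u + b *\<^sub>R v)) (?p x) < e"
    using near[OF close[OF ab]] by simp
  moreover have "dist (?q (x + c *\<^sub>R v + d *\<^sub>R u)) (?q x) < e"
    using near[OF close[OF cd]] by (simp add: add.commute)
  moreover have "\<bar>?p x - ?q x\<bar> \<le> \<bar>?q (x + c *\<^sub>R v + d *\<^sub>R u) - ?q x\<bar> + \<bar>?q (x + c *\<^sub>R v + d *\<^sub>R u) - ?p x\<bar>"
    using abs_triangle_ineq4[of "?q (x + c *\<^sub>R v + d *\<^sub>R u) - ?q x" "?q (x + c *\<^sub>R v + d *\<^sub>R u) - ?p x"] by simp
  ultimately show False by (simp add: dist_real_def e_def)
qed

lemma second_derivative_symmetric:
  fixes f :: "'e::euclidean_space \<Rightarrow> 'f::euclidean_space"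
  assumes S: "open S" "x \<in> S" and f: "smooth_on S f"
  shows "fder (\<lambda>z. fder f z u) x v = fder (\<lambda>z. fder f z v) x u"
proof (rule euclidean_eqI)
  fix i :: 'f assume "i \<in> Basis"
  have inner: "fder (\<lambda>z. g z \<bullet> i) z w = fder g z w \<bullet> i" if "g differentiable at z" for g :: "'e \<Rightarrow> 'f" and z w
    by (rule fun_cong[OF fder_eqI]) (rule has_derivative_inner_left[OF fder_has_derivative[OF that]])
  have di: "(\<lambda>z. g z \<bullet> i) differentiable at z" if "g differentiable at z" for g :: "'e \<Rightarrow> 'f" and z
    using that by simp
  note d = smooth_on_differentiable[OF f] smooth_on_differentiable[OF smooth_on_fder[OF f]]
  have i1: "fder (\<lambda>z. f z \<bullet> i) z w = fder f z w \<bullet> i" if "z \<in> S" for z w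
    using inner d that by blast
  have i2: "fder (\<lambda>z. fder (\<lambda>z. f z \<bullet> i) z w) z w' = fder (\<lambda>z. fder f z w) z w' \<bullet> i" if "z \<in> S" for z w w'
    using fder_cong_open[OF S(1) that, of "\<lambda>z. fder (\<lambda>z. f z \<bullet> i) z w" "\<lambda>z. fder f z w \<bullet> i"] i1
      inner[OF d(2)[OF that]] by simp
  have "fder (\<lambda>z. fder (\<lambda>z. f z \<bullet> i) z u) x v = fder (\<lambda>z. fder (\<lambda>z. f z \<bullet> i) z v) x u"
  proof (rule second_derivative_symmetric_real[OF S])
    show "(\<lambda>z. f z \<bullet> i) differentiable at z" if "z \<in> S" for z using di d that by blast
    show "(\<lambda>z. fder (\<lambda>z. f z \<bullet> i) z w) differentiable at z" if "z \<in> S" for z w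
      using differentiable_cong_open[OF S(1) that, of "\<lambda>z. fder (\<lambda>z. f z \<bullet> i) z w" "\<lambda>z. fder f z w \<bullet> i"]
        i1 di[OF d(2)[OF that]] by simp
    show "continuous_on S (\<lambda>z. fder (\<lambda>z. fder (\<lambda>z. f z \<bullet> i) z w) z w')" for w w'
      using smooth_on_continuous[OF smooth_on_fder[OF smooth_on_fder[OF f]], of w w']
      by (subst continuous_on_cong[OF refl i2]) (auto intro!: continuous_intros)
  qed
  then show "fder (\<lambda>z. fder f z u) x v \<bullet> i = fder (\<lambda>z. fder f z v) x u \<bullet> i"
    using i2[OF S(2)] by simp
qed

section \<open>Curvature in an adapted frame\<close>

text \<open>The local data on the domain \<open>V\<close> of the frame. Absence of torsion and
  compatibility with the metric are stated on constant vectors, as symmetry of \<Gamma> and a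
  formula for the derivative of \<open>h\<close>.\<close>

locale hermitian_chart =
  fixes n :: nat and V :: "'e::euclidean_space set" and h :: "'e metric" and J :: "'e endo"
    and \<Gamma> :: "'e \<Rightarrow> 'e \<Rightarrow> 'e \<Rightarrow> 'e" and E :: "nat \<Rightarrow> 'e vfield"
  assumes dim: "DIM('e) = 2 * n" and open_V: "open V"
    and h_bilinear: "\<And>y. y \<in> V \<Longrightarrow> bilinear (h y)"
    and h_sym: "\<And>y v w. y \<in> V \<Longrightarrow> h y v w = h y w v"
    and h_diff: "\<And>y v w. y \<in> V \<Longrightarrow> (\<lambda>z. h z v w) differentiable at y"
    and J_linear: "\<And>y. y \<in> V \<Longrightarrow> linear (J y)"
    and J_J: "\<And>y v. y \<in> V \<Longrightarrow> J y (J y v) = - v"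
    and h_J_J: "\<And>y v w. y \<in> V \<Longrightarrow> h y (J y v) (J y w) = h y v w"
    and J_diff: "\<And>y v. y \<in> V \<Longrightarrow> (\<lambda>z. J z v) differentiable at y"
    and \<Gamma>_bilinear: "\<And>y. y \<in> V \<Longrightarrow> bilinear (\<Gamma> y)"
    and \<Gamma>_sym: "\<And>y v w. y \<in> V \<Longrightarrow> \<Gamma> y v w = \<Gamma> y w v"
    and \<Gamma>_diff: "\<And>y v w. y \<in> V \<Longrightarrow> (\<lambda>z. \<Gamma> z v w) differentiable at y"
    and \<Gamma>_metric: "\<And>y u v w. y \<in> V \<Longrightarrow>
      fder (\<lambda>z. h z v w) y u = h y (\<Gamma> y u v) w + h y v (\<Gamma> y u w)"
    and smooth_E: "\<And>A. A < 2*n \<Longrightarrow> smooth_on V (E A)"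
    and E_J': "\<And>y i. y \<in> V \<Longrightarrow> i < n \<Longrightarrow> E (n + i) y = J y (E i y)"
    and E_orth: "\<And>y A B. y \<in> V \<Longrightarrow> A < 2*n \<Longrightarrow> B < 2*n \<Longrightarrow> h y (E A y) (E B y) = (if A = B then 1 else 0)"
begin

lemma h_add: "y \<in> V \<Longrightarrow> h y (u + v) w = h y u w + h y v w" "y \<in> V \<Longrightarrow> h y w (u + v) = h y w u + h y w v"
  and h_scale: "y \<in> V \<Longrightarrow> h y (r *\<^sub>R u) w = r * h y u w" "y \<in> V \<Longrightarrow> h y w (r *\<^sub>R u) = r * h y w u"
  and h_diff': "y \<in> V \<Longrightarrow> h y (u - v) w = h y u w - h y v w" "y \<in> V \<Longrightarrow> h y w (u - v) = h y w u - h y w v"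
  and h_neg: "y \<in> V \<Longrightarrow> h y (- u) w = - h y u w" "y \<in> V \<Longrightarrow> h y w (- u) = - h y w u"
  and h_zero: "y \<in> V \<Longrightarrow> h y 0 w = 0" "y \<in> V \<Longrightarrow> h y w 0 = 0"
  using h_bilinear by (simp_all add: bilinear_ladd bilinear_radd bilinear_lmul bilinear_rmul
      bilinear_lsub bilinear_rsub bilinear_lneg bilinear_rneg bilinear_lzero bilinear_rzero)

lemma h_sum: "y \<in> V \<Longrightarrow> h y (\<Sum>i\<in>I. f i) w = (\<Sum>i\<in>I. h y (f i) w)"
    "y \<in> V \<Longrightarrow> h y w (\<Sum>i\<in>I. f i) = (\<Sum>i\<in>I. h y w (f i))"
  using h_bilinear[of y] linear_sum[of "\<lambda>v. h y v w"] linear_sum[of "h y w"]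
  by (simp_all add: bilinear_def)

lemmas h_simps = h_add h_scale h_diff' h_neg h_zero h_sum

lemma E_diff: "A < 2*n \<Longrightarrow> y \<in> V \<Longrightarrow> E A differentiable at y"
  by (rule smooth_on_differentiable[OF smooth_E])

lemma E_diff2: "A < 2*n \<Longrightarrow> y \<in> V \<Longrightarrow> (\<lambda>z. fder (E A) z v) differentiable at y"
  by (rule smooth_on_differentiable[OF smooth_on_fder[OF smooth_E]])

lemma E_J: assumes y: "y \<in> V" and A: "A < 2*n" shows "J y (E A y) = eps n A *\<^sub>R E (sig n A) y"
proof (cases "A < n")
  case True
  then show ?thesis using E_J'[OF y] by (simp add: eps_def sig_def)
next
  case False
  then have "E A y = J y (E (A - n) y)" using E_J'[OF y, of "A - n"] A by simp
  then show ?thesis using False J_J[OF y] by (simp add: eps_def sig_def)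
qed

lemma h_J: "y \<in> V \<Longrightarrow> h y (J y v) w = - h y v (J y w)"
  using h_J_J[of y v "J y w"] by (simp add: J_J h_simps)

text \<open>Orthonormality makes the \<open>2 * n\<close> frame vectors independent, and by
  \<open>dim\<close> they then span. The inner product of the type is unrelated to \<open>h\<close>,
  so the expansion is proved from these two facts.\<close>

lemma frame_expand:
  assumes y: "y \<in> V" shows "v = (\<Sum>A<2*n. h y v (E A y) *\<^sub>R E A y)"
proof -
  let ?S = "(\<lambda>A. E A y) ` {..<2*n}"
  have inj: "inj_on (\<lambda>A. E A y) {..<2*n}"
    by (rule inj_onI) (use E_orth[OF y] in \<open>metis lessThan_iff zero_neq_one\<close>)
  have "independent ?S"
    unfolding independent_explicit_module
  proof (intro allI impI)
    fix t u v assume t: "finite t" "t \<subseteq> ?S" and z: "(\<Sum>v\<in>t. u v *\<^sub>R v) = 0" and v: "v \<in> t"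
    obtain B where B: "B < 2*n" "v = E B y" using t v by auto
    have "0 = h y (\<Sum>w\<in>t. u w *\<^sub>R w) v" by (simp add: z h_simps y)
    also have "\<dots> = (\<Sum>w\<in>t. u w * h y w v)" by (simp add: h_simps y)
    also have "\<dots> = (\<Sum>w\<in>t. if w = v then u w else 0)"
    proof (rule sum.cong)
      fix w assume "w \<in> t"
      then obtain A where "A < 2*n" "w = E A y" using t by auto
      then show "u w * h y w v = (if w = v then u w else 0)"
        using B E_orth[OF y, of A B] E_orth[OF y, of B B] inj by (auto simp: inj_on_def)
    qed simp
    also have "\<dots> = u v" using t v by (simp add: sum.delta')
    finally show "u v = 0" by simp
  qed
  moreover have "card ?S = DIM('e)" using inj dim by (simp add: card_image)
  ultimately have "span ?S = UNIV"
    by (metis dim_UNIV dim_eq_card_independent dim_eq_full)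
  then have "v \<in> span ?S" by simp
  then obtain c where c: "v = (\<Sum>A<2*n. c A *\<^sub>R E A y)"
    by (auto simp: span_finite sum.reindex[OF inj] image_iff)
  have "h y v (E B y) = c B" if "B < 2*n" for B
    unfolding c using that y by (simp add: h_simps E_orth if_distrib[of "\<lambda>x. _ * x"] cong: if_cong)
  then show ?thesis by (subst c) (rule sum.cong, auto)
qed

lemma frame_eqI:
  assumes y: "y \<in> V" and "\<And>A. A < 2*n \<Longrightarrow> h y v (E A y) = h y w (E A y)" shows "v = w"
proof -
  have "v = (\<Sum>A<2*n. h y v (E A y) *\<^sub>R E A y)" by (rule frame_expand[OF y])
  also have "\<dots> = (\<Sum>A<2*n. h y w (E A y) *\<^sub>R E A y)"
    by (rule sum.cong) (simp_all add: assms(2))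
  also have "\<dots> = w" by (rule frame_expand[OF y, symmetric])
  finally show ?thesis .
qed

definition w :: "nat \<Rightarrow> nat \<Rightarrow> nat \<Rightarrow> 'e \<Rightarrow> real" where
  "w A B C y = h y (cov \<Gamma> (E A) (E B) y) (E C y)"

lemma cov_frame: "y \<in> V \<Longrightarrow> cov \<Gamma> (E A) (E B) y = (\<Sum>C<2*n. w A B C y *\<^sub>R E C y)"
  unfolding w_def by (rule frame_expand)

lemma has_derivative_h:
  assumes y: "y \<in> V" and u: "u differentiable at y" and v: "v differentiable at y"
  shows "((\<lambda>z. h z (u z) (v z)) has_derivative (\<lambda>a. h y (fder u y a + \<Gamma> y a (u y)) (v y) + h y (u y) (fder v y a + \<Gamma> y a (v y)))) (at y)"
  using has_derivative_bilinear_family[OF open_V y h_bilinear h_diff[OF y] u v]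
  by (simp add: \<Gamma>_metric y h_simps algebra_simps)

lemma differentiable_h:
  "y \<in> V \<Longrightarrow> u differentiable at y \<Longrightarrow> v differentiable at y \<Longrightarrow> (\<lambda>z. h z (u z) (v z)) differentiable at y"
  using has_derivative_h differentiableI by blast

lemma has_derivative_cov:
  assumes y: "y \<in> V" and A: "A < 2*n" and B: "B < 2*n"
  shows "(cov \<Gamma> (E A) (E B) has_derivative (\<lambda>v. fder (\<lambda>z. fder (E B) z (E A y)) y v + fder (E B) y (fder (E A) y v)
    + (fder (\<lambda>z. \<Gamma> z (E A y) (E B y)) y v + \<Gamma> y (fder (E A) y v) (E B y) + \<Gamma> y (E A y) (fder (E B) y v)))) (at y)"
  unfolding cov_def
  by (intro has_derivative_add has_derivative_linear_family[OF open_V y] has_derivative_bilinear_family[OF open_V y]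
      linear_fder E_diff E_diff2 \<Gamma>_bilinear \<Gamma>_diff A B y)

lemma w_diff: "A < 2*n \<Longrightarrow> B < 2*n \<Longrightarrow> C < 2*n \<Longrightarrow> y \<in> V \<Longrightarrow> w A B C differentiable at y"
  unfolding w_def [abs_def]
  by (intro differentiable_h E_diff differentiableI[OF has_derivative_cov])

lemma w_skew:
  assumes y: "y \<in> V" and r: "A < 2*n" "B < 2*n" "C < 2*n"
  shows "w A C B y = - w A B C y"
proof -
  have "fder (\<lambda>z. h z (E B z) (E C z)) y = fder (\<lambda>_. if B = C then 1 else 0 :: real) y"
    by (rule fder_cong_open[OF open_V y]) (use E_orth r in simp)
  then have "fder (\<lambda>z. h z (E B z) (E C z)) y (E A y) = 0" by (simp add: fder_const)
  then have "h y (cov \<Gamma> (E A) (E B) y) (E C y) + h y (E B y) (cov \<Gamma> (E A) (E C) y) = 0"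
    using fder_eqI[OF has_derivative_h[OF y E_diff E_diff]] r y by (simp add: cov_def)
  then show ?thesis using h_sym[OF y, of "E B y"] by (simp add: w_def)
qed

definition dw :: "'e \<Rightarrow> nat \<Rightarrow> nat \<Rightarrow> nat \<Rightarrow> nat \<Rightarrow> real" where
  "dw y D A B C = fder (w A B C) y (E D y)"

lemma connection_array: assumes y: "y \<in> V" shows "connection_array n (\<lambda>A B C. w A B C y) (dw y)"
proof
  show "skew_array n (\<lambda>A B C. w A B C y)"
    unfolding skew_array_def by (intro allI impI w_skew[OF y])
  fix D
  show "skew_array n (dw y D)"
    unfolding skew_array_def
  proof (intro allI impI)
    fix A B C assume r: "A < 2*n" "B < 2*n" "C < 2*n"
    have "fder (w A C B) y = fder (\<lambda>z. - w A B C z) y"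
      by (rule fder_cong_open[OF open_V y]) (rule w_skew[OF _ r])
    also have "\<dots> = (\<lambda>v. - fder (w A B C) y v)"
      by (rule fder_eqI) (intro has_derivative_minus fder_has_derivative w_diff r y)
    finally show "dw y D A C B = - dw y D A B C" by (simp add: dw_def)
  qed
qed

abbreviation Tw :: "'e \<Rightarrow> nat \<Rightarrow> nat \<Rightarrow> nat \<Rightarrow> real" where
  "Tw y \<equiv> tors n (\<lambda>A B C. w A B C y)"

text \<open>\<open>nJ y v u\<close> is \<open>(\<nabla>\<^sub>v J) u\<close>.\<close>

definition nJ :: "'e \<Rightarrow> 'e \<Rightarrow> 'e \<Rightarrow> 'e" where
  "nJ y v u = fder (\<lambda>z. J z u) y v + \<Gamma> y v (J y u) - J y (\<Gamma> y v u)"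

lemma bilinear_nJ: assumes y: "y \<in> V" shows "bilinear (nJ y)"
proof -
  note J = linear_fder[OF J_diff[OF y]] linear_fder_family[OF open_V y J_linear J_diff[OF y]]
  have G: "linear (\<lambda>v. \<Gamma> y v u)" "linear (\<Gamma> y u)" for u using \<Gamma>_bilinear[OF y] by (auto simp: bilinear_def)
  note c = linear_compose[OF _ J_linear[OF y], unfolded comp_def]
  show ?thesis
    unfolding bilinear_def nJ_def
    by (intro conjI allI linear_compose_add linear_compose_sub J G c
        linear_compose[OF J_linear[OF y] G(2), unfolded comp_def])
qed

lemma has_derivative_J:
  assumes "y \<in> V" "u differentiable at y"
  shows "((\<lambda>z. J z (u z)) has_derivative (\<lambda>v. fder (\<lambda>z. J z (u y)) y v + J y (fder u y v))) (at y)"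
  by (rule has_derivative_linear_family[OF open_V assms(1) J_linear J_diff assms(2)]) (use assms in auto)

lemma cov_endo_eq:
  assumes y: "y \<in> V" and Y: "Y differentiable at y"
  shows "cov_endo \<Gamma> J X Y y = nJ y (X y) (Y y)"
  using fder_eqI[OF has_derivative_J[OF y Y]] linear_add[OF J_linear[OF y]]
  by (simp add: cov_endo_def cov_def endo_app_def nJ_def)

text \<open>Near \<open>y\<close> the field \<open>endo_app J (E B)\<close> is a constant multiple
  of a frame field, so no derivative of components of \<open>J\<close> occurs and
  \<open>\<nabla>J\<close> is algebraic in the connection coefficients.\<close>

lemma h_nJ:
  assumes y: "y \<in> V" and r: "A < 2*n" "B < 2*n" "C < 2*n"
  shows "h y (nJ y (E A y) (E B y)) (E C y) = Tw y A B C"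
proof -
  have "fder (endo_app J (E B)) y = fder (\<lambda>z. eps n B *\<^sub>R E (sig n B) z) y"
    by (rule fder_cong_open[OF open_V y]) (simp add: endo_app_def E_J r)
  then have 1: "cov \<Gamma> (E A) (endo_app J (E B)) y = eps n B *\<^sub>R cov \<Gamma> (E A) (E (sig n B)) y"
    using bilinear_rmul[OF \<Gamma>_bilinear[OF y]]
    by (simp add: cov_def fder_scaleR E_diff r y endo_app_def E_J scaleR_add_right)
  have "nJ y (E A y) (E B y) = cov \<Gamma> (E A) (endo_app J (E B)) y - J y (cov \<Gamma> (E A) (E B) y)"
    using cov_endo_eq[OF y E_diff[OF r(2) y], of "E A"] by (simp add: cov_endo_def)
  then show ?thesis
    using r y by (simp add: 1 h_simps h_J E_J tors_def w_def)
qed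

lemma nJ_J: "y \<in> V \<Longrightarrow> A < 2*n \<Longrightarrow> B < 2*n \<Longrightarrow> C < 2*n \<Longrightarrow>
  h y (J y (nJ y (E A y) (E B y))) (E C y) = - (eps n C * Tw y A B (sig n C))"
  by (simp add: h_J E_J h_simps h_nJ)

end

section \<open>The connections \<open>D^t\<close> and the curvature components in the frame\<close>

context hermitian_chart
begin

lemma nJ_simps:
  "y \<in> V \<Longrightarrow> nJ y (u + v) z = nJ y u z + nJ y v z" "y \<in> V \<Longrightarrow> nJ y z (u + v) = nJ y z u + nJ y z v"
  "y \<in> V \<Longrightarrow> nJ y (r *\<^sub>R u) z = r *\<^sub>R nJ y u z" "y \<in> V \<Longrightarrow> nJ y z (r *\<^sub>R u) = r *\<^sub>R nJ y z u"
  using bilinear_nJ by (simp_all add: bilinear_ladd bilinear_radd bilinear_lmul bilinear_rmul)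

lemma J_simps:
  "y \<in> V \<Longrightarrow> J y (u + v) = J y u + J y v" "y \<in> V \<Longrightarrow> J y (r *\<^sub>R u) = r *\<^sub>R J y u"
  using J_linear by (simp_all add: linear_add linear_scale)

definition aform :: "real \<Rightarrow> 'e \<Rightarrow> 'e \<Rightarrow> 'e \<Rightarrow> 'e \<Rightarrow> real" where
  "aform t y v u z = - (1/2) * h y (J y (nJ y v u)) z + t/4 *
     (h y (nJ y (J y u) z + J y (nJ y u z)) v - h y (nJ y (J y z) u + J y (nJ y z u)) v)"

lemma aform_linear:
  assumes "y \<in> V"
  shows "linear (\<lambda>v. aform t y v u z)" "linear (\<lambda>u. aform t y v u z)" "linear (aform t y v u)"
  by (rule linearI; simp add: aform_def nJ_simps J_simps h_simps assms algebra_simps)+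

lemma gauduchon_form_eq:
  assumes y: "y \<in> V" and Y: "Y differentiable at y"
  shows "gauduchon_form h J \<Gamma> t X Y (\<lambda>_. z) y = h y (cov \<Gamma> X Y y) z + aform t y (X y) (Y y) z"
  by (simp add: gauduchon_form_def cov_endo_eq[OF y Y] cov_endo_eq[OF y] endo_app_def aform_def h_simps y)

text \<open>The vector dual to \<open>aform\<close> under \<open>h\<close>. It provides the explicit
  witness for the description operator in \<open>gauduchon\<close>.\<close>

definition gS :: "real \<Rightarrow> 'e \<Rightarrow> 'e \<Rightarrow> 'e \<Rightarrow> 'e" where
  "gS t y v u = (\<Sum>C<2*n. aform t y v u (E C y) *\<^sub>R E C y)"

lemma bilinear_gS: assumes "y \<in> V" shows "bilinear (gS t y)"
  unfolding bilinear_def gS_def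
  by (intro conjI allI linear_compose_sum ballI linearI)
    (simp_all add: linear_add[OF aform_linear(1)[OF assms]] linear_add[OF aform_linear(2)[OF assms]]
      linear_scale[OF aform_linear(1)[OF assms]] linear_scale[OF aform_linear(2)[OF assms]] scaleR_add_left)

lemma h_gS: assumes y: "y \<in> V" shows "h y (gS t y v u) z = aform t y v u z"
proof -
  have "aform t y v u z = aform t y v u (\<Sum>C<2*n. h y z (E C y) *\<^sub>R E C y)"
    by (rule arg_cong[OF frame_expand[OF y]])
  also have "\<dots> = (\<Sum>C<2*n. h y z (E C y) * aform t y v u (E C y))"
    by (simp add: linear_sum[OF aform_linear(3)[OF y]] linear_scale[OF aform_linear(3)[OF y]])
  finally show ?thesis
    by (simp add: gS_def h_simps y h_sym[OF y, of z] mult.commute)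
qed

lemma gauduchon_eq:
  assumes y: "y \<in> V" and Y: "Y differentiable at y"
  shows "gauduchon h J \<Gamma> t X Y y = fder Y y (X y) + (\<Gamma> y (X y) (Y y) + gS t y (X y) (Y y))"
  unfolding gauduchon_def gauduchon_form_eq[OF y Y]
proof (rule the_equality)
  show *: "\<forall>z. h y (fder Y y (X y) + (\<Gamma> y (X y) (Y y) + gS t y (X y) (Y y))) z
     = h y (cov \<Gamma> X Y y) z + aform t y (X y) (Y y) z"
    by (simp add: cov_def h_simps y h_gS)
  fix u assume "\<forall>z. h y u z = h y (cov \<Gamma> X Y y) z + aform t y (X y) (Y y) z"
  with * show "u = fder Y y (X y) + (\<Gamma> y (X y) (Y y) + gS t y (X y) (Y y))"
    by (intro frame_eqI[OF y]) simp
qed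

lemma aform_frame:
  assumes "y \<in> V" "A < 2*n" "B < 2*n" "C < 2*n"
  shows "aform t y (E A y) (E B y) (E C y) = ators n t (Tw y) A B C"
  using assms by (simp add: aform_def ators_def E_J nJ_simps h_simps h_nJ nJ_J algebra_simps)

definition gw :: "real \<Rightarrow> nat \<Rightarrow> nat \<Rightarrow> nat \<Rightarrow> 'e \<Rightarrow> real" where
  "gw t A B C y = gau n t (\<lambda>A B C. w A B C y) A B C"

lemma gauduchon_frame:
  assumes y: "y \<in> V" and r: "A < 2*n" "B < 2*n"
  shows "fder (E B) y (E A y) + (\<Gamma> y (E A y) (E B y) + gS t y (E A y) (E B y)) = (\<Sum>C<2*n. gw t A B C y *\<^sub>R E C y)"
  (is "?l = _")
proof -
  have "h y ?l (E C y) = gw t A B C y" if "C < 2*n" for C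
    using r that y by (simp add: h_simps h_gS aform_frame gw_def gau_def w_def cov_def)
  then show ?thesis by (subst frame_expand[OF y, of ?l]) simp
qed

lemma gw_has_derivative:
  assumes y: "y \<in> V" and r: "A < 2*n" "B < 2*n" "C < 2*n"
  shows "(gw t A B C has_derivative (\<lambda>v. gau n t (\<lambda>A B C. fder (w A B C) y v) A B C)) (at y)"
proof -
  have d: "(w A B C has_derivative fder (w A B C) y) (at y)" if "A < 2*n" "B < 2*n" "C < 2*n" for A B C
    by (rule fder_has_derivative[OF w_diff[OF that y]])
  show ?thesis
    unfolding gw_def [abs_def] gau_def ators_def tors_def
    by (intro has_derivative_add has_derivative_diff has_derivative_mult_right d r sig_less)
qed

lemma h_comb:
  assumes y: "y \<in> V" and S: "S < 2*n" shows "h y (\<Sum>K<2*n. c K *\<^sub>R E K y) (E S y) = c S"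
proof -
  have "h y (\<Sum>K<2*n. c K *\<^sub>R E K y) (E S y) = (\<Sum>K<2*n. c K * h y (E K y) (E S y))"
    by (simp add: h_simps y)
  also have "\<dots> = (\<Sum>K<2*n. if K = S then c K else 0)"
    by (rule sum.cong) (use S in \<open>simp_all add: E_orth[OF y]\<close>)
  finally have "h y (\<Sum>K<2*n. c K *\<^sub>R E K y) (E S y) = (\<Sum>K<2*n. if K = S then c K else 0)" .
  then show ?thesis using S by simp
qed

lemma h_lincomb: "y \<in> V \<Longrightarrow> h y (\<Sum>K\<in>I. c K *\<^sub>R X K) z = (\<Sum>K\<in>I. c K * h y (X K) z)"
  by (simp add: h_simps)

text \<open>Covers the Levi-Civita connection and \<open>D^t\<close> at once. \<open>D\<close> is
  only controlled on \<open>V\<close> and on differentiable fields, which suffices since iterated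
  derivatives at \<open>x\<close> depend on fields near \<open>x\<close>. The constants
  \<open>a\<close>, \<open>b\<close>, \<open>c\<close>, \<open>d\<close> accommodate the factors of
  the unitary frame.\<close>

lemma curvature_frame:
  fixes a b c d :: real
  assumes x: "x \<in> V"
    and D: "\<And>y X Y. y \<in> V \<Longrightarrow> Y differentiable at y \<Longrightarrow> D X Y y = fder Y y (X y) + B y (X y) (Y y)"
    and B: "\<And>y. y \<in> V \<Longrightarrow> bilinear (B y)"
    and g: "\<And>y P Q. y \<in> V \<Longrightarrow> P < 2*n \<Longrightarrow> Q < 2*n \<Longrightarrow>
      fder (E Q) y (E P y) + B y (E P y) (E Q y) = (\<Sum>K<2*n. g P Q K y *\<^sub>R E K y)"
    and gd: "\<And>P Q K. P < 2*n \<Longrightarrow> Q < 2*n \<Longrightarrow> K < 2*n \<Longrightarrow> g P Q K differentiable at x"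
    and r: "i < 2*n" "j < 2*n" "k < 2*n" "l < 2*n"
  shows "curvature h D (\<lambda>y. a *\<^sub>R E i y) (\<lambda>y. b *\<^sub>R E j y) (\<lambda>y. c *\<^sub>R E k y) (\<lambda>y. d *\<^sub>R E l y) x
    = a * b * c * d * curv n (\<lambda>A B C. w A B C x) (\<lambda>A B C. g A B C x) (\<lambda>D A B C. fder (g A B C) x (E D x)) i j k l"
proof -
  let ?dg = "\<lambda>D A B C. fder (g A B C) x (E D x)"
  have dE: "(\<lambda>y. q *\<^sub>R E Q y) differentiable at y" if "Q < 2*n" "y \<in> V" for q Q y
    using E_diff[OF that] by simp
  have DE: "D (\<lambda>y. p *\<^sub>R E P y) (\<lambda>y. q *\<^sub>R E Q y) y = (\<Sum>K<2*n. (p * q * g P Q K y) *\<^sub>R E K y)"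
    if "y \<in> V" "P < 2*n" "Q < 2*n" for p q P Q y
  proof -
    have "D (\<lambda>y. p *\<^sub>R E P y) (\<lambda>y. q *\<^sub>R E Q y) y = (p * q) *\<^sub>R (fder (E Q) y (E P y) + B y (E P y) (E Q y))"
      using that by (simp add: D dE fder_scaleR E_diff linear_scale[OF linear_fder[OF E_diff]]
          bilinear_lmul[OF B] bilinear_rmul[OF B] scaleR_add_right mult.commute)
    then show ?thesis using that by (simp add: g scaleR_sum_right)
  qed
  have DD: "h x (D (\<lambda>y. r *\<^sub>R E R y) (D (\<lambda>y. p *\<^sub>R E P y) (\<lambda>y. q *\<^sub>R E Q y)) x) (E S x)
     = p * q * r * (?dg R P Q S + (\<Sum>K<2*n. g P Q K x * g R K S x))"
    if s: "P < 2*n" "Q < 2*n" "R < 2*n" "S < 2*n" for p q r P Q R S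
  proof -
    let ?F = "\<lambda>y. \<Sum>K<2*n. (p * q * g P Q K y) *\<^sub>R E K y"
    let ?G = "D (\<lambda>y. p *\<^sub>R E P y) (\<lambda>y. q *\<^sub>R E Q y)"
    have F: "(?F has_derivative (\<lambda>v. \<Sum>K<2*n. (p * q * g P Q K x) *\<^sub>R fder (E K) x v
        + (p * q * fder (g P Q K) x v) *\<^sub>R E K x)) (at x)"
      using s x by (intro has_derivative_sum has_derivative_scaleR has_derivative_mult_right fder_has_derivative
         gd E_diff) auto
    have GF: "?G y = ?F y" if "y \<in> V" for y by (rule DE[OF that s(1,2)])
    have dG: "?G differentiable at x"
      by (rule iffD2[OF differentiable_cong_open[OF open_V x GF] differentiableI[OF F]])
    have fG: "fder ?G x = fder ?F x" by (rule fder_cong_open[OF open_V x GF])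
    have "D (\<lambda>y. r *\<^sub>R E R y) ?G x = fder ?F x (r *\<^sub>R E R x) + B x (r *\<^sub>R E R x) (?F x)"
      by (simp add: D[OF x dG] fG GF[OF x])
    also have "fder ?F x (r *\<^sub>R E R x) = r *\<^sub>R (\<Sum>K<2*n. (p * q * g P Q K x) *\<^sub>R fder (E K) x (E R x)
        + (p * q * ?dg R P Q K) *\<^sub>R E K x)"
      unfolding fder_eqI[OF F] scaleR_sum_right
      using s x by (intro sum.cong refl) (simp add: linear_scale[OF linear_fder[OF E_diff]]
          linear_scale[OF linear_fder[OF gd]] scaleR_add_right mult_ac)
    also have "B x (r *\<^sub>R E R x) (?F x) = r *\<^sub>R (\<Sum>K<2*n. (p * q * g P Q K x) *\<^sub>R B x (E R x) (E K x))"
      using linear_sum[OF bilinear_linear2[OF B[OF x]], of "E R x" "\<lambda>K. (p * q * g P Q K x) *\<^sub>R E K x" "{..<2*n}"]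
      by (simp add: bilinear_lmul[OF B[OF x]] bilinear_rmul[OF B[OF x]])
    also have "r *\<^sub>R (\<Sum>K<2*n. (p * q * g P Q K x) *\<^sub>R fder (E K) x (E R x) + (p * q * ?dg R P Q K) *\<^sub>R E K x)
       + r *\<^sub>R (\<Sum>K<2*n. (p * q * g P Q K x) *\<^sub>R B x (E R x) (E K x))
      = r *\<^sub>R ((\<Sum>K<2*n. (p * q * g P Q K x) *\<^sub>R (fder (E K) x (E R x) + B x (E R x) (E K x)))
         + (\<Sum>K<2*n. (p * q * ?dg R P Q K) *\<^sub>R E K x))"
      by (simp add: sum.distrib scaleR_add_right)
    also have "h x \<dots> (E S x) = r * ((\<Sum>K<2*n. p * q * g P Q K x * g R K S x) + p * q * ?dg R P Q S)"
    proof -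
      have "h x (fder (E K) x (E R x) + B x (E R x) (E K x)) (E S x) = g R K S x" if "K < 2*n" for K
        unfolding g[OF x s(3) that] by (rule h_comb[OF x s(4)])
      then show ?thesis
        unfolding h_scale(1)[OF x] h_add(1)[OF x] h_comb[OF x s(4)]
          h_lincomb[OF x, of _ "\<lambda>K. fder (E K) x (E R x) + B x (E R x) (E K x)"] by simp
    qed
    finally show ?thesis
      by (simp add: sum_distrib_left [symmetric] algebra_simps)
  qed
  have br: "lie_bracket (\<lambda>y. c *\<^sub>R E k y) (\<lambda>y. d *\<^sub>R E l y) x = (\<Sum>K<2*n. (c * d * (w k l K x - w l k K x)) *\<^sub>R E K x)"
  proof -
    have "lie_bracket (\<lambda>y. c *\<^sub>R E k y) (\<lambda>y. d *\<^sub>R E l y) x = (c * d) *\<^sub>R (cov \<Gamma> (E k) (E l) x - cov \<Gamma> (E l) (E k) x)"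
      using r x by (simp add: lie_bracket_def fder_scaleR E_diff linear_scale[OF linear_fder[OF E_diff]]
          cov_def \<Gamma>_sym[OF x, of "E k x"] scaleR_diff_right mult.commute)
    also have "\<dots> = (\<Sum>K<2*n. (c * d * (w k l K x - w l k K x)) *\<^sub>R E K x)"
      unfolding cov_frame[OF x] by (simp add: sum_subtractf [symmetric] scaleR_sum_right scaleR_diff_left [symmetric])
    finally show ?thesis .
  qed
  have Dbr: "h x (D (lie_bracket (\<lambda>y. c *\<^sub>R E k y) (\<lambda>y. d *\<^sub>R E l y)) (\<lambda>y. b *\<^sub>R E j y) x) (E i x)
    = b * c * d * (\<Sum>K<2*n. (w k l K x - w l k K x) * g K j i x)"
  proof -
    have "D (lie_bracket (\<lambda>y. c *\<^sub>R E k y) (\<lambda>y. d *\<^sub>R E l y)) (\<lambda>y. b *\<^sub>R E j y) x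
      = (\<Sum>K<2*n. (b * (c * d * (w k l K x - w l k K x))) *\<^sub>R (fder (E j) x (E K x) + B x (E K x) (E j x)))"
      unfolding D[OF x dE[OF r(2) x]] br
      using linear_sum[OF linear_fder[OF E_diff[OF r(2) x]], of "\<lambda>K. (c * d * (w k l K x - w l k K x)) *\<^sub>R E K x" "{..<2*n}"]
        linear_sum[OF bilinear_linear1[OF B[OF x]], of "\<lambda>K. (c * d * (w k l K x - w l k K x)) *\<^sub>R E K x" "{..<2*n}" "E j x"]
      by (simp add: fder_scaleR E_diff r x bilinear_rmul[OF B[OF x]] bilinear_lmul[OF B[OF x]]
          linear_scale[OF linear_fder[OF E_diff]] scaleR_sum_right scaleR_add_right sum.distrib)
    moreover have "h x (fder (E j) x (E K x) + B x (E K x) (E j x)) (E i x) = g K j i x" if "K < 2*n" for K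
      unfolding g[OF x that r(2)] by (rule h_comb[OF x r(1)])
    ultimately show ?thesis
      by (simp add: h_lincomb[OF x] sum_distrib_left mult_ac)
  qed
  show ?thesis
    using r by (simp add: curvature_def h_simps x DD Dbr curv_def sum_subtractf right_diff_distrib distrib_left mult_ac)
qed

lemma curvature_cov:
  assumes x: "x \<in> V" and r: "i < 2*n" "j < 2*n" "k < 2*n" "l < 2*n"
  shows "curvature h (cov \<Gamma>) (E i) (E j) (E k) (E l) x
    = curv n (\<lambda>A B C. w A B C x) (\<lambda>A B C. w A B C x) (dw x) i j k l"
  using curvature_frame[OF x, of "cov \<Gamma>" \<Gamma> w i j k l 1 1 1 1]
  by (simp add: cov_def \<Gamma>_bilinear r x w_diff cov_frame[unfolded cov_def] dw_def [abs_def])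

lemma curvature_gauduchon:
  assumes x: "x \<in> V" and r: "i < 2*n" "j < 2*n" "k < 2*n" "l < 2*n"
  shows "curvature h (gauduchon h J \<Gamma> t) (\<lambda>y. a *\<^sub>R E i y) (\<lambda>y. b *\<^sub>R E j y) (\<lambda>y. c *\<^sub>R E k y) (\<lambda>y. d *\<^sub>R E l y) x
    = a * b * c * d * curv n (\<lambda>A B C. w A B C x) (gau n t (\<lambda>A B C. w A B C x)) (\<lambda>D. gau n t (dw x D)) i j k l"
proof -
  have bil: "bilinear (\<lambda>v u. \<Gamma> y v u + gS t y v u)" if "y \<in> V" for y
    using \<Gamma>_bilinear[OF that] bilinear_gS[OF that] by (simp add: bilinear_def linear_compose_add)
  have "curv n (\<lambda>A B C. w A B C x) (\<lambda>A B C. gw t A B C x) (\<lambda>D A B C. fder (gw t A B C) x (E D x)) i j k l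
     = curv n (\<lambda>A B C. w A B C x) (gau n t (\<lambda>A B C. w A B C x)) (\<lambda>D. gau n t (dw x D)) i j k l"
    using r by (simp add: curv_def fder_eqI[OF gw_has_derivative[OF x]] gw_def dw_def [abs_def])
  moreover have "curvature h (gauduchon h J \<Gamma> t) (\<lambda>y. a *\<^sub>R E i y) (\<lambda>y. b *\<^sub>R E j y) (\<lambda>y. c *\<^sub>R E k y) (\<lambda>y. d *\<^sub>R E l y) x
    = a * b * c * d * curv n (\<lambda>A B C. w A B C x) (\<lambda>A B C. gw t A B C x) (\<lambda>D A B C. fder (gw t A B C) x (E D x)) i j k l"
    by (rule curvature_frame[where B = "\<lambda>y v u. \<Gamma> y v u + gS t y v u"])
      (use x gauduchon_eq bil gauduchon_frame differentiableI[OF gw_has_derivative[OF x]] r in auto)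
  ultimately show ?thesis by simp
qed

lemma riemann_scalar_eq:
  assumes x: "x \<in> V"
  shows "riemann_scalar n h \<Gamma> E x = (\<Sum>A<2*n. \<Sum>B<2*n. curv n (\<lambda>A B C. w A B C x) (\<lambda>A B C. w A B C x) (dw x) A B A B)"
proof -
  have "riemann_scalar n h \<Gamma> E x = (\<Sum>B<2*n. \<Sum>A<2*n. curv n (\<lambda>A B C. w A B C x) (\<lambda>A B C. w A B C x) (dw x) A B A B)"
    unfolding riemann_scalar_def ricci_def by (intro sum.cong refl) (simp add: curvature_cov[OF x])
  then show ?thesis by (subst sum.swap)
qed

text \<open>The second derivatives of \<open>E j\<close> cancel by symmetry and the bracket term
  absorbs the first derivatives of \<open>E k\<close> and \<open>E l\<close>. What is left depends
  only on the values of the fields, and the Bianchi identity follows from the symmetry of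
  \<Gamma>.\<close>

lemma curvature_cov_coords:
  assumes x: "x \<in> V" and r: "j < 2*n" "k < 2*n" "l < 2*n"
  shows "curvature h (cov \<Gamma>) X (E j) (E k) (E l) x = h x
    (fder (\<lambda>z. \<Gamma> z (E l x) (E j x)) x (E k x) - fder (\<lambda>z. \<Gamma> z (E k x) (E j x)) x (E l x)
     + \<Gamma> x (E k x) (\<Gamma> x (E l x) (E j x)) - \<Gamma> x (E l x) (\<Gamma> x (E k x) (E j x))) (X x)"
proof -
  have s: "fder (\<lambda>z. fder (E j) z (E l x)) x (E k x) = fder (\<lambda>z. fder (E j) z (E k x)) x (E l x)"
    by (rule second_derivative_symmetric[OF open_V x smooth_E[OF r(1)]])
  note lin = linear_diff[OF linear_fder[OF E_diff[OF r(1) x]]] bilinear_lsub[OF \<Gamma>_bilinear[OF x]]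
    bilinear_radd[OF \<Gamma>_bilinear[OF x]]
  have "cov \<Gamma> (E k) (cov \<Gamma> (E l) (E j)) x - cov \<Gamma> (E l) (cov \<Gamma> (E k) (E j)) x - cov \<Gamma> (lie_bracket (E k) (E l)) (E j) x
    = fder (\<lambda>z. \<Gamma> z (E l x) (E j x)) x (E k x) - fder (\<lambda>z. \<Gamma> z (E k x) (E j x)) x (E l x)
     + \<Gamma> x (E k x) (\<Gamma> x (E l x) (E j x)) - \<Gamma> x (E l x) (\<Gamma> x (E k x) (E j x))"
    unfolding cov_def[of \<Gamma> "E k" "cov \<Gamma> (E l) (E j)"] cov_def[of \<Gamma> "E l" "cov \<Gamma> (E k) (E j)"]
      fder_eqI[OF has_derivative_cov[OF x r(3,1)]] fder_eqI[OF has_derivative_cov[OF x r(2,1)]]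
    unfolding cov_def lie_bracket_def
    by (simp add: s lin algebra_simps)
  then show ?thesis by (simp add: curvature_def)
qed

lemma bianchi:
  assumes x: "x \<in> V" and r: "j < 2*n" "k < 2*n" "l < 2*n"
  shows "curvature h (cov \<Gamma>) X (E j) (E k) (E l) x + curvature h (cov \<Gamma>) X (E k) (E l) (E j) x
     + curvature h (cov \<Gamma>) X (E l) (E j) (E k) x = 0"
proof -
  have s: "fder (\<lambda>z. \<Gamma> z u v) x a = fder (\<lambda>z. \<Gamma> z v u) x a" for u v a
    by (rule fun_cong[OF fder_cong_open[OF open_V x]]) (rule \<Gamma>_sym)
  show ?thesis
    using r by (simp add: curvature_cov_coords[OF x] h_simps x
        s[of "E l x" "E j x"] s[of "E k x" "E j x"] s[of "E l x" "E k x"]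
        \<Gamma>_sym[OF x, of "E l x" "E j x"] \<Gamma>_sym[OF x, of "E k x" "E j x"] \<Gamma>_sym[OF x, of "E l x" "E k x"])
qed

end

section \<open>Symmetries of the curvature components and the traces over the unitary frame\<close>

lemma curv_skew34: "curv n w g dg A B D C = - curv n w g dg A B C D"
  unfolding curv_def minus_add_distrib sum_negf [symmetric] by (simp add: algebra_simps)

lemma curv_skew12:
  assumes g: "skew_array n g" and dg: "\<And>D. D < 2*n \<Longrightarrow> skew_array n (dg D)"
    and r: "A < 2*n" "B < 2*n" "C < 2*n" "D < 2*n"
  shows "curv n w g dg B A C D = - curv n w g dg A B C D"
proof -
  have "(\<Sum>K<2*n. g D A K * g C K B - g C A K * g D K B - (w C D K - w D C K) * g K A B)
     = (\<Sum>K<2*n. - (g D B K * g C K A - g C B K * g D K A - (w C D K - w D C K) * g K B A))"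
  proof (rule sum.cong)
    fix K assume "K \<in> {..<2*n}"
    then show "g D A K * g C K B - g C A K * g D K B - (w C D K - w D C K) * g K A B
      = - (g D B K * g C K A - g C B K * g D K A - (w C D K - w D C K) * g K B A)"
      using skew_arrayD[OF g, of D K A] skew_arrayD[OF g, of C B K] skew_arrayD[OF g, of C K A]
        skew_arrayD[OF g, of D B K] skew_arrayD[OF g, of K B A] r by simp
  qed simp
  then have "(\<Sum>K<2*n. g D A K * g C K B - g C A K * g D K B - (w C D K - w D C K) * g K A B)
     = - (\<Sum>K<2*n. g D B K * g C K A - g C B K * g D K A - (w C D K - w D C K) * g K B A)"
    by (simp only: sum_negf)
  then show ?thesis
    using skew_arrayD[OF dg, of C D B A] skew_arrayD[OF dg, of D C B A] r
    by (simp add: curv_def)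
qed

text \<open>The identity rotates the last three indices of \<open>K A (JA) B (JB)\<close>. Of the
  two resulting terms, one sums to \<open>starJ\<close> by skewness in the last pair, the other by
  exchanging \<open>B\<close> with \<open>sig n B\<close>.\<close>

lemma bianchi_ricJ:
  assumes "\<And>A B C D. A < 2*n \<Longrightarrow> B < 2*n \<Longrightarrow> C < 2*n \<Longrightarrow> D < 2*n \<Longrightarrow>
    curv n w g dg A B C D + curv n w g dg A C D B + curv n w g dg A D B C = 0"
  shows "ricJ n w g dg = 2 * starJ n w g dg"
proof -
  let ?K = "curv n w g dg"
  have 1: "(\<Sum>A<2*n. \<Sum>B<2*n. eps n A * eps n B * ?K A B (sig n B) (sig n A)) = - starJ n w g dg"
    unfolding starJ_def sum_negf [symmetric]
    by (intro sum.cong refl) (subst curv_skew34, simp)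
  have 2: "(\<Sum>A<2*n. \<Sum>B<2*n. eps n A * eps n B * ?K A (sig n B) (sig n A) B) = - starJ n w g dg"
    unfolding starJ_def sum_negf [symmetric]
    by (intro sum.cong refl sum_sig_eq) simp
  have "ricJ n w g dg = (\<Sum>A<2*n. \<Sum>B<2*n. - (eps n A * eps n B * ?K A B (sig n B) (sig n A))
     - eps n A * eps n B * ?K A (sig n B) (sig n A) B)"
    unfolding ricJ_def
  proof (intro sum.cong refl)
    fix A B assume "A \<in> {..<2*n}" "B \<in> {..<2*n}"
    then have "?K A (sig n A) B (sig n B) = - ?K A B (sig n B) (sig n A) - ?K A (sig n B) (sig n A) B"
      using assms[of A "sig n A" B "sig n B"] by simp
    then show "eps n A * eps n B * ?K A (sig n A) B (sig n B) = - (eps n A * eps n B * ?K A B (sig n B) (sig n A))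
      - eps n A * eps n B * ?K A (sig n B) (sig n A) B"
      by (simp add: right_diff_distrib)
  qed
  then show ?thesis using 1 2 by (simp add: sum_subtractf sum_negf)
qed

lemma sum_split_frame:
  fixes f :: "nat \<Rightarrow> 'b::comm_monoid_add" and n :: nat
  shows "(\<Sum>A<2*n. f A) = (\<Sum>i<n. f i + f (n + i))"
proof -
  have "(\<Sum>A<2*n. f A) = (\<Sum>A<n + n. f A)" by (simp add: mult_2)
  also have "\<dots> = (\<Sum>A<n. f A) + (\<Sum>i<n. f (n + i))"
    using sum.shift_bounds_nat_ivl[of f 0 n n]
    by (simp add: lessThan_atLeast0 sum.atLeastLessThan_concat [of 0 n "n + n", symmetric] add.commute)
  finally show ?thesis by (simp add: sum.distrib)
qed

lemma sum_antisym_zero: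
  assumes "\<And>i j. i < n \<Longrightarrow> j < n \<Longrightarrow> f j i = - f i j"
  shows "(\<Sum>i<n. \<Sum>j<n. f i j :: real) = 0"
proof -
  have "(\<Sum>i<n. \<Sum>j<n. f i j) = (\<Sum>j<n. \<Sum>i<n. f i j)" by (rule sum.swap)
  also have "\<dots> = (\<Sum>i<n. \<Sum>j<n. - f i j)"
    by (intro sum.cong refl) (rule assms, auto)
  finally show ?thesis by (simp add: sum_negf)
qed

locale hermitian_curvature =
  fixes n :: nat and K :: "nat \<Rightarrow> nat \<Rightarrow> nat \<Rightarrow> nat \<Rightarrow> real"
  assumes K12: "\<lbrakk>A < 2*n; B < 2*n; C < 2*n; D < 2*n\<rbrakk> \<Longrightarrow> K B A C D = - K A B C D"
    and K34: "\<lbrakk>A < 2*n; B < 2*n; C < 2*n; D < 2*n\<rbrakk> \<Longrightarrow> K A B D C = - K A B C D"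
    and KJ: "\<lbrakk>A < 2*n; B < 2*n; C < 2*n; D < 2*n\<rbrakk> \<Longrightarrow> K (sig n A) (sig n B) C D = eps n A * eps n B * K A B C D"
begin

lemma K_zero: "A < 2*n \<Longrightarrow> C < 2*n \<Longrightarrow> D < 2*n \<Longrightarrow> K A A C D = 0" "A < 2*n \<Longrightarrow> B < 2*n \<Longrightarrow> C < 2*n \<Longrightarrow> K A B C C = 0"
  using K12[of A A C D] K34[of A B C C] by auto

lemma KJ_frame:
  assumes "i < n" "j < n" "C < 2*n" "D < 2*n"
  shows "K (n + i) (n + j) C D = K i j C D" "K (n + i) j C D = - K i (n + j) C D"
  using KJ[of i j C D] KJ[of i "n + j" C D] assms by (simp_all add: sig_def eps_def)


end

context hermitian_chart
begin

definition Kt :: "real \<Rightarrow> 'e \<Rightarrow> nat \<Rightarrow> nat \<Rightarrow> nat \<Rightarrow> nat \<Rightarrow> real" where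
  "Kt t x = curv n (\<lambda>A B C. w A B C x) (gau n t (\<lambda>A B C. w A B C x)) (\<lambda>D. gau n t (dw x D))"

lemma skew_array_gau: assumes "skew_array n v" shows "skew_array n (gau n t v)"
proof -
  interpret hermitian_array n "tors n v" by (rule hermitian_array_tors[OF assms])
  have "gau n t v = (\<lambda>A B C. v A B C + ators n t (tors n v) A B C)"
    by (intro ext) (simp add: gau_def)
  then show ?thesis using skew_array_add[OF assms skew_ators] by simp
qed

lemma hermitian_curvature_Kt:
  assumes x: "x \<in> V" shows "hermitian_curvature n (Kt t x)"
proof
  interpret C: connection_array n "\<lambda>A B C. w A B C x" "dw x" by (rule connection_array[OF x])
  fix A B C D assume r: "A < 2*n" "B < 2*n" "C < 2*n" "D < 2*n"
  show "Kt t x B A C D = - Kt t x A B C D"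
    unfolding Kt_def by (rule curv_skew12[OF skew_array_gau[OF C.skew_w] skew_array_gau[OF C.skew_dw] r])
  show "Kt t x A B D C = - Kt t x A B C D"
    unfolding Kt_def by (rule curv_skew34)
  show "Kt t x (sig n A) (sig n B) C D = eps n A * eps n B * Kt t x A B C D"
    unfolding Kt_def by (rule curv_J_comm[OF J_comm_gau[OF C.skew_w] J_comm_gau[OF C.skew_dw] r])
qed

lemma ricJ_riemann:
  assumes x: "x \<in> V"
  shows "ricJ n (\<lambda>A B C. w A B C x) (\<lambda>A B C. w A B C x) (dw x)
     = 2 * starJ n (\<lambda>A B C. w A B C x) (\<lambda>A B C. w A B C x) (dw x)"
  by (rule bianchi_ricJ) (simp add: curvature_cov[OF x, symmetric] bianchi[OF x])

lemma ubar_frame_eq: "ubar_frame n E i = ((\<lambda>x. (1 / sqrt 2) *\<^sub>R E i x), (\<lambda>x. (1 / sqrt 2) *\<^sub>R E (n + i) x))"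
  by (simp add: ubar_frame_def u_frame_def)

text \<open>By skewness in both pairs, the pair (ubar_i, u_i) acts as -i times (e_i, J e_i) and
  (u_j, ubar_j) as i times (e_j, J e_j), so each summand is real. The factor 1/4 appears because
  \<open>ricJ\<close> counts every pair \<open>i\<close>, \<open>j\<close> four times.\<close>

lemma hermitian_scalar_1_eq:
  assumes x: "x \<in> V"
  shows "hermitian_scalar_1 n h J \<Gamma> E t x = complex_of_real
    (1/4 * ricJ n (\<lambda>A B C. w A B C x) (gau n t (\<lambda>A B C. w A B C x)) (\<lambda>D. gau n t (dw x D)))"
proof -
  interpret K: hermitian_curvature n "Kt t x" by (rule hermitian_curvature_Kt[OF x])
  note cg = curvature_gauduchon[OF x, of _ _ _ _ t, folded Kt_def]
  have "curvature_C h (gauduchon h J \<Gamma> t) x [ubar_frame n E i, u_frame n E i, u_frame n E j, ubar_frame n E j]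
     = complex_of_real (Kt t x i (n + i) j (n + j))" if i: "i < n" "j < n" for i j
  proof -
    note r = K.K12[of i "n + i" j "n + j"] K.K12[of i "n + i" "n + j" j] K.K34[of i "n + i" j "n + j"]
    define c where "c = 1 / sqrt (2::real)"
    have c: "c * c = 1/2" "\<And>z. c * (c * z) = z / 2" by (simp_all add: c_def)
    show ?thesis
      unfolding curvature_C_def ubar_frame_eq u_frame_def c_def [symmetric]
      using i by (simp add: cg K.K_zero r c complex_eq_iff del: scaleR_minus_left)
  qed
  then have "hermitian_scalar_1 n h J \<Gamma> E t x = complex_of_real (\<Sum>i<n. \<Sum>j<n. Kt t x i (n + i) j (n + j))"
    by (simp add: hermitian_scalar_1_def)
  also have "(\<Sum>i<n. \<Sum>j<n. Kt t x i (n + i) j (n + j)) = 1/4 * ricJ n (\<lambda>A B C. w A B C x) (gau n t (\<lambda>A B C. w A B C x)) (\<lambda>D. gau n t (dw x D))"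
    unfolding ricJ_def sum_split_frame Kt_def [symmetric] sum_distrib_left sum.distrib [symmetric]
  proof (intro sum.cong refl)
    fix i j assume "i \<in> {..<n}" "j \<in> {..<n}"
    then show "Kt t x i (n + i) j (n + j) = 1 / 4 *
       (eps n i * eps n j * Kt t x i (sig n i) j (sig n j)
        + eps n i * eps n (n + j) * Kt t x i (sig n i) (n + j) (sig n (n + j))
        + (eps n (n + i) * eps n j * Kt t x (n + i) (sig n (n + i)) j (sig n j)
        + eps n (n + i) * eps n (n + j) * Kt t x (n + i) (sig n (n + i)) (n + j) (sig n (n + j))))"
      using K.K12[of i "n + i" j "n + j"] K.K12[of i "n + i" "n + j" j] K.K34[of i "n + i" j "n + j"]
      by (simp add: eps_def sig_def)
  qed
  finally show ?thesis .
qed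

text \<open>The summands \<open>?R i j + \<i> * ?I i j\<close> need not be real: \<open>?I\<close>
  is antisymmetric in \<open>i\<close> and \<open>j\<close> and only vanishes after summation.
  Invariance under \<open>J\<close> in the first pair turns the four components over
  \<open>i\<close>, \<open>j\<close> into twice \<open>?R i j\<close>.\<close>

lemma hermitian_scalar_2_eq:
  assumes x: "x \<in> V"
  shows "hermitian_scalar_2 n h J \<Gamma> E t x = complex_of_real
    (1/2 * (\<Sum>A<2*n. \<Sum>B<2*n. curv n (\<lambda>A B C. w A B C x) (gau n t (\<lambda>A B C. w A B C x)) (\<lambda>D. gau n t (dw x D)) A B A B))"
proof -
  interpret K: hermitian_curvature n "Kt t x" by (rule hermitian_curvature_Kt[OF x])
  let ?K = "Kt t x"
  note cg = curvature_gauduchon[OF x, of _ _ _ _ t, folded Kt_def]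
  let ?I = "\<lambda>i j. 1/2 * (?K i j i (n + j) - ?K i j (n + i) j - ?K i (n + j) i j - ?K i (n + j) (n + i) (n + j))"
  let ?R = "\<lambda>i j. 1/2 * (?K i j i j + ?K i j (n + i) (n + j) + ?K i (n + j) i (n + j) - ?K i (n + j) (n + i) j)"
  have "curvature_C h (gauduchon h J \<Gamma> t) x [ubar_frame n E i, u_frame n E j, u_frame n E i, ubar_frame n E j]
     = complex_of_real (?R i j) + \<i> * complex_of_real (?I i j)" if i: "i < n" "j < n" for i j
  proof -
    define c where "c = 1 / sqrt (2::real)"
    have c: "c * c = 1/2" "\<And>z. c * (c * z) = z / 2" by (simp_all add: c_def)
    show ?thesis
      unfolding curvature_C_def ubar_frame_eq u_frame_def c_def [symmetric]
      using i by (simp add: cg K.KJ_frame c complex_eq_iff del: scaleR_minus_left)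
  qed
  then have "hermitian_scalar_2 n h J \<Gamma> E t x = complex_of_real (\<Sum>i<n. \<Sum>j<n. ?R i j) + \<i> * complex_of_real (\<Sum>i<n. \<Sum>j<n. ?I i j)"
    by (simp add: hermitian_scalar_2_def sum.distrib sum_distrib_left)
  also have "(\<Sum>i<n. \<Sum>j<n. ?I i j) = 0"
  proof (rule sum_antisym_zero)
    fix i j assume r: "i < n" "j < n"
    have 1: "?K j i j (n + i) = ?K i j (n + i) j"
      using K.K12[of i j j "n + i"] K.K34[of i j "n + i" j] r by simp
    have 2: "?K j i (n + j) i = ?K i j i (n + j)"
      using K.K12[of i j "n + j" i] K.K34[of i j i "n + j"] r by simp
    have 3: "?K j (n + i) C D = - ?K i (n + j) D C" if "C < 2*n" "D < 2*n" for C D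
      using K.K12[of "n + i" j C D] K.KJ_frame(2)[OF r that] K.K34[of i "n + j" C D] that r by simp
    have 4: "?K j (n + i) j i = - ?K i (n + j) i j"
      "?K j (n + i) (n + j) (n + i) = - ?K i (n + j) (n + i) (n + j)"
      using 3[of j i] 3[of "n + j" "n + i"] r by simp_all
    show "?I j i = - ?I i j"
      unfolding 1 2 4 by (simp add: field_simps)
  qed
  also have "(\<Sum>i<n. \<Sum>j<n. ?R i j) = 1/2 * (\<Sum>A<2*n. \<Sum>B<2*n. ?K A B A B)"
    unfolding sum_split_frame sum_distrib_left sum.distrib [symmetric]
    by (intro sum.cong refl) (simp add: K.KJ_frame)
  finally show ?thesis by (simp add: Kt_def)
qed

end

section \<open>The volume form and the codifferential\<close>

lemma sum_card_1: "(\<Sum>S | S \<subseteq> {..<N::nat} \<and> card S = 1. f S) = (\<Sum>A<N. f {A} :: 'b::comm_monoid_add)"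
proof (rule sum.reindex_bij_witness[of _ "\<lambda>A. {A}" "\<lambda>S. the_elem S"])
qed (auto simp: card_1_singleton_iff)

lemma sum_card_2:
  fixes f :: "nat set \<Rightarrow> real"
  assumes sym: "\<And>A B. A < N \<Longrightarrow> B < N \<Longrightarrow> A < B \<Longrightarrow> g A B = f {A, B} \<and> g B A = f {A, B}"
    and diag: "\<And>A. A < N \<Longrightarrow> g A A = 0"
  shows "(\<Sum>S | S \<subseteq> {..<N} \<and> card S = 2. f S) = 1/2 * (\<Sum>A<N. \<Sum>B<N. g A B)"
proof -
  let ?P = "{(A, B). A < B \<and> B < N}" and ?Q = "{(A, B). B < A \<and> A < N}" and ?D = "{(A, B). A = B \<and> A < N}"
  have fin: "finite ?P" "finite ?Q" "finite ?D"
    by (rule finite_subset[of _ "{..<N} \<times> {..<N}"]; auto)+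
  have b: "bij_betw (\<lambda>(A, B). {A, B}) ?P {S. S \<subseteq> {..<N} \<and> card S = 2}"
  proof (rule bij_betwI')
    fix p q assume "p \<in> ?P" "q \<in> ?P"
    then show "((\<lambda>(A, B). {A, B}) p = (\<lambda>(A, B). {A, B}) q) = (p = q)"
      by (auto simp: doubleton_eq_iff)
  next
    fix p assume "p \<in> ?P"
    then show "(\<lambda>(A, B). {A, B}) p \<in> {S. S \<subseteq> {..<N} \<and> card S = 2}" by auto
  next
    fix S assume S: "S \<in> {S. S \<subseteq> {..<N} \<and> card S = 2}"
    then obtain A B where "S = {A, B}" "A \<noteq> B" by (auto simp: card_2_iff)
    then have "(A, B) \<in> ?P \<and> S = {A, B} \<or> (B, A) \<in> ?P \<and> S = {B, A}"
      using S by auto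
    then show "\<exists>p\<in>?P. S = (\<lambda>(A, B). {A, B}) p" by blast
  qed
  have "(\<Sum>A<N. \<Sum>B<N. g A B) = (\<Sum>(A, B)\<in>{..<N} \<times> {..<N}. g A B)"
    by (simp add: sum.cartesian_product)
  also have "{..<N} \<times> {..<N} = (?P \<union> ?Q) \<union> ?D" by auto
  also have "(\<Sum>(A, B)\<in>(?P \<union> ?Q) \<union> ?D. g A B) = (\<Sum>(A, B)\<in>?P. g A B) + (\<Sum>(A, B)\<in>?Q. g A B) + (\<Sum>(A, B)\<in>?D. g A B)"
    using fin by (subst sum.union_disjoint, auto) (subst sum.union_disjoint, auto)
  also have "(\<Sum>(A, B)\<in>?D. g A B) = 0" by (rule sum.neutral) (auto simp: diag)
  also have "(\<Sum>(A, B)\<in>?Q. g A B) = (\<Sum>(A, B)\<in>?P. f {A, B})"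
    by (rule sum.reindex_bij_witness[of _ "\<lambda>(A, B). (B, A)" "\<lambda>(A, B). (B, A)"]) (use sym in auto)
  also have "(\<Sum>(A, B)\<in>?P. g A B) = (\<Sum>(A, B)\<in>?P. f {A, B})"
    by (rule sum.cong) (use sym in auto)
  also have "(\<Sum>(A, B)\<in>?P. f {A, B}) = (\<Sum>S | S \<subseteq> {..<N} \<and> card S = 2. f S)"
    using sum.reindex_bij_betw[OF b, of f] by (simp add: case_prod_unfold)
  finally show ?thesis by simp
qed

lemma sum_card_pred:
  assumes "N > 0"
  shows "(\<Sum>S | S \<subseteq> {..<N::nat} \<and> Suc (card S) = N. f S) = (\<Sum>A<N. f ({..<N} - {A}) :: 'b::comm_monoid_add)"
proof (rule sum.reindex_bij_witness[of _ "\<lambda>A. {..<N} - {A}" "\<lambda>S. the_elem ({..<N} - S)"])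
  fix S assume S: "S \<in> {S. S \<subseteq> {..<N} \<and> Suc (card S) = N}"
  then have "card ({..<N} - S) = 1" by (subst card_Diff_subset) (auto intro: finite_subset)
  then obtain A where A: "{..<N} - S = {A}" by (auto simp: card_1_singleton_iff)
  then show "the_elem ({..<N} - S) \<in> {..<N}" by auto
  show "{..<N} - {the_elem ({..<N} - S)} = S" using A S by auto
  then show "f ({..<N} - {the_elem ({..<N} - S)}) = f S" by simp
next
  fix A assume "A \<in> {..<N}"
  then have "{..<N} - ({..<N} - {A}) = {A}" by auto
  then show "the_elem ({..<N} - ({..<N} - {A})) = A" by simp
  show "{..<N} - {A} \<in> {S. S \<subseteq> {..<N} \<and> Suc (card S) = N}" using \<open>A \<in> _\<close> by auto
qed

lemma sorted_list_of_set_lessThan: "sorted_list_of_set {..<N::nat} = [0..<N]"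
  by (simp add: lessThan_atLeast0)

lemma sorted_list_of_set_lessThan_remove:
  assumes "A < N" shows "sorted_list_of_set ({..<N} - {A}) = [0..<A] @ [Suc A..<N]"
proof -
  have "{..<N} - {A} = set ([0..<A] @ [Suc A..<N])" using assms by auto
  then show ?thesis
    using sorted_list_of_set.idem_if_sorted_distinct[of "[0..<A] @ [Suc A..<N]"]
    by (auto simp: sorted_append)
qed

context hermitian_chart
begin

abbreviation Es :: "'e \<Rightarrow> 'e list" where
  "Es x \<equiv> map (\<lambda>A. E A x) [0..<2*n]"

definition Vmat :: "'e \<Rightarrow> 'e list \<Rightarrow> real mat" where
  "Vmat y vs = Matrix.mat (2*n) (2*n) (\<lambda>(A, B). h y (E A y) (vs ! B))"

lemma Vmat_carrier: "Vmat y vs \<in> carrier_mat (2*n) (2*n)"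
  by (simp add: Vmat_def)

abbreviation vol :: "'e \<Rightarrow> 'e list \<Rightarrow> real" where
  "vol \<equiv> vol_form n h E"

lemma vol_det: "vol y vs = Determinant.det (Vmat y vs)"
proof -
  have "Determinant.det (Vmat y vs) = (\<Sum>p | p permutes {0..<2*n}. of_int (sign p) * (\<Prod>A = 0..<2*n. Vmat y vs $$ (A, p A)))"
    by (rule det_def'[OF Vmat_carrier])
  also have "\<dots> = vol y vs"
    unfolding vol_form_def lessThan_atLeast0
  proof (intro sum.cong refl arg_cong2[of _ _ _ _ "(*)"] prod.cong)
    fix p A assume p: "p \<in> {p. p permutes {0..<2*n}}" and A: "A \<in> {0..<2*n}"
    then have "p A \<in> {0..<2*n}" by (simp add: permutes_in_image)
    then show "Vmat y vs $$ (A, p A) = h y (E A y) (vs ! p A)" using A by (simp add: Vmat_def)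
  qed
  finally show ?thesis by simp
qed

text \<open>Any two top degree forms are proportional: \<open>rho x y\<close> relates the volume forms at \<open>y\<close> and at \<open>x\<close>, both
  regarded as forms on the coordinate space.  This reduces differentiating the Hodge star to the
  derivative of \<open>rho x\<close>.\<close>

definition rho :: "'e \<Rightarrow> 'e \<Rightarrow> real" where
  "rho x y = vol y (Es x)"

text \<open>Expanding the arguments in the frame at \<open>x\<close> factors the matrix of products
  with the frame at \<open>y\<close>; the determinant is multiplicative.\<close>

lemma vol_transport:
  assumes x: "x \<in> V" and y: "y \<in> V"
  shows "vol y vs = rho x y * vol x vs"
proof -
  have "Vmat y vs = Vmat y (Es x) * Vmat x vs"
  proof (rule eq_matI)
    fix i j assume "i < dim_row (Vmat y (Es x) * Vmat x vs)" "j < dim_col (Vmat y (Es x) * Vmat x vs)"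
    then have r: "i < 2*n" "j < 2*n" by (simp_all add: Vmat_def)
    have "h y (E i y) (vs ! j) = h y (E i y) (\<Sum>C<2*n. h x (vs ! j) (E C x) *\<^sub>R E C x)"
      by (rule arg_cong[OF frame_expand[OF x]])
    also have "\<dots> = (\<Sum>C<2*n. h y (E i y) (E C x) * h x (E C x) (vs ! j))"
      by (simp add: h_sum(2)[OF y] h_scale(2)[OF y] h_sym[OF x, of "vs ! j"] mult.commute)
    finally show "Vmat y vs $$ (i, j) = (Vmat y (Es x) * Vmat x vs) $$ (i, j)"
      using r by (simp add: Vmat_def scalar_prod_def lessThan_atLeast0)
  qed (simp_all add: Vmat_def)
  then show ?thesis
    by (simp add: vol_det rho_def det_mult[OF Vmat_carrier Vmat_carrier])
qed

lemma vol_swap: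
  assumes "length xs + 2 + length ys = 2*n"
  shows "vol y (xs @ a # b # ys) = - vol y (xs @ b # a # ys)"
proof -
  have "Vmat y (xs @ a # b # ys) = swapcols (length xs) (Suc (length xs)) (Vmat y (xs @ b # a # ys))"
    by (rule eq_matI) (use assms in \<open>auto simp: Vmat_def nth_append nth_Cons' less_Suc_eq\<close>)
  then show ?thesis
    using det_swapcols[OF _ _ _ Vmat_carrier, of "length xs" "Suc (length xs)" y "xs @ b # a # ys"] assms
    by (simp add: vol_det)
qed

lemma vol_move:
  assumes "length zs + 1 + length xs + length ys = 2*n"
  shows "vol y (zs @ a # xs @ ys) = (-1) ^ length xs * vol y (zs @ xs @ a # ys)"
  using assms
proof (induction xs arbitrary: zs)
  case Nil
  then show ?case by simp
next
  case (Cons b xs)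
  have "vol y (zs @ a # (b # xs) @ ys) = - vol y ((zs @ [b]) @ a # xs @ ys)"
    using vol_swap[of zs "xs @ ys" y a b] Cons.prems by simp
  also have "\<dots> = (-1) ^ length (b # xs) * vol y (zs @ (b # xs) @ a # ys)"
    using Cons.IH[of "zs @ [b]"] Cons.prems by simp
  finally show ?case .
qed

lemma vol_repeat:
  assumes "length ws + 1 = 2*n" "a \<in> set ws" shows "vol y (a # ws) = 0"
proof -
  obtain xs ys where ws: "ws = xs @ a # ys" using assms(2) by (auto dest: split_list)
  have "vol y (a # xs @ (a # ys)) = (-1) ^ length xs * vol y (xs @ a # a # ys)"
    using vol_move[of "[]" xs "a # ys" y a] assms by (simp add: ws)
  moreover have "vol y (xs @ a # a # ys) = 0"
    using vol_swap[of xs ys y a a] assms by (simp add: ws)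
  ultimately show ?thesis by (simp add: ws)
qed

lemma n_pos: "n > 0"
  using dim DIM_positive[where 'a = 'e] by simp

text \<open>Laplace expansion along the first column, whose cofactors do not depend on the first
  vector.\<close>

lemma vol_linear:
  assumes y: "y \<in> V"
  shows "vol y (v # ws) = (\<Sum>A<2*n. h y (E A y) v * vol y (E A y # ws))"
proof -
  define c where "c i = cofactor (Vmat y (0 # ws)) i 0" for i
  have c: "vol y (u # ws) = (\<Sum>i<2*n. h y (E i y) u * c i)" for u
  proof -
    have d: "mat_delete (Vmat y (u # ws)) i 0 = mat_delete (Vmat y (0 # ws)) i 0" for i
      by (rule eq_matI) (auto simp: mat_delete_def Vmat_def)
    have "vol y (u # ws) = (\<Sum>i<2*n. Vmat y (u # ws) $$ (i, 0) * cofactor (Vmat y (u # ws)) i 0)"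
      unfolding vol_det using n_pos by (intro laplace_expansion_column Vmat_carrier) simp
    also have "\<dots> = (\<Sum>i<2*n. h y (E i y) u * c i)"
      by (rule sum.cong) (use n_pos in \<open>auto simp: c_def cofactor_def d, simp add: Vmat_def\<close>)
    finally show ?thesis .
  qed
  have e: "vol y (E A y # ws) = c A" if "A < 2*n" for A
  proof -
    have "vol y (E A y # ws) = (\<Sum>i<2*n. if i = A then c i else 0)"
      unfolding c by (rule sum.cong) (use that in \<open>simp_all add: E_orth[OF y]\<close>)
    then show ?thesis using that by simp
  qed
  have "vol y (v # ws) = (\<Sum>A<2*n. h y (E A y) v * c A)" by (rule c)
  also have "\<dots> = (\<Sum>A<2*n. h y (E A y) v * vol y (E A y # ws))"
    by (rule sum.cong) (simp_all add: e)
  finally show ?thesis .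
qed

lemma vol_Es: "y \<in> V \<Longrightarrow> vol y (Es y) = 1"
proof -
  assume y: "y \<in> V"
  have "Vmat y (Es y) = 1\<^sub>m (2*n)"
    by (rule eq_matI) (auto simp: Vmat_def E_orth[OF y])
  then show ?thesis by (simp add: vol_det)
qed

lemma rho_self: "x \<in> V \<Longrightarrow> rho x x = 1"
  by (simp add: rho_def vol_Es)

definition dual_rest :: "'e \<Rightarrow> nat \<Rightarrow> 'e list" where
  "dual_rest x B = map (\<lambda>A. E A x) ([0..<B] @ [Suc B..<2*n])"

lemma length_dual_rest: "B < 2*n \<Longrightarrow> length (dual_rest x B) + 1 = 2*n"
  by (simp add: dual_rest_def)

lemma set_dual_rest: "A < 2*n \<Longrightarrow> A \<noteq> B \<Longrightarrow> E A x \<in> set (dual_rest x B)"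
  unfolding dual_rest_def set_map by (rule imageI) auto

lemma Es_split: "B < 2*n \<Longrightarrow> Es x = map (\<lambda>A. E A x) [0..<B] @ E B x # map (\<lambda>A. E A x) [Suc B..<2*n]"
  using upt_add_eq_append[of 0 B "2*n - B"] upt_conv_Cons[of B "2*n"] by simp

lemma vol_dual_rest:
  assumes y: "y \<in> V" and B: "B < 2*n"
  shows "vol y (v # dual_rest y B) = (-1) ^ B * h y (E B y) v"
proof -
  have 1: "vol y (E B y # dual_rest y B) = (-1) ^ B"
    using vol_move[of "[]" "map (\<lambda>A. E A y) [0..<B]" "map (\<lambda>A. E A y) [Suc B..<2*n]" y "E B y"] B
    by (simp add: dual_rest_def Es_split[OF B, symmetric] vol_Es[OF y])
  have "vol y (v # dual_rest y B) = (\<Sum>A<2*n. if A = B then (-1) ^ B * h y (E B y) v else 0)"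
    unfolding vol_linear[OF y, of v]
    by (rule sum.cong) (use 1 vol_repeat length_dual_rest[OF B] set_dual_rest in auto)
  then show ?thesis using B by simp
qed

definition skip :: "nat \<Rightarrow> nat \<Rightarrow> nat" where
  "skip B k = (if k < B then k else Suc k)"

lemma dual_rest_nth: "k < 2*n - 1 \<Longrightarrow> B < 2*n \<Longrightarrow> dual_rest x B ! k = E (skip B k) x"
  by (auto simp: dual_rest_def nth_append skip_def)

definition dual_rest2 :: "'e \<Rightarrow> nat \<Rightarrow> nat \<Rightarrow> 'e list" where
  "dual_rest2 x B k = take k (dual_rest x B) @ drop (Suc k) (dual_rest x B)"

text \<open>The list lacks the frame vectors \<open>B\<close> and \<open>skip B k\<close>, so only
  their coefficients in \<open>u\<close> and \<open>v\<close> matter. \<open>k\<close> is the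
  position after removal of \<open>B\<close>: restoring the two vectors takes \<open>k\<close> and
  \<open>B\<close> transpositions, hence the sign.\<close>

lemma vol_dual_rest2:
  assumes y: "y \<in> V" and B: "B < 2*n" and k: "k < 2*n - 1"
  shows "vol y (u # v # dual_rest2 y B k) = (-1) ^ (B + k) *
     (h y (E B y) u * h y (E (skip B k) y) v - h y (E (skip B k) y) u * h y (E B y) v)"
proof -
  let ?L = "dual_rest2 y B k" and ?k = "skip B k"
  have lk: "k < length (dual_rest y B)" using length_dual_rest[OF B, of y] k by simp
  have kk: "?k < 2*n" "?k \<noteq> B" using k by (auto simp: skip_def)
  have len: "length ?L + 2 = 2*n" using lk length_dual_rest[OF B, of y] by (simp add: dual_rest2_def)
  have split: "dual_rest y B = take k (dual_rest y B) @ E ?k y # drop (Suc k) (dual_rest y B)"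
    using id_take_nth_drop[OF lk] dual_rest_nth[OF k B] by simp
  have set: "E A y \<in> set ?L" if "A < 2*n" "A \<noteq> B" "A \<noteq> ?k" for A
    using set_dual_rest[OF that(1,2), of y] that(3) kk
  proof -
    have ne: "E A y \<noteq> E ?k y" using E_orth[OF y that(1) kk(1)] E_orth[OF y kk(1) kk(1)] that(3) by auto
    have "E A y \<in> set (take k (dual_rest y B) @ E ?k y # drop (Suc k) (dual_rest y B))"
      using set_dual_rest[OF that(1,2), of y] split by simp
    then show ?thesis using ne by (auto simp: dual_rest2_def)
  qed
  have one: "vol y (a # E B y # ?L) = - ((-1) ^ (B + k) * h y (E ?k y) a)" for a
  proof -
    have b: "vol y (E ?k y # E B y # ?L) = - ((-1) ^ (B + k))"
    proof -
      have "vol y (E ?k y # E B y # ?L) = - vol y (E B y # E ?k y # ?L)"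
        using vol_swap[of "[]" ?L y "E ?k y" "E B y"] len by simp
      also have "vol y (E B y # E ?k y # ?L) = (-1) ^ k * vol y (E B y # dual_rest y B)"
        using vol_move[of "[E B y]" "take k (dual_rest y B)" "drop (Suc k) (dual_rest y B)" y "E ?k y"] lk
          length_dual_rest[OF B, of y] split by (simp add: dual_rest2_def)
      finally show ?thesis by (simp add: vol_dual_rest[OF y B] E_orth[OF y B B] power_add mult.commute)
    qed
    have "vol y (a # E B y # ?L) = (\<Sum>A<2*n. if A = ?k then - ((-1) ^ (B + k) * h y (E ?k y) a) else 0)"
      unfolding vol_linear[OF y, of a]
    proof (rule sum.cong)
      fix A assume A: "A \<in> {..<2*n}"
      show "h y (E A y) a * vol y (E A y # E B y # ?L) = (if A = ?k then - ((-1) ^ (B + k) * h y (E ?k y) a) else 0)"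
      proof (cases "A = ?k")
        case True
        then show ?thesis using b by simp
      next
        case False
        then have "E A y \<in> set (E B y # ?L)" using set A by auto
        then have "vol y (E A y # E B y # ?L) = 0" by (intro vol_repeat) (use len in auto)
        then show ?thesis using False by simp
      qed
    qed simp
    then show ?thesis using kk by simp
  qed
  have two: "vol y (a # E ?k y # ?L) = (-1) ^ (B + k) * h y (E B y) a" for a
  proof -
    have b: "vol y (E B y # E ?k y # ?L) = (-1) ^ (B + k)"
      using one[of "E ?k y"] vol_swap[of "[]" ?L y "E B y" "E ?k y"] len E_orth[OF y kk(1) kk(1)] by simp
    have "vol y (a # E ?k y # ?L) = (\<Sum>A<2*n. if A = B then (-1) ^ (B + k) * h y (E B y) a else 0)"
      unfolding vol_linear[OF y, of a]
    proof (rule sum.cong)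
      fix A assume A: "A \<in> {..<2*n}"
      show "h y (E A y) a * vol y (E A y # E ?k y # ?L) = (if A = B then (-1) ^ (B + k) * h y (E B y) a else 0)"
      proof (cases "A = B")
        case True
        then show ?thesis using b by simp
      next
        case False
        then have "E A y \<in> set (E ?k y # ?L)" using set A by auto
        then have "vol y (E A y # E ?k y # ?L) = 0" by (intro vol_repeat) (use len in auto)
        then show ?thesis using False by simp
      qed
    qed simp
    then show ?thesis using B by simp
  qed
  have "vol y (u # v # ?L) = (\<Sum>A<2*n. (if A = B then h y (E B y) u * vol y (E B y # v # ?L) else 0)
     + (if A = ?k then h y (E ?k y) u * vol y (E ?k y # v # ?L) else 0))"
    unfolding vol_linear[OF y, of u]
  proof (rule sum.cong)
    fix A assume A: "A \<in> {..<2*n}"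
    show "h y (E A y) u * vol y (E A y # v # ?L) = (if A = B then h y (E B y) u * vol y (E B y # v # ?L) else 0)
     + (if A = ?k then h y (E ?k y) u * vol y (E ?k y # v # ?L) else 0)"
    proof (cases "A = B \<or> A = ?k")
      case True
      then show ?thesis using kk by auto
    next
      case False
      then have "E A y \<in> set (v # ?L)" using set A by auto
      then have "vol y (E A y # v # ?L) = 0" by (intro vol_repeat) (use len in auto)
      then show ?thesis using False by simp
    qed
  qed simp
  also have "\<dots> = h y (E B y) u * vol y (E B y # v # ?L) + h y (E ?k y) u * vol y (E ?k y # v # ?L)"
    using B kk by (simp add: sum.distrib)
  also have "vol y (E B y # v # ?L) = (-1) ^ (B + k) * h y (E ?k y) v"
    using vol_swap[of "[]" ?L y "E B y" v] one[of v] len by simp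
  also have "vol y (E ?k y # v # ?L) = - ((-1) ^ (B + k) * h y (E B y) v)"
    using vol_swap[of "[]" ?L y "E ?k y" v] two[of v] len by simp
  finally show ?thesis by (simp add: algebra_simps)
qed

text \<open>The Christoffel symbols of the chart in frame components. They measure how coordinate
  derivatives of the frame differ from \<open>w\<close> and must cancel from every
  codifferential.\<close>

definition gam :: "'e \<Rightarrow> nat \<Rightarrow> nat \<Rightarrow> nat \<Rightarrow> real" where
  "gam x A B C = h x (\<Gamma> x (E A x) (E B x)) (E C x)"

lemma gam_sym: "x \<in> V \<Longrightarrow> gam x A B C = gam x B A C"
  by (simp add: gam_def \<Gamma>_sym[of x "E A x" "E B x"])

lemma h_fder_E: "x \<in> V \<Longrightarrow> h x (fder (E B) x (E A x)) (E C x) = w A B C x - gam x A B C"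
  by (simp add: w_def gam_def cov_def h_simps)

lemma has_derivative_rho:
  assumes x: "x \<in> V"
  shows "(rho x has_derivative (\<lambda>v. \<Sum>A<2*n. h x (fder (E A) x v + \<Gamma> x v (E A x)) (E A x) + h x (E A x) (\<Gamma> x v (E A x)))) (at x)"
proof -
  let ?N = "{..<2*n}"
  define \<eta> where "\<eta> A C v = h x (fder (E A) x v + \<Gamma> x v (E A x)) (E C x) + h x (E A x) (\<Gamma> x v (E C x))" for A C v
  have \<eta>: "((\<lambda>y. h y (E A y) (E C x)) has_derivative \<eta> A C) (at x)" if "A < 2*n" for A C
    using has_derivative_h[OF x E_diff[OF that x], of "\<lambda>_. E C x"] by (simp add: \<eta>_def [abs_def] fder_const)
  have rho: "rho x = (\<lambda>y. \<Sum>p | p permutes ?N. of_int (sign p) * (\<Prod>A<2*n. h y (E A y) (E (p A) x)))"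
  proof (rule ext)
    fix y
    show "rho x y = (\<Sum>p | p permutes ?N. of_int (sign p) * (\<Prod>A<2*n. h y (E A y) (E (p A) x)))"
      unfolding rho_def vol_form_def
    proof (intro sum.cong refl arg_cong2[of _ _ _ _ "(*)"] prod.cong)
      fix p A assume p: "p \<in> {p. p permutes ?N}" and A: "A \<in> ?N"
      then have "p A \<in> ?N" using permutes_in_image[of p ?N A] by blast
      then show "h y (E A y) (Es x ! p A) = h y (E A y) (E (p A) x)" by simp
    qed
  qed
  have d: "(rho x has_derivative (\<lambda>v. \<Sum>p | p permutes ?N. of_int (sign p) *
     (\<Sum>A<2*n. \<eta> A (p A) v * (\<Prod>B\<in>?N - {A}. h x (E B x) (E (p B) x))))) (at x)"
    unfolding rho
    by (intro has_derivative_sum has_derivative_mult_right has_derivative_prod \<eta>) simp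
  \<comment> \<open>A permutation other than the identity moves at least two indices. Hence an
    undifferentiated off-diagonal entry remains, and it is zero at \<open>x\<close>: the derivative
    of the determinant at the identity matrix is the trace.\<close>
  have z: "(\<Sum>A<2*n. \<eta> A (p A) v * (\<Prod>B\<in>?N - {A}. h x (E B x) (E (p B) x))) = 0"
    if p: "p permutes ?N" "p \<noteq> id" for p v
  proof (rule sum.neutral, rule ballI)
    fix A assume A: "A \<in> ?N"
    have "\<exists>B\<in>?N - {A}. p B \<noteq> B"
    proof (rule ccontr)
      assume "\<not> ?thesis"
      then have f: "p B = B" if "B \<noteq> A" for B
        using that permutes_not_in[OF p(1)] by (cases "B \<in> ?N") auto
      moreover have "p A = A"
      proof (rule ccontr)
        assume "p A \<noteq> A"
        then have "p (p A) = p A" using f by blast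
        then show False using \<open>p A \<noteq> A\<close> permutes_inj[OF p(1)] by (auto dest: injD)
      qed
      ultimately have "p = id" by (metis eq_id_iff)
      then show False using p by simp
    qed
    then obtain B where B: "B \<in> ?N - {A}" "p B \<noteq> B" by auto
    have "p B \<in> ?N" using B permutes_in_image[OF p(1), of B] by blast
    then have "h x (E B x) (E (p B) x) = 0" using B E_orth[OF x, of B "p B"] by auto
    then have "(\<Prod>B\<in>?N - {A}. h x (E B x) (E (p B) x)) = 0"
      using B by (intro prod_zero) auto
    then show "\<eta> A (p A) v * (\<Prod>B\<in>?N - {A}. h x (E B x) (E (p B) x)) = 0" by simp
  qed
  have "(\<Sum>p | p permutes ?N. of_int (sign p) * (\<Sum>A<2*n. \<eta> A (p A) v * (\<Prod>B\<in>?N - {A}. h x (E B x) (E (p B) x))))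
    = (\<Sum>A<2*n. \<eta> A A v)" for v
  proof -
    have "(\<Sum>p | p permutes ?N. of_int (sign p) * (\<Sum>A<2*n. \<eta> A (p A) v * (\<Prod>B\<in>?N - {A}. h x (E B x) (E (p B) x))))
      = (\<Sum>p | p permutes ?N. if p = id then (\<Sum>A<2*n. \<eta> A A v) else 0)"
    proof (rule sum.cong)
      fix p assume p: "p \<in> {p. p permutes ?N}"
      show "of_int (sign p) * (\<Sum>A<2*n. \<eta> A (p A) v * (\<Prod>B\<in>?N - {A}. h x (E B x) (E (p B) x)))
        = (if p = id then (\<Sum>A<2*n. \<eta> A A v) else 0)"
      proof (cases "p = id")
        case True
        have "(\<Prod>B\<in>?N - {A}. h x (E B x) (E B x)) = 1" for A
          by (rule prod.neutral) (auto simp: E_orth[OF x])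
        then show ?thesis using True by (simp add: sign_id)
      qed (use z p in simp)
    qed simp
    also have "\<dots> = (\<Sum>A<2*n. \<eta> A A v)"
      using finite_permutations[of ?N] permutes_id[of ?N] by (simp add: sum.delta)
    finally show ?thesis .
  qed
  with d show ?thesis by (simp add: \<eta>_def)
qed

text \<open>The classical formula that the logarithmic derivative of the volume density is the trace
  of the Christoffel symbols. The contribution of \<open>w\<close> is a trace of a skew
  array.\<close>

lemma fder_rho:
  assumes x: "x \<in> V" and k: "k < 2*n"
  shows "fder (rho x) x (E k x) = (\<Sum>A<2*n. gam x k A A)"
proof -
  have "fder (rho x) x (E k x) = (\<Sum>A<2*n. w k A A x + gam x k A A)"
    unfolding fder_eqI[OF has_derivative_rho[OF x]]
    by (simp add: w_def cov_def gam_def h_sym[OF x, of "E _ x" "\<Gamma> _ _ _"])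
  also have "\<dots> = (\<Sum>A<2*n. gam x k A A)"
  proof (rule sum.cong)
    fix A assume "A \<in> {..<2*n}"
    then have "w k A A x = 0" using w_skew[OF x k, of A A] by simp
    then show "w k A A x + gam x k A A = gam x k A A" by simp
  qed simp
  finally show ?thesis .
qed

end

lemma Fd_skew_mult: "A < 2*n \<Longrightarrow> C < 2*n \<Longrightarrow> Fd n C A * r = - (Fd n A C * r)"
  using Fd_skew[of A n C] by simp

lemma sum_mult_delta:
  assumes "k < N" shows "(\<Sum>C<N::nat. g C * (if k = C then 1 else 0)) = (g k :: real)"
proof -
  have "(\<Sum>C<N. g C * (if k = C then 1 else 0)) = (\<Sum>C<N. if k = C then g C else 0)"
    by (rule sum.cong) auto
  then show ?thesis using assms by simp
qed

section \<open>The Hodge star in the degrees needed, and the codifferentials of \<open>F\<close> and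
  of the Lee form\<close>

context hermitian_chart
begin

lemma hodge_star_top:
  assumes x: "x \<in> V" shows "hodge_star n h E \<eta> x [] = \<eta> x (Es x)"
proof -
  have "{S. S \<subseteq> {..<2*n} \<and> card S + length ([]::'e list) = 2*n} = {{..<2*n}}"
    by (auto dest: card_subset_eq[OF finite_lessThan])
  then show ?thesis
    by (simp add: hodge_star_def frame_list_def sorted_list_of_set_lessThan vol_Es[OF x])
qed

lemma frame_list_remove: "C < 2*n \<Longrightarrow> frame_list E ({..<2*n} - {C}) x = dual_rest x C"
  by (simp add: frame_list_def dual_rest_def sorted_list_of_set_lessThan_remove)

text \<open>Here the star acts on a form of degree \<open>2 * n - 1\<close>. The minus sign comes
  from moving \<open>v\<close> past the odd number \<open>2 * n - 1\<close> of frame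
  vectors.\<close>

lemma hodge_star_1:
  assumes x: "x \<in> V"
  shows "hodge_star n h E \<eta> x [v] = (\<Sum>C<2*n. - ((-1) ^ C * h x (E C x) v * \<eta> x (dual_rest x C)))"
proof -
  have v: "vol x (dual_rest x C @ [v]) = - ((-1) ^ C * h x (E C x) v)" if "C < 2*n" for C
  proof -
    have "vol x (v # dual_rest x C) = (-1) ^ length (dual_rest x C) * vol x (dual_rest x C @ [v])"
      using vol_move[of "[]" "dual_rest x C" "[]" x v] length_dual_rest[OF that] by simp
    moreover have "(-1) ^ length (dual_rest x C) = (-1 :: real)"
    proof -
      have "odd (length (dual_rest x C))"
        using length_dual_rest[OF that, of x] by (metis even_add even_mult_iff even_numeral odd_one)
      then show ?thesis by simp
    qed
    ultimately show ?thesis using vol_dual_rest[OF x that, of v] by simp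
  qed
  have "hodge_star n h E \<eta> x [v] = (\<Sum>S | S \<subseteq> {..<2*n} \<and> Suc (card S) = 2*n. \<eta> x (frame_list E S x) * vol x (frame_list E S x @ [v]))"
    by (simp add: hodge_star_def)
  also have "\<dots> = (\<Sum>C<2*n. \<eta> x (frame_list E ({..<2*n} - {C}) x) * vol x (frame_list E ({..<2*n} - {C}) x @ [v]))"
    using n_pos by (intro sum_card_pred) simp
  also have "\<dots> = (\<Sum>C<2*n. - ((-1) ^ C * h x (E C x) v * \<eta> x (dual_rest x C)))"
    by (intro sum.cong refl) (simp add: frame_list_remove v)
  finally show ?thesis .
qed

lemma hodge_star_1form:
  assumes "length ws + 1 = 2*n"
  shows "hodge_star n h E \<phi> y ws = (\<Sum>A<2*n. \<phi> y [E A y] * vol y (E A y # ws))"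
proof -
  have "card S + length ws = 2*n \<longleftrightarrow> card S = 1" for S :: "nat set" using assms by auto
  then have "hodge_star n h E \<phi> y ws = (\<Sum>S | S \<subseteq> {..<2*n} \<and> card S = 1. \<phi> y (frame_list E S y) * vol y (frame_list E S y @ ws))"
    by (simp add: hodge_star_def)
  then show ?thesis
    by (subst (asm) sum_card_1) (simp add: frame_list_def)
qed

lemma fund_form_frame:
  "y \<in> V \<Longrightarrow> A < 2*n \<Longrightarrow> B < 2*n \<Longrightarrow> fund_form h J y [E A y, E B y] = Fd n A B"
  by (simp add: fund_form_def E_J h_simps E_orth Fd_def)

lemma hodge_star_fund_form:
  assumes y: "y \<in> V" and L: "length L + 2 = 2*n"
  shows "hodge_star n h E (fund_form h J) y L = 1/2 * (\<Sum>A<2*n. \<Sum>C<2*n. Fd n A C * vol y (E A y # E C y # L))"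
proof -
  have "card S + length L = 2*n \<longleftrightarrow> card S = 2" for S :: "nat set" using L by auto
  then have "hodge_star n h E (fund_form h J) y L = (\<Sum>S | S \<subseteq> {..<2*n} \<and> card S = 2.
      fund_form h J y (frame_list E S y) * vol y (frame_list E S y @ L))"
    by (simp add: hodge_star_def)
  also have "\<dots> = 1/2 * (\<Sum>A<2*n. \<Sum>C<2*n. Fd n A C * vol y (E A y # E C y # L))"
  proof (rule sum_card_2)
    fix A B assume r: "A < 2*n" "B < 2*n" "A < B"
    have f: "frame_list E {A, B} y = [E A y, E B y]"
      using r by (simp add: frame_list_def sorted_list_of_set_insert_remove)
    show "Fd n A B * vol y (E A y # E B y # L) = fund_form h J y (frame_list E {A, B} y) * vol y (frame_list E {A, B} y @ L)
       \<and> Fd n B A * vol y (E B y # E A y # L) = fund_form h J y (frame_list E {A, B} y) * vol y (frame_list E {A, B} y @ L)"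
      using r y vol_swap[of "[]" L y "E B y" "E A y"] L Fd_skew[of A n B]
      by (simp add: f fund_form_frame)
  next
    fix A assume "A < 2*n"
    then show "Fd n A A * vol y (E A y # E A y # L) = 0"
      using vol_repeat[of "E A y # L" "E A y" y] L by simp
  qed
  finally show ?thesis .
qed

lemma Es_remove: "i < 2*n \<Longrightarrow> take i (Es x) @ drop (Suc i) (Es x) = dual_rest x i"
  by (simp add: dual_rest_def take_map drop_map)

lemma has_derivative_h_fixed:
  assumes x: "x \<in> V" and A: "A < 2*n"
  shows "((\<lambda>y. h x u (E A y)) has_derivative (\<lambda>v. h x u (fder (E A) x v))) (at x)"
  by (rule bounded_linear.has_derivative[OF _ fder_has_derivative[OF E_diff[OF A x]]])
    (simp add: linear_conv_bounded_linear [symmetric] bilinear_linear2[OF h_bilinear[OF x]])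

text \<open>The exterior derivative differentiates with arguments frozen at \<open>x\<close>. On
  those arguments the star at \<open>y\<close> is expressed by \<open>rho x y\<close> and products
  in the fixed metric \<open>h x\<close>, which gives \<open>?G\<close>.\<close>

lemma codiff_1form:
  assumes x: "x \<in> V" and f: "\<And>y A. y \<in> V \<Longrightarrow> A < 2*n \<Longrightarrow> \<phi> y [E A y] = f A y"
    and fd: "\<And>A. A < 2*n \<Longrightarrow> f A differentiable at x"
  shows "codiff n h E \<phi> x [] = - dvg n (\<lambda>A B C. w A B C x) (\<lambda>A. f A x) (\<lambda>D A. fder (f A) x (E D x))"
proof -
  let ?G = "\<lambda>i y. \<Sum>A<2*n. f A y * (rho x y * ((-1) ^ i * h x (E i x) (E A y)))"
  let ?r = "\<lambda>i. \<Sum>A<2*n. gam x i A A"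
  have r1: "rho x x = 1" by (rule rho_self[OF x])
  have dr: "(rho x has_derivative fder (rho x) x) (at x)"
    by (rule fder_has_derivative[OF differentiableI[OF has_derivative_rho[OF x]]])
  have hodge: "hodge_star n h E \<phi> y (dual_rest x i) = ?G i y" if "y \<in> V" "i < 2*n" for y i
    using that by (simp add: hodge_star_1form length_dual_rest[simplified] f vol_transport[OF x that(1), of "_ # _"]
        vol_dual_rest[OF x that(2)])
  have dG: "fder (?G i) x v = (-1) ^ i * (\<Sum>A<2*n. f A x * (h x (E i x) (fder (E A) x v) + fder (rho x) x v * (if i = A then 1 else 0))
      + fder (f A) x v * (if i = A then 1 else 0))" if i: "i < 2*n" for i v
  proof -
    have "(?G i has_derivative (\<lambda>v. \<Sum>A<2*n. f A x * (rho x x * ((-1) ^ i * h x (E i x) (fder (E A) x v))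
        + fder (rho x) x v * ((-1) ^ i * h x (E i x) (E A x))) + fder (f A) x v * (rho x x * ((-1) ^ i * h x (E i x) (E A x))))) (at x)"
      by (intro has_derivative_sum has_derivative_mult has_derivative_mult_right fder_has_derivative fd dr
          has_derivative_h_fixed[OF x]) auto
    note e = fder_eqI[OF this]
    show ?thesis
      unfolding e r1 sum_distrib_left
      by (intro sum.cong refl) (use i in \<open>simp add: E_orth[OF x] algebra_simps\<close>)
  qed
  have "ext_d (hodge_star n h E \<phi>) x (Es x) = (\<Sum>i<2*n. (-1) ^ i * fder (\<lambda>y. hodge_star n h E \<phi> y (dual_rest x i)) x (E i x))"
    by (simp add: ext_d_def Es_remove)
  also have "\<dots> = (\<Sum>i<2*n. \<Sum>A<2*n. f A x * (h x (E i x) (fder (E A) x (E i x)) + ?r i * (if i = A then 1 else 0))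
      + fder (f A) x (E i x) * (if i = A then 1 else 0))"
  proof (rule sum.cong)
    fix i assume i: "i \<in> {..<2*n}"
    then have i': "i < 2*n" by simp
    have m1: "(-1) ^ i * ((-1) ^ i * r) = r" for r :: real by (cases "even i") auto
    have e: "fder (\<lambda>y. hodge_star n h E \<phi> y (dual_rest x i)) x = fder (?G i) x"
      by (rule fder_cong_open[OF open_V x]) (use hodge i in auto)
    show "(-1) ^ i * fder (\<lambda>y. hodge_star n h E \<phi> y (dual_rest x i)) x (E i x)
      = (\<Sum>A<2*n. f A x * (h x (E i x) (fder (E A) x (E i x)) + ?r i * (if i = A then 1 else 0))
      + fder (f A) x (E i x) * (if i = A then 1 else 0))"
      unfolding e dG[OF i'] fder_rho[OF x i'] m1 ..
  qed simp
  also have "\<dots> = (\<Sum>i<2*n. \<Sum>A<2*n. f A x * (- w i i A x - gam x i A i)) + (\<Sum>i<2*n. f i x * ?r i)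
     + (\<Sum>i<2*n. fder (f i) x (E i x))"
    unfolding sum.distrib [symmetric]
  proof (rule sum.cong)
    fix i assume i: "i \<in> {..<2*n}"
    have "(\<Sum>A<2*n. f A x * (h x (E i x) (fder (E A) x (E i x)) + ?r i * (if i = A then 1 else 0))
      + fder (f A) x (E i x) * (if i = A then 1 else 0))
      = (\<Sum>A<2*n. f A x * (- w i i A x - gam x i A i) + (if i = A then f A x * ?r i + fder (f A) x (E i x) else 0))"
    proof (rule sum.cong)
      fix A assume A: "A \<in> {..<2*n}"
      have "h x (E i x) (fder (E A) x (E i x)) = - w i i A x - gam x i A i"
        using h_sym[OF x, of "E i x"] h_fder_E[OF x, of A i i] w_skew[OF x, of i i A] i A by simp
      then show "f A x * (h x (E i x) (fder (E A) x (E i x)) + ?r i * (if i = A then 1 else 0))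
        + fder (f A) x (E i x) * (if i = A then 1 else 0)
        = f A x * (- w i i A x - gam x i A i) + (if i = A then f A x * ?r i + fder (f A) x (E i x) else 0)"
        by (simp add: distrib_left)
    qed simp
    then show "(\<Sum>A<2*n. f A x * (h x (E i x) (fder (E A) x (E i x)) + ?r i * (if i = A then 1 else 0))
      + fder (f A) x (E i x) * (if i = A then 1 else 0))
      = (\<Sum>A<2*n. f A x * (- w i i A x - gam x i A i)) + f i x * ?r i + fder (f i) x (E i x)"
      using i by (simp add: sum.distrib)
  qed simp
  \<comment> \<open>By symmetry of \<open>gam\<close> in its first two indices, the derivative of
    the volume density equals the \<open>gam\<close> terms from the derivatives of the frame, and
    the two cancel.\<close>
  also have "(\<Sum>i<2*n. f i x * ?r i) = (\<Sum>i<2*n. \<Sum>A<2*n. f A x * gam x i A i)"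
  proof -
    have "(\<Sum>i<2*n. f i x * ?r i) = (\<Sum>i<2*n. \<Sum>A<2*n. f i x * gam x A i A)"
      unfolding sum_distrib_left
      by (intro sum.cong refl arg_cong2[of _ _ _ _ "(*)"] gam_sym[OF x])
    then show ?thesis by (subst sum.swap)
  qed
  finally have "ext_d (hodge_star n h E \<phi>) x (Es x) = dvg n (\<lambda>A B C. w A B C x) (\<lambda>A. f A x) (\<lambda>D A. fder (f A) x (E D x))"
    by (simp add: dvg_def sum.distrib [symmetric] right_diff_distrib sum_subtractf sum_negf mult.commute)
  then show ?thesis
    by (simp add: codiff_def hodge_star_top[OF x])
qed

lemma sum_skip:
  fixes f :: "nat \<Rightarrow> real"
  assumes B: "B < N" and z: "f B = 0"
  shows "(\<Sum>k<N - 1. f (skip B k)) = (\<Sum>k<N. f k)"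
proof -
  have "(\<Sum>k<N - 1. f (skip B k)) = (\<Sum>k\<in>{..<N} - {B}. f k)"
    by (rule sum.reindex_bij_witness[of _ "\<lambda>k. if k < B then k else k - 1" "skip B"])
      (use B in \<open>auto simp: skip_def\<close>)
  also have "\<dots> = (\<Sum>k<N. f k)"
    using B z by (subst sum_diff1) auto
  finally show ?thesis .
qed

text \<open>The components of \<open>F\<close> are constant, so only \<open>rho\<close> and the
  frame vectors are differentiated. The volume derivative cancels one family of \<open>gam\<close>
  terms, the other cancels because \<open>gam\<close> is symmetric and \<open>F\<close> is skew; the
  terms in \<open>w\<close> form the trace of \<open>Tw\<close>.\<close>

lemma ext_d_hodge_fund_form:
  assumes x: "x \<in> V" and B: "B < 2*n"
  shows "ext_d (hodge_star n h E (fund_form h J)) x (dual_rest x B) = (-1) ^ B * - (\<Sum>k<2*n. Tw x k k B)"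
proof -
  let ?Q = "\<lambda>k y. \<Sum>A<2*n. \<Sum>C<2*n. Fd n A C * (h x (E B x) (E A y) * h x (E k x) (E C y))"
  have r1: "rho x x = 1" by (rule rho_self[OF x])
  have dr: "(rho x has_derivative fder (rho x) x) (at x)"
    by (rule fder_has_derivative[OF differentiableI[OF has_derivative_rho[OF x]]])
  have hodge: "hodge_star n h E (fund_form h J) y (dual_rest2 x B k) = (-1) ^ (B + k) * (rho x y * ?Q (skip B k) y)"
    if y: "y \<in> V" and k: "k < 2*n - 1" for y k
  proof -
    have len: "length (dual_rest2 x B k) + 2 = 2*n"
      using length_dual_rest[OF B, of x] k by (simp add: dual_rest2_def)
    let ?a = "\<lambda>A C. h x (E B x) (E A y) * h x (E (skip B k) x) (E C y)"
    have "(\<Sum>A<2*n. \<Sum>C<2*n. Fd n A C * ?a C A) = (\<Sum>A<2*n. \<Sum>C<2*n. Fd n C A * ?a A C)"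
      by (rule sum.swap)
    also have "\<dots> = (\<Sum>A<2*n. \<Sum>C<2*n. - (Fd n A C * ?a A C))"
      by (intro sum.cong refl Fd_skew_mult) auto
    finally have s: "(\<Sum>A<2*n. \<Sum>C<2*n. Fd n A C * ?a C A) = - ?Q (skip B k) y" by (simp add: sum_negf)
    have "hodge_star n h E (fund_form h J) y (dual_rest2 x B k)
      = 1/2 * (\<Sum>A<2*n. \<Sum>C<2*n. Fd n A C * (rho x y * ((-1) ^ (B + k) * (?a A C - ?a C A))))"
      unfolding hodge_star_fund_form[OF y len] vol_transport[OF x y] vol_dual_rest2[OF x B k]
      by (simp add: mult.commute)
    also have "\<dots> = 1/2 * ((-1) ^ (B + k) * (rho x y * (?Q (skip B k) y - (\<Sum>A<2*n. \<Sum>C<2*n. Fd n A C * ?a C A))))"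
      by (simp add: sum_distrib_left sum_subtractf [symmetric] right_diff_distrib mult_ac)
    finally show ?thesis unfolding s by simp
  qed
  let ?d = "\<lambda>k. fder (rho x) x (E k x) * Fd n B k
      + (\<Sum>A<2*n. Fd n A k * (w k A B x - gam x k A B)) + (\<Sum>C<2*n. Fd n B C * (w k C k x - gam x k C k))"
  have dQ: "fder (\<lambda>y. (-1) ^ j * (rho x y * ?Q k y)) x (E k x) = (-1) ^ j * ?d k" if k: "k < 2*n" for k j
  proof -
    have "((\<lambda>y. (-1) ^ j * (rho x y * ?Q k y)) has_derivative (\<lambda>v. (-1) ^ j * (rho x x *
       (\<Sum>A<2*n. \<Sum>C<2*n. Fd n A C * (h x (E B x) (E A x) * h x (E k x) (fder (E C) x v)
          + h x (E B x) (fder (E A) x v) * h x (E k x) (E C x))) + fder (rho x) x v * ?Q k x))) (at x)"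
      by (intro has_derivative_sum has_derivative_mult has_derivative_mult_right dr has_derivative_h_fixed[OF x]) auto
    then have "fder (\<lambda>y. (-1) ^ j * (rho x y * ?Q k y)) x (E k x) = (-1) ^ j * (rho x x *
       (\<Sum>A<2*n. \<Sum>C<2*n. Fd n A C * (h x (E B x) (E A x) * h x (E k x) (fder (E C) x (E k x))
          + h x (E B x) (fder (E A) x (E k x)) * h x (E k x) (E C x))) + fder (rho x) x (E k x) * ?Q k x)"
      by (simp add: fder_eqI)
    also have "?Q k x = Fd n B k"
    proof -
      have "?Q k x = (\<Sum>A<2*n. if A = B then (\<Sum>C<2*n. if C = k then Fd n A C else 0) else 0)"
        by (intro sum.cong refl) (use B k in \<open>auto simp: E_orth[OF x] sum_mult_delta\<close>)
      then show ?thesis using B k by simp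
    qed
    also have "(\<Sum>A<2*n. \<Sum>C<2*n. Fd n A C * (h x (E B x) (E A x) * h x (E k x) (fder (E C) x (E k x))
          + h x (E B x) (fder (E A) x (E k x)) * h x (E k x) (E C x)))
      = (\<Sum>A<2*n. Fd n A k * (w k A B x - gam x k A B)) + (\<Sum>C<2*n. Fd n B C * (w k C k x - gam x k C k))"
    proof -
      have 1: "h x (E K x) (fder (E C) x (E k x)) = w k C K x - gam x k C K" for C K
        using h_sym[OF x, of "E K x"] h_fder_E[OF x, of C k K] by simp
      have 2: "(\<Sum>A<2*n. \<Sum>C<2*n. Fd n A C * (h x (E B x) (E A x) * h x (E k x) (fder (E C) x (E k x))))
        = (\<Sum>A<2*n. if A = B then (\<Sum>C<2*n. Fd n A C * (w k C k x - gam x k C k)) else 0)"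
        by (intro sum.cong refl) (use B in \<open>auto simp: E_orth[OF x] 1 intro!: sum.neutral sum.cong\<close>)
      have 3: "(\<Sum>A<2*n. \<Sum>C<2*n. Fd n A C * (h x (E B x) (fder (E A) x (E k x)) * h x (E k x) (E C x)))
        = (\<Sum>A<2*n. \<Sum>C<2*n. if C = k then Fd n A C * (w k A B x - gam x k A B) else 0)"
        by (intro sum.cong refl) (use k in \<open>auto simp: E_orth[OF x] 1\<close>)
      show ?thesis using 2 3 B k by (simp add: distrib_left sum.distrib)
    qed
    finally show ?thesis by (simp add: r1 algebra_simps)
  qed
  \<comment> \<open>The exterior derivative runs over the indices other than \<open>B\<close>. As
    the expression vanishes at \<open>B\<close>, \<open>sum_skip\<close> extends the sum to all
    indices.\<close>
  have Fdd: "?d B = 0"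
  proof -
    have "(\<Sum>A<2*n. Fd n A B * (w B A B x - gam x B A B)) = - (\<Sum>C<2*n. Fd n B C * (w B C B x - gam x B C B))"
      unfolding sum_negf [symmetric] by (intro sum.cong refl Fd_skew_mult) (use B in auto)
    moreover have "Fd n B B = 0" using Fd_skew[OF B B] by simp
    ultimately show ?thesis by simp
  qed
  have "ext_d (hodge_star n h E (fund_form h J)) x (dual_rest x B)
    = (\<Sum>k<2*n - 1. (-1) ^ k * fder (\<lambda>y. hodge_star n h E (fund_form h J) y (dual_rest2 x B k)) x (E (skip B k) x))"
  proof -
    have "length (dual_rest x B) = 2*n - 1" using length_dual_rest[OF B, of x] by simp
    then show ?thesis by (simp add: ext_d_def dual_rest2_def dual_rest_nth[OF _ B])
  qed
  also have "\<dots> = (\<Sum>k<2*n - 1. (-1) ^ B * ?d (skip B k))"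
  proof (rule sum.cong)
    fix k assume "k \<in> {..<2*n - 1}"
    then have k: "k < 2*n - 1" by simp
    have kk: "skip B k < 2*n" using k by (auto simp: skip_def)
    have "fder (\<lambda>y. hodge_star n h E (fund_form h J) y (dual_rest2 x B k)) x = fder (\<lambda>y. (-1) ^ (B + k) * (rho x y * ?Q (skip B k) y)) x"
      by (rule fder_cong_open[OF open_V x]) (rule hodge[OF _ k])
    then have "(-1) ^ k * fder (\<lambda>y. hodge_star n h E (fund_form h J) y (dual_rest2 x B k)) x (E (skip B k) x)
      = (-1) ^ k * ((-1) ^ (B + k) * ?d (skip B k))"
      using dQ[OF kk, of "B + k"] by simp
    also have "\<dots> = (-1) ^ B * ?d (skip B k)"
    proof -
      have "(-1) ^ k * ((-1) ^ (B + k) * r) = (-1) ^ B * r" for r :: real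
        by (simp add: power_add mult.left_commute mult.assoc [symmetric] power_mult_distrib [symmetric])
      then show ?thesis by blast
    qed
    finally show "(-1) ^ k * fder (\<lambda>y. hodge_star n h E (fund_form h J) y (dual_rest2 x B k)) x (E (skip B k) x) = (-1) ^ B * ?d (skip B k)" .
  qed simp
  also have "\<dots> = (\<Sum>k<2*n. (-1) ^ B * ?d k)"
    by (rule sum_skip[OF B, of "\<lambda>k. (-1) ^ B * ?d k"]) (use Fdd in simp)
  also have "\<dots> = (-1) ^ B * (\<Sum>k<2*n. ?d k)" by (rule sum_distrib_left [symmetric])
  also have "(\<Sum>k<2*n. ?d k) = - (\<Sum>k<2*n. Tw x k k B)"
  proof -
    have g1: "(\<Sum>k<2*n. \<Sum>A<2*n. Fd n A k * gam x k A B) = 0"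
    proof -
      have "(\<Sum>k<2*n. \<Sum>A<2*n. Fd n A k * gam x k A B) = (\<Sum>A<2*n. \<Sum>k<2*n. Fd n A k * gam x k A B)"
        by (rule sum.swap)
      also have "\<dots> = (\<Sum>A<2*n. \<Sum>k<2*n. Fd n A k * gam x A k B)"
        by (intro sum.cong refl arg_cong2[of _ _ _ _ "(*)"] gam_sym[OF x])
      also have "\<dots> = (\<Sum>A<2*n. \<Sum>k<2*n. - (Fd n k A * gam x A k B))"
        by (intro sum.cong refl Fd_skew_mult) auto
      finally show ?thesis by (simp add: sum_negf)
    qed
    have g2: "(\<Sum>k<2*n. \<Sum>C<2*n. Fd n B C * gam x k C k) = (\<Sum>k<2*n. fder (rho x) x (E k x) * Fd n B k)"
    proof -
      have "(\<Sum>k<2*n. \<Sum>C<2*n. Fd n B C * gam x k C k) = (\<Sum>C<2*n. \<Sum>k<2*n. Fd n B C * gam x k C k)"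
        by (rule sum.swap)
      also have "\<dots> = (\<Sum>C<2*n. fder (rho x) x (E C x) * Fd n B C)"
      proof (rule sum.cong)
        fix C assume C: "C \<in> {..<2*n}"
        have "gam x k C k = gam x C k k" for k by (rule gam_sym[OF x])
        then show "(\<Sum>k<2*n. Fd n B C * gam x k C k) = fder (rho x) x (E C x) * Fd n B C"
          using C by (simp add: fder_rho[OF x] sum_distrib_left mult.commute)
      qed simp
      finally show ?thesis .
    qed
    have w1: "(\<Sum>k<2*n. \<Sum>A<2*n. Fd n A k * w k A B x) = - (\<Sum>k<2*n. eps n k * w k (sig n k) B x)"
    proof -
      have "(\<Sum>k<2*n. \<Sum>A<2*n. Fd n A k * w k A B x) = (\<Sum>k<2*n. \<Sum>A<2*n. - (Fd n k A * w k A B x))"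
        by (intro sum.cong refl Fd_skew_mult) auto
      then show ?thesis by (simp add: sum_Fd sum_negf)
    qed
    have w2: "(\<Sum>k<2*n. \<Sum>C<2*n. Fd n B C * w k C k x) = - (\<Sum>k<2*n. eps n B * w k k (sig n B) x)"
      unfolding sum_negf [symmetric]
      by (intro sum.cong refl) (use B in \<open>simp add: sum_Fd w_skew[OF x, of _ _ "sig n B"]\<close>)
    have "(\<Sum>k<2*n. ?d k) = (\<Sum>k<2*n. fder (rho x) x (E k x) * Fd n B k) + ((\<Sum>k<2*n. \<Sum>A<2*n. Fd n A k * w k A B x)
       - (\<Sum>k<2*n. \<Sum>A<2*n. Fd n A k * gam x k A B)) + ((\<Sum>k<2*n. \<Sum>C<2*n. Fd n B C * w k C k x)
       - (\<Sum>k<2*n. \<Sum>C<2*n. Fd n B C * gam x k C k))"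
      by (simp add: sum.distrib sum_subtractf right_diff_distrib)
    then show ?thesis
      unfolding g1 g2 w1 w2 by (simp add: tors_def sum.distrib)
  qed
  finally show ?thesis .
qed

lemma codiff_fund_form:
  assumes x: "x \<in> V"
  shows "codiff n h E (fund_form h J) x [v] = - (\<Sum>C<2*n. h x (E C x) v * (\<Sum>k<2*n. Tw x k k C))"
proof -
  have k: "- ((-1) ^ C * a * ((-1) ^ C * - b)) = a * b" for C and a b :: real
    by (cases "even C") auto
  have "(\<Sum>C<2*n. - ((-1) ^ C * h x (E C x) v * ext_d (hodge_star n h E (fund_form h J)) x (dual_rest x C)))
    = (\<Sum>C<2*n. h x (E C x) v * (\<Sum>k<2*n. Tw x k k C))"
  proof (rule sum.cong)
    fix C assume "C \<in> {..<2*n}"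
    then have e: "ext_d (hodge_star n h E (fund_form h J)) x (dual_rest x C) = (-1) ^ C * - (\<Sum>k<2*n. Tw x k k C)"
      by (intro ext_d_hodge_fund_form[OF x]) simp
    show "- ((-1) ^ C * h x (E C x) v * ext_d (hodge_star n h E (fund_form h J)) x (dual_rest x C))
      = h x (E C x) v * (\<Sum>k<2*n. Tw x k k C)"
      unfolding e by (rule k)
  qed simp
  then show ?thesis
    unfolding codiff_def hodge_star_1[OF x] by simp
qed

lemma lee_form_frame:
  assumes y: "y \<in> V" and A: "A < 2*n"
  shows "lee_form n h J E y [E A y] = lee n (Tw y) A"
proof -
  have "lee_form n h J E y [E A y] = (\<Sum>C<2*n. eps n A * h y (E C y) (E (sig n A) y) * (\<Sum>k<2*n. Tw y k k C))"
    using A y by (simp add: lee_form_def endo_form1_def codiff_fund_form[OF y] E_J h_simps)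
  also have "\<dots> = (\<Sum>C<2*n. if C = sig n A then eps n A * (\<Sum>k<2*n. Tw y k k C) else 0)"
    by (rule sum.cong) (use A in \<open>auto simp: E_orth[OF y]\<close>)
  also have "\<dots> = lee n (Tw y) A"
    using A by (simp add: lee_def sum_distrib_left)
  finally show ?thesis .
qed

lemma codiff_lee_form:
  assumes x: "x \<in> V"
  shows "codiff n h E (lee_form n h J E) x []
    = - dvg n (\<lambda>A B C. w A B C x) (lee n (Tw x)) (\<lambda>D. lee n (tors n (dw x D)))"
proof -
  have d: "((\<lambda>y. lee n (Tw y) A) has_derivative (\<lambda>v. lee n (tors n (\<lambda>A B C. fder (w A B C) x v)) A)) (at x)"
    if A: "A < 2*n" for A
  proof -
    have wd: "(w A B C has_derivative fder (w A B C) x) (at x)" if "A < 2*n" "B < 2*n" "C < 2*n" for A B C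
      by (rule fder_has_derivative[OF w_diff[OF that x]])
    show ?thesis
      unfolding lee_def tors_def
      by (intro has_derivative_sum has_derivative_mult_right has_derivative_add wd) (use A in auto)
  qed
  have "codiff n h E (lee_form n h J E) x [] = - dvg n (\<lambda>A B C. w A B C x) (\<lambda>A. lee n (Tw x) A)
     (\<lambda>D A. fder (\<lambda>y. lee n (Tw y) A) x (E D x))"
    by (rule codiff_1form[OF x, where f = "\<lambda>A y. lee n (Tw y) A"])
      (use lee_form_frame differentiableI[OF d] in auto)
  also have "\<dots> = - dvg n (\<lambda>A B C. w A B C x) (lee n (Tw x)) (\<lambda>D. lee n (tors n (dw x D)))"
    unfolding dvg_def by (simp add: fder_eqI[OF d] dw_def [abs_def])
  finally show ?thesis .
qed

end

section \<open>Norms of the components of the torsion\<close>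

text \<open>Triples with a repeated index contribute zero, and each 3-element set is the image of
  six ordered triples on which \<open>G\<close> is constant.\<close>

lemma sum_card_3:
  fixes f :: "nat set \<Rightarrow> real"
  assumes eq: "\<And>A B C. A < B \<Longrightarrow> B < C \<Longrightarrow> C < N \<Longrightarrow> G A B C = f {A, B, C}"
    and s12: "\<And>A B C. A < N \<Longrightarrow> B < N \<Longrightarrow> C < N \<Longrightarrow> G B A C = G A B C"
    and s23: "\<And>A B C. A < N \<Longrightarrow> B < N \<Longrightarrow> C < N \<Longrightarrow> G A C B = G A B C"
    and diag: "\<And>A C. A < N \<Longrightarrow> C < N \<Longrightarrow> G A A C = 0"
  shows "(\<Sum>S | S \<subseteq> {..<N} \<and> card S = 3. f S) = 1/6 * (\<Sum>A<N. \<Sum>B<N. \<Sum>C<N. G A B C)"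
proof -
  let ?T = "{S. S \<subseteq> {..<N} \<and> card S = 3}"
  let ?X = "{..<N} \<times> {..<N} \<times> {..<N}"
  let ?D = "{(A, B, C). A < N \<and> B < N \<and> C < N \<and> A \<noteq> B \<and> B \<noteq> C \<and> A \<noteq> C}"
  let ?g = "\<lambda>(A, B, C). {A, B, C}" and ?h = "\<lambda>(A, B, C). G A B C"
  have finD: "finite ?D" by (rule finite_subset[of _ ?X]) auto
  have finT: "finite ?T" by (rule finite_subset[of _ "Pow {..<N}"]) auto
  have fib: "sum ?h {p \<in> ?D. ?g p = S} = 6 * f S" if S: "S \<in> ?T" for S
  proof -
    have fin: "finite S" using S finite_subset by auto
    define l where "l = sorted_list_of_set S"
    have l: "length l = 3" "sorted l" "distinct l" "set l = S"
      using S fin by (simp_all add: l_def)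
    obtain a b c where lab: "l = [a, b, c]" using l(1) by (auto simp: numeral_3_eq_3 length_Suc_conv)
    have o: "a < b" "b < c" and Sabc: "S = {a, b, c}" using l(2-4) by (auto simp: lab less_le)
    have r: "a < N" "b < N" "c < N" using S Sabc by auto
    have "{p \<in> ?D. ?g p = S} = {(a, b, c), (a, c, b), (b, a, c), (b, c, a), (c, a, b), (c, b, a)}"
    proof (rule Set.set_eqI)
      fix p :: "nat \<times> nat \<times> nat"
      obtain A B C where p: "p = (A, B, C)" by (cases p) auto
      show "p \<in> {p \<in> ?D. ?g p = S} \<longleftrightarrow> p \<in> {(a, b, c), (a, c, b), (b, a, c), (b, c, a), (c, a, b), (c, b, a)}"
      proof
        assume "p \<in> {p \<in> ?D. ?g p = S}"
        then have e: "{A, B, C} = {a, b, c}" and d: "A \<noteq> B" "B \<noteq> C" "A \<noteq> C" by (simp_all add: p Sabc)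
        have "A \<in> {a, b, c}" "B \<in> {a, b, c}" "C \<in> {a, b, c}" using e by blast+
        then show "p \<in> {(a, b, c), (a, c, b), (b, a, c), (b, c, a), (c, a, b), (c, b, a)}"
          using d by (auto simp: p)
      next
        assume "p \<in> {(a, b, c), (a, c, b), (b, a, c), (b, c, a), (c, a, b), (c, b, a)}"
        then show "p \<in> {p \<in> ?D. ?g p = S}" using o r by (auto simp: Sabc)
      qed
    qed
    moreover have "G a c b = G a b c" "G b a c = G a b c" "G b c a = G a b c" "G c a b = G a b c" "G c b a = G a b c"
    proof -
      show 1: "G a c b = G a b c" by (rule s23[OF r])
      show 2: "G b a c = G a b c" by (rule s12[OF r])
      show "G b c a = G a b c" using s23[OF r(2,1,3)] 2 by simp
      show 3: "G c a b = G a b c" using s12[OF r(1,3,2)] 1 by simp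
      show "G c b a = G a b c" using s23[OF r(3,1,2)] 3 by simp
    qed
    moreover have "G a b c = f S" using eq[OF o r(3)] Sabc by simp
    ultimately show ?thesis using o by simp
  qed
  have "(\<Sum>A<N. \<Sum>B<N. \<Sum>C<N. G A B C) = sum ?h ?X"
    by (simp add: sum.cartesian_product)
  also have "\<dots> = sum ?h ?D"
  proof (rule sum.mono_neutral_right)
    show "\<forall>p\<in>?X - ?D. ?h p = 0"
    proof
      fix p assume p: "p \<in> ?X - ?D"
      obtain A B C where p': "p = (A, B, C)" by (cases p) auto
      then have r: "A < N" "B < N" "C < N" and ne: "A = B \<or> B = C \<or> A = C" using p by auto
      have "G A B C = 0"
        using ne diag[OF r(1,3)] diag[OF r(2,1)] diag[OF r(3,2)] s12[OF r] s23[OF r] s23[OF r(2,1,3)] s12[OF r(1,3,2)] by auto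
      then show "?h p = 0" by (simp add: p')
    qed
  qed auto
  also have "\<dots> = (\<Sum>S\<in>?T. sum ?h {p \<in> ?D. ?g p = S})"
    by (rule sum.group[symmetric, OF finD finT]) (auto simp: card_insert_if)
  also have "\<dots> = (\<Sum>S\<in>?T. 6 * f S)" by (rule sum.cong) (simp_all only: fib)
  also have "\<dots> = 6 * (\<Sum>S\<in>?T. f S)" by (rule sum_distrib_left [symmetric])
  finally show ?thesis by simp
qed

lemma sum_less_half:
  assumes "\<And>A B. A < N \<Longrightarrow> B < N \<Longrightarrow> g B A = g A B" and "\<And>A. A < N \<Longrightarrow> g A A = (0::real)"
  shows "(\<Sum>B<N::nat. \<Sum>A<B. g A B) = 1/2 * (\<Sum>B<N. \<Sum>A<N. g A B)"
  using assms
proof (induction N)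
  case (Suc N)
  have IH: "(\<Sum>B<N. \<Sum>A<B. g A B) = 1/2 * (\<Sum>B<N. \<Sum>A<N. g A B)"
    by (rule Suc.IH) (use Suc.prems in auto)
  have "(\<Sum>B<N. g N B) = (\<Sum>A<N. g A N)"
    by (rule sum.cong) (use Suc.prems(1)[of _ N] in auto)
  then show ?case using IH Suc.prems(2)[of N] by (simp add: sum.distrib)
qed simp

lemma cyc3_alternating:
  assumes "skew_array n Q" and r: "A < 2*n" "B < 2*n" "C < 2*n"
  shows "cyc3 Q B A C = - cyc3 Q A B C" "cyc3 Q A C B = - cyc3 Q A B C"
  using skew_arrayD[OF assms(1), of A B C] skew_arrayD[OF assms(1), of B C A] skew_arrayD[OF assms(1), of C A B] r
  by (simp_all add: cyc3_def)

lemma (in hermitian_array) skew_array: "skew_array n P"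
  unfolding skew_array_def by (intro allI impI skew)

lemma sum_subsets3:
  fixes f :: "nat set \<Rightarrow> complex"
  shows "(\<Sum>S | S \<subseteq> {..<3} \<and> card S = 3. f S) = f {0, 1, 2}"
    "(\<Sum>S | S \<subseteq> {..<3} \<and> card S = 2. f S) = f {0, 1} + f {0, 2} + f {1, 2}"
    "(\<Sum>S | S \<subseteq> {..<3} \<and> card S = 1. f S) = f {0} + f {1} + f {2}"
    "(\<Sum>S | S \<subseteq> {..<3} \<and> card S = 0. f S) = f {}"
proof -
  have e: "{S. S \<subseteq> {..<3::nat} \<and> card S = k} = {S \<in> Pow {0, 1, 2}. card S = k}" for k
    by (auto simp: lessThan_Suc numeral_3_eq_3)
  have P: "Pow {0, 1, 2::nat} = {{}, {0}, {1}, {2}, {0, 1}, {0, 2}, {1, 2}, {0, 1, 2}}"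
    by (auto simp: Pow_insert)
  have k:
    "{S. S \<subseteq> {..<3::nat} \<and> card S = 3} = {{0, 1, 2}}"
    "{S. S \<subseteq> {..<3::nat} \<and> card S = 2} = {{0, 1}, {0, 2}, {1, 2}}"
    "{S. S \<subseteq> {..<3::nat} \<and> card S = 1} = {{0}, {1}, {2}}"
    "{S. S \<subseteq> {..<3::nat} \<and> card S = 0} = {{}}"
    unfolding e P by auto
  have d: "{0, 1} \<noteq> {0, 2::nat}" "{0, 1} \<noteq> {1, 2::nat}" "{0, 2} \<noteq> {1, 2::nat}"
    by (simp_all add: doubleton_eq_iff)
  show "(\<Sum>S | S \<subseteq> {..<3} \<and> card S = 3. f S) = f {0, 1, 2}"
    unfolding k by simp
  show "(\<Sum>S | S \<subseteq> {..<3} \<and> card S = 2. f S) = f {0, 1} + f {0, 2} + f {1, 2}"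
    unfolding k using d by (simp add: add.assoc)
  show "(\<Sum>S | S \<subseteq> {..<3} \<and> card S = 1. f S) = f {0} + f {1} + f {2}"
    unfolding k by (simp add: add.assoc)
  show "(\<Sum>S | S \<subseteq> {..<3} \<and> card S = 0. f S) = f {}"
    unfolding k by simp
qed

lemma type_part_3:
  assumes "p + q = 3"
  shows "type_part J p q \<omega> x [u, v, z] = (\<Sum>S | S \<subseteq> {..<3::nat} \<and> card S = p. complexify (\<omega> x)
    [if 0 \<in> S then proj10 J x u else proj01 J x u, if 1 \<in> S then proj10 J x v else proj01 J x v,
     if 2 \<in> S then proj10 J x z else proj01 J x z])"
proof -
  have "[0..<3] = [0, 1, 2 :: nat]" by (simp add: upt_rec numeral_2_eq_2)
  then show ?thesis
    unfolding type_part_def assms by (simp add: numeral_2_eq_2 del: complexify.simps cong: if_cong)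
qed

context hermitian_chart
begin

lemma form_norm_sq_3:
  assumes g: "\<And>A B C. A < 2*n \<Longrightarrow> B < 2*n \<Longrightarrow> C < 2*n \<Longrightarrow> \<omega> x [E A x, E B x, E C x] = g A B C"
    and a: "\<And>A B C. A < 2*n \<Longrightarrow> B < 2*n \<Longrightarrow> C < 2*n \<Longrightarrow> g B A C = - g A B C"
      "\<And>A B C. A < 2*n \<Longrightarrow> B < 2*n \<Longrightarrow> C < 2*n \<Longrightarrow> g A C B = - g A B C"
  shows "form_norm_sq n E 3 \<omega> x = 1/6 * sum3 n (\<lambda>A B C. (g A B C)\<^sup>2)"
  unfolding form_norm_sq_def sum3_def
proof (rule sum_card_3)
  fix A B C assume r: "A < B" "B < C" "C < 2*n"
  have "sorted_list_of_set {A, B, C} = [A, B, C]"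
    using r by (simp add: sorted_list_of_set_insert_remove)
  then show "(g A B C)\<^sup>2 = (\<omega> x (frame_list E {A, B, C} x))\<^sup>2"
    using r g[of A B C] by (simp add: frame_list_def)
next
  fix A B C assume r: "A < 2*n" "B < 2*n" "C < 2*n"
  show "(g B A C)\<^sup>2 = (g A B C)\<^sup>2" using a(1)[OF r] by simp
  show "(g A C B)\<^sup>2 = (g A B C)\<^sup>2" using a(2)[OF r] by simp
next
  fix A C assume "A < 2*n" "C < 2*n"
  then show "(g A A C)\<^sup>2 = 0" using a(1)[of A A C] by simp
qed

lemma lee_norm:
  assumes x: "x \<in> V"
  shows "form_norm_sq n E 1 (lee_form n h J E) x = (\<Sum>A<2*n. (lee n (Tw x) A)\<^sup>2)"
  unfolding form_norm_sq_def sum_card_1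
  by (rule sum.cong) (simp_all add: frame_list_def lee_form_frame[OF x])

lemma fder_fund_form:
  assumes x: "x \<in> V"
  shows "fder (\<lambda>y. h y (J y v) u) x a = h x (nJ x a v) u - h x (\<Gamma> x a v) (J x u) + h x (J x v) (\<Gamma> x a u)"
proof -
  have d: "(\<lambda>y. J y v) differentiable at x" by (rule J_diff[OF x])
  show ?thesis
    using fder_eqI[OF has_derivative_h[OF x d differentiable_const, of u]]
    by (simp add: fder_const nJ_def h_simps x h_J)
qed

lemma nJ_skew:
  assumes x: "x \<in> V" shows "h x (nJ x a u) v = - h x (nJ x a v) u"
proof -
  have "fder (\<lambda>y. h y (J y v) u) x = fder (\<lambda>y. - h y (J y u) v) x"
    by (rule fder_cong_open[OF open_V x]) (simp add: h_J h_sym[of _ v])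
  also have "\<dots> = (\<lambda>a. - fder (\<lambda>y. h y (J y u) v) x a)"
    by (rule fder_eqI) (intro has_derivative_minus fder_has_derivative differentiable_h x J_diff differentiable_const)
  finally have "fder (\<lambda>y. h y (J y v) u) x a = - fder (\<lambda>y. h y (J y u) v) x a" by simp
  then show ?thesis
    unfolding fder_fund_form[OF x]
    by (simp add: h_sym[OF x, of "\<Gamma> x a v"] h_sym[OF x, of "\<Gamma> x a u"])
qed

text \<open>Each coordinate derivative of \<open>F\<close> is \<open>\<nabla>F\<close> plus two
  terms in \<Gamma>; these cancel in the alternating sum because \<Gamma> is symmetric.\<close>

lemma ext_d_fund_form:
  assumes x: "x \<in> V"
  shows "ext_d (fund_form h J) x [u, v, z] = h x (nJ x u v) z + h x (nJ x v z) u + h x (nJ x z u) v"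
proof -
  have "ext_d (fund_form h J) x [u, v, z] = fder (\<lambda>y. h y (J y v) z) x u - fder (\<lambda>y. h y (J y u) z) x v
     + fder (\<lambda>y. h y (J y u) v) x z"
    by (simp add: ext_d_def fund_form_def numeral_3_eq_3 lessThan_Suc)
  then show ?thesis
    unfolding fder_fund_form[OF x] \<Gamma>_sym[OF x, of v u] \<Gamma>_sym[OF x, of z u] \<Gamma>_sym[OF x, of z v]
    by (simp add: nJ_skew[OF x, of v u z] h_sym[OF x, of "J x _" "\<Gamma> x _ _"])
qed

lemma ext_d_fund_form_frame:
  assumes x: "x \<in> V" and r: "A < 2*n" "B < 2*n" "C < 2*n"
  shows "ext_d (fund_form h J) x [a *\<^sub>R E A x, b *\<^sub>R E B x, c *\<^sub>R E C x] = a * b * c * cyc3 (Tw x) A B C"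
  using r by (simp add: ext_d_fund_form[OF x] nJ_simps x h_simps h_nJ cyc3_def algebra_simps)

lemma proj_frame:
  assumes "x \<in> V" "A < 2*n"
  shows "proj10 J x (E A x) = ((1/2) *\<^sub>R E A x, (- (eps n A / 2)) *\<^sub>R E (sig n A) x)"
    "proj01 J x (E A x) = ((1/2) *\<^sub>R E A x, (eps n A / 2) *\<^sub>R E (sig n A) x)"
  using assms by (simp_all add: proj10_def proj01_def E_J)

lemma dF_minus_frame:
  assumes x: "x \<in> V" and r: "A < 2*n" "B < 2*n" "C < 2*n"
  shows "dF_minus h J x [E A x, E B x, E C x] = cyc3 (Jpart n (-1) (Tw x)) A B C"
proof -
  interpret c: connection_array n "\<lambda>A B C. w A B C x" "dw x" by (rule connection_array[OF x])
  have e: "3 + 0 = (3::nat)" "0 + 3 = (3::nat)" "2 + 1 = (3::nat)" "1 + 2 = (3::nat)" by simp_all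
  \<comment> \<open>With \<open>cyc3_minus\<close> the right-hand side involves only
    \<open>cyc3 (Tw x)\<close> at the indices and their images under \<open>sig n\<close>, the
    quantities into which the type projections of \<open>dF\<close> expand.\<close>
  show ?thesis
    unfolding c.T.cyc3_minus[OF r, symmetric] dF_minus_def
      type_part_3[OF e(1)] type_part_3[OF e(2)] type_part_3[OF e(3)] type_part_3[OF e(4)]
      sum_subsets3
    using r by (simp add: proj_frame[OF x] ext_d_fund_form_frame[OF x] field_simps del: scaleR_minus_left)
qed

lemma dF_plus_frame:
  assumes x: "x \<in> V" and r: "A < 2*n" "B < 2*n" "C < 2*n"
  shows "dF_plus h J x [E A x, E B x, E C x] = cyc3 (Jpart n 1 (Tw x)) A B C"
proof -
  interpret c: connection_array n "\<lambda>A B C. w A B C x" "dw x" by (rule connection_array[OF x])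
  have s: "cyc3 (Jpart n 1 (Tw x)) A B C = cyc3 (Tw x) A B C - cyc3 (Jpart n (-1) (Tw x)) A B C"
    using Jpart_add[of "Tw x" _ _ _ n] by (simp add: cyc3_def Jpart_def field_simps)
  have e: "3 + 0 = (3::nat)" "0 + 3 = (3::nat)" "2 + 1 = (3::nat)" "1 + 2 = (3::nat)" by simp_all
  show ?thesis
    unfolding s c.T.cyc3_minus[OF r, symmetric] dF_plus_def
      type_part_3[OF e(1)] type_part_3[OF e(2)] type_part_3[OF e(3)] type_part_3[OF e(4)]
      sum_subsets3
    using r by (simp add: proj_frame[OF x] ext_d_fund_form_frame[OF x] field_simps del: scaleR_minus_left)
qed

lemma dF_plus_prim_frame:
  assumes x: "x \<in> V" and r: "A < 2*n" "B < 2*n" "C < 2*n"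
  shows "dF_plus_prim n h J E x [E A x, E B x, E C x] = cyc3 (Jpart n 1 (Tw x)) A B C
    - 1 / (real n - 1) * cyc3 (\<lambda>A B C. lee n (Tw x) A * Fd n B C) A B C"
proof -
  have "wedge1 (lee_form n h J E) (fund_form h J) x [E A x, E B x, E C x]
    = cyc3 (\<lambda>A B C. lee n (Tw x) A * Fd n B C) A B C"
    using r by (simp add: wedge1_def numeral_3_eq_3 lessThan_Suc lee_form_frame[OF x] fund_form_frame[OF x]
        cyc3_def Fd_skew[of C n A])
  then show ?thesis using dF_plus_frame[OF assms] by (simp add: dF_plus_prim_def)
qed

lemma lie_bracket_frame:
  assumes x: "x \<in> V" and r: "A < 2*n" "B < 2*n"
    and X: "\<And>y. y \<in> V \<Longrightarrow> X y = a *\<^sub>R E A y" and Y: "\<And>y. y \<in> V \<Longrightarrow> Y y = b *\<^sub>R E B y"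
  shows "h x (lie_bracket X Y x) (E C x) = a * b * (w A B C x - w B A C x)"
proof -
  have "fder X x = fder (\<lambda>y. a *\<^sub>R E A y) x" "fder Y x = fder (\<lambda>y. b *\<^sub>R E B y) x"
    by (rule fder_cong_open[OF open_V x], rule X Y, assumption)+
  then have "lie_bracket X Y x = (a * b) *\<^sub>R (cov \<Gamma> (E A) (E B) x - cov \<Gamma> (E B) (E A) x)"
    using r x by (simp add: lie_bracket_def X Y fder_scaleR E_diff linear_scale[OF linear_fder[OF E_diff]]
        cov_def \<Gamma>_sym[OF x, of "E A x" "E B x"] scaleR_diff_right mult.commute)
  then show ?thesis by (simp add: h_simps x w_def right_diff_distrib)
qed

lemma nijenhuis3_frame:
  assumes x: "x \<in> V" and r: "A < 2*n" "B < 2*n" "C < 2*n"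
  shows "nijenhuis3 h J (E C) (E A) (E B) x = -2 * Jtw n (Jpart n (-1) (Tw x)) A B C + 2 * Jtw n (Jpart n (-1) (Tw x)) B A C"
proof -
  interpret c: connection_array n "\<lambda>A B C. w A B C x" "dw x" by (rule connection_array[OF x])
  have JE: "endo_app J (E A) y = eps n A *\<^sub>R E (sig n A) y" if "y \<in> V" "A < 2*n" for A y
    using that by (simp add: endo_app_def E_J)
  have E1: "E A y = 1 *\<^sub>R E A y" for A y by simp
  have b: "h x (lie_bracket (E A) (E B) x) (E D x) = w A B D x - w B A D x"
    "h x (lie_bracket (endo_app J (E A)) (E B) x) (E D x) = eps n A * (w (sig n A) B D x - w B (sig n A) D x)"
    "h x (lie_bracket (E A) (endo_app J (E B)) x) (E D x) = eps n B * (w A (sig n B) D x - w (sig n B) A D x)"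
    "h x (lie_bracket (endo_app J (E A)) (endo_app J (E B)) x) (E D x)
       = eps n A * eps n B * (w (sig n A) (sig n B) D x - w (sig n B) (sig n A) D x)" for D
    using lie_bracket_frame[OF x r(1,2) E1 E1]
      lie_bracket_frame[OF x sig_less[OF r(1)] r(2) JE[OF _ r(1)] E1]
      lie_bracket_frame[OF x r(1) sig_less[OF r(2)] E1 JE[OF _ r(2)]]
      lie_bracket_frame[OF x sig_less[OF r(1)] sig_less[OF r(2)] JE[OF _ r(1)] JE[OF _ r(2)]] by simp_all
  have "nijenhuis3 h J (E C) (E A) (E B) x
    = (w A B C x - w B A C x) - eps n A * eps n C * (w (sig n A) B (sig n C) x - w B (sig n A) (sig n C) x)
     - eps n B * eps n C * (w A (sig n B) (sig n C) x - w (sig n B) A (sig n C) x)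
     - eps n A * eps n B * (w (sig n A) (sig n B) C x - w (sig n B) (sig n A) C x)"
    using r by (simp add: nijenhuis3_def nijenhuis_def h_sym[OF x, of "E C x"] h_simps x h_J E_J b mult_ac)
  then show ?thesis using c.nijenhuis_connection[OF r] by simp
qed

lemma nijenhuis_norm:
  assumes x: "x \<in> V"
  shows "nijenhuis_0_norm_sq n h J E x = 4/3 * (sum3 n (\<lambda>A B C. Jpart n (-1) (Tw x) A B C * Jpart n (-1) (Tw x) A B C)
    - sum3 n (\<lambda>A B C. Jpart n (-1) (Tw x) A B C * Jpart n (-1) (Tw x) B C A))"
proof -
  interpret c: connection_array n "\<lambda>A B C. w A B C x" "dw x" by (rule connection_array[OF x])
  define NN where "NN A B C = nijenhuis3 h J (E A) (E B) (E C) x" for A B C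
  have NN: "NN A B C = -2 * Jtw n c.T.Pm B C A + 2 * Jtw n c.T.Pm C B A" if "A < 2*n" "B < 2*n" "C < 2*n" for A B C
    unfolding NN_def using nijenhuis3_frame[OF x that(2,3,1)] .
  have N0: "nijenhuis_0 h J (E C) (E A) (E B) x = NN C A B - cyc3 NN C A B / 3" for A B C
    by (simp add: nijenhuis_0_def nijenhuis_b_def NN_def cyc3_def)
  have sk: "skew_array n NN"
    unfolding skew_array_def by (simp add: NN)
  let ?N = "\<lambda>A B C. NN C A B - cyc3 NN C A B / 3"
  have alt: "?N B A C = - ?N A B C" if "A < 2*n" "B < 2*n" "C < 2*n" for A B C
    using skew_arrayD[OF sk, of C A B] cyc3_alternating(2)[OF sk, of C A B] that by simp
  have "nijenhuis_0_norm_sq n h J E x = (\<Sum>B<2*n. \<Sum>A<B. \<Sum>C<2*n. (?N A B C)\<^sup>2)"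
    by (simp add: nijenhuis_0_norm_sq_def N0)
  \<comment> \<open>The norm counts pairs with \<open>A < B\<close> only, which turns the factor 8/3
    of \<open>norm_nijenhuis0\<close> into 4/3.\<close>
  also have "\<dots> = 1/2 * (\<Sum>B<2*n. \<Sum>A<2*n. \<Sum>C<2*n. (?N A B C)\<^sup>2)"
  proof (rule sum_less_half)
    fix A B assume r: "A < 2*n" "B < 2*n"
    show "(\<Sum>C<2*n. (?N B A C)\<^sup>2) = (\<Sum>C<2*n. (?N A B C)\<^sup>2)"
    proof (rule sum.cong)
      fix C assume "C \<in> {..<2*n}"
      then show "(?N B A C)\<^sup>2 = (?N A B C)\<^sup>2" using alt[OF r, of C] by (metis lessThan_iff power2_minus)
    qed simp
  next
    fix A assume r: "A < 2*n"
    show "(\<Sum>C<2*n. (?N A A C)\<^sup>2) = 0"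
    proof (rule sum.neutral, rule ballI)
      fix C assume "C \<in> {..<2*n}"
      then have "?N A A C = 0" using alt[OF r r, of C] by (metis lessThan_iff equal_neg_zero)
      then show "(?N A A C)\<^sup>2 = 0" by simp
    qed
  qed
  also have "(\<Sum>B<2*n. \<Sum>A<2*n. \<Sum>C<2*n. (?N A B C)\<^sup>2) = sum3 n (\<lambda>C A B. (NN C A B - cyc3 NN C A B / 3)\<^sup>2)"
    using sum3_swap13[of n "\<lambda>C A B. (NN C A B - cyc3 NN C A B / 3)\<^sup>2"] by (simp add: sum3_def)
  also have "\<dots> = 8/3 * (c.T.pm2 - c.T.pmc)"
    by (rule c.T.norm_nijenhuis0[OF NN])
  finally show ?thesis by simp
qed

theorem hermitian_scalar_curvatures:
  assumes x: "x \<in> V" and n: "n \<ge> 2"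
  defines "s \<equiv> riemann_scalar n h \<Gamma> E x"
    and "dFm2 \<equiv> form_norm_sq n E 3 (dF_minus h J) x"
    and "dFp02 \<equiv> form_norm_sq n E 3 (dF_plus_prim n h J E) x"
    and "N02 \<equiv> nijenhuis_0_norm_sq n h J E x"
    and "\<alpha>2 \<equiv> form_norm_sq n E 1 (lee_form n h J E) x"
    and "\<delta>\<alpha> \<equiv> codiff n h E (lee_form n h J E) x []"
  shows "hermitian_scalar_1 n h J \<Gamma> E t x = complex_of_real
      (s / 2 - 5/12 * dFm2 + 1/16 * N02 + 1/4 * dFp02
        + (1 / (4 * (real n - 1)) + (t - 1) / 2) * \<alpha>2 + (t - 2) / 2 * \<delta>\<alpha>)"
    "hermitian_scalar_2 n h J \<Gamma> E t x = complex_of_real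
      (s / 2 - 1/12 * dFm2 + 1/32 * N02 - (t\<^sup>2 - 2 * t) / 4 * dFp02
        - ((t\<^sup>2 - 2 * t) / (4 * (real n - 1)) + (t + 1)\<^sup>2 / 8) * \<alpha>2 - (t + 1) / 2 * \<delta>\<alpha>)"
proof -
  interpret c: connection_array n "\<lambda>A B C. w A B C x" "dw x" by (rule connection_array[OF x])
  define p m mm a d where "p = c.T.pp2" and "m = c.T.pm2" and "mm = c.T.pmc"
    and "a = (\<Sum>A<2*n. (lee n (Tw x) A)\<^sup>2)"
    and "d = dvg n (\<lambda>A B C. w A B C x) (lee n (Tw x)) (\<lambda>D. lee n (tors n (dw x D)))"
  note alt = hermitian_array.skew_array[OF typed_array.axioms(1)[OF c.T.typed_Pm]]
    hermitian_array.skew_array[OF typed_array.axioms(1)[OF c.T.typed_Pp]]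
  have skW: "skew_array n (\<lambda>A B C. lee n (Tw x) A * Fd n B C)"
    unfolding skew_array_def
  proof (intro allI impI)
    fix A B C assume "A < 2*n" "B < 2*n" "C < 2*n"
    then show "lee n (Tw x) A * Fd n C B = - (lee n (Tw x) A * Fd n B C)"
      using Fd_skew[of B n C] by simp
  qed
  \<comment> \<open>With the division hidden in \<open>q\<close>, the final comparison is linear in
    \<open>s\<close>, \<open>p\<close>, \<open>m\<close>, \<open>mm\<close>, \<open>a\<close>,
    \<open>d\<close> and \<open>q * a\<close>, with coefficients polynomial in
    \<open>t\<close>.\<close>
  define q where "q = 1 / (real n - 1)"
  have q: "q\<^sup>2 * (real n - 1) = q" "1 / (4 * (real n - 1)) = q / 4" "r / (4 * (real n - 1)) = r * q / 4" for r
    using n by (simp_all add: q_def power2_eq_square)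
  have 1: "dFm2 = m / 2 + mm"
  proof -
    have "dFm2 = 1/6 * sum3 n (\<lambda>A B C. (cyc3 c.T.Pm A B C)\<^sup>2)"
      unfolding dFm2_def
    proof (rule form_norm_sq_3[where g = "cyc3 c.T.Pm"])
      fix A B C assume r: "A < 2*n" "B < 2*n" "C < 2*n"
      show "dF_minus h J x [E A x, E B x, E C x] = cyc3 c.T.Pm A B C" by (rule dF_minus_frame[OF x r])
      show "cyc3 c.T.Pm B A C = - cyc3 c.T.Pm A B C" "cyc3 c.T.Pm A C B = - cyc3 c.T.Pm A B C"
        by (rule cyc3_alternating[OF alt(1) r])+
    qed
    then show ?thesis by (simp add: c.T.norm_cyc3_Pm m_def mm_def)
  qed
  have 2: "dFp02 = p / 2 - q * a"
  proof -
    have "dFp02 = 1/6 * sum3 n (\<lambda>A B C. (cyc3 c.T.Pp A B C - 1 / (real n - 1) * cyc3 (\<lambda>A B C. lee n (Tw x) A * Fd n B C) A B C)\<^sup>2)"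
      unfolding dFp02_def
    proof (rule form_norm_sq_3[where g = "\<lambda>A B C. cyc3 c.T.Pp A B C - 1 / (real n - 1) * cyc3 (\<lambda>A B C. lee n (Tw x) A * Fd n B C) A B C"])
      fix A B C assume r: "A < 2*n" "B < 2*n" "C < 2*n"
      let ?g = "\<lambda>A B C. cyc3 c.T.Pp A B C - 1 / (real n - 1) * cyc3 (\<lambda>A B C. lee n (Tw x) A * Fd n B C) A B C"
      show "dF_plus_prim n h J E x [E A x, E B x, E C x] = ?g A B C" by (rule dF_plus_prim_frame[OF x r])
      show "?g B A C = - ?g A B C" "?g A C B = - ?g A B C"
        unfolding cyc3_alternating[OF alt(2) r] cyc3_alternating[OF skW r] by simp_all
    qed
    also have "\<dots> = 1/6 * (3 * p - 12 * q * a + 6 * (q\<^sup>2 * (real n - 1)) * a)"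
      unfolding c.T.norm_primitive by (simp add: p_def q_def a_def)
    finally show ?thesis unfolding q by (simp add: field_simps)
  qed
  have 3: "N02 = 4/3 * (m - mm)" unfolding N02_def nijenhuis_norm[OF x] m_def mm_def ..
  have 4: "\<alpha>2 = a" unfolding \<alpha>2_def a_def by (rule lee_norm[OF x])
  have 5: "\<delta>\<alpha> = - d" unfolding \<delta>\<alpha>_def d_def by (rule codiff_lee_form[OF x])
  have s: "s = c.scal" unfolding s_def by (rule riemann_scalar_eq[OF x])
  \<comment> \<open>The coefficients match through -5/12 (m/2 + mm) + 1/12 (m - mm) = -m/8 - mm/2,
    and the term in \<open>q * a\<close> from (dF)_0^+ cancels the explicit one.\<close>
  show "hermitian_scalar_1 n h J \<Gamma> E t x = complex_of_real
      (s / 2 - 5/12 * dFm2 + 1/16 * N02 + 1/4 * dFp02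
        + (1 / (4 * (real n - 1)) + (t - 1) / 2) * \<alpha>2 + (t - 2) / 2 * \<delta>\<alpha>)"
    unfolding hermitian_scalar_1_eq[OF x] c.hermitian_scal1[OF ricJ_riemann[OF x]]
    unfolding s [symmetric] p_def [symmetric] m_def [symmetric] mm_def [symmetric] a_def [symmetric] d_def [symmetric]
      1 2 3 4 5 q
    by (rule arg_cong[where f = complex_of_real]) (simp add: field_simps)
  \<comment> \<open>Here -1/12 (m/2 + mm) + 1/24 (m - mm) = -mm/8, so the norm of T^-
    disappears.\<close>
  show "hermitian_scalar_2 n h J \<Gamma> E t x = complex_of_real
      (s / 2 - 1/12 * dFm2 + 1/32 * N02 - (t\<^sup>2 - 2 * t) / 4 * dFp02
        - ((t\<^sup>2 - 2 * t) / (4 * (real n - 1)) + (t + 1)\<^sup>2 / 8) * \<alpha>2 - (t + 1) / 2 * \<delta>\<alpha>)"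
    unfolding hermitian_scalar_2_eq[OF x] c.hermitian_scal2
    unfolding s [symmetric] p_def [symmetric] m_def [symmetric] mm_def [symmetric] a_def [symmetric] d_def [symmetric]
      1 2 3 4 5 q
    by (rule arg_cong[where f = complex_of_real]) (simp add: field_simps power2_eq_square)
qed

end

theorem theorem1p1:
  fixes M :: "'m topology"
    and \<A> :: "('m, 'e::euclidean_space) chart set"
    and J :: "('m, 'e) chart \<Rightarrow> 'e endo"
    and h :: "('m, 'e) chart \<Rightarrow> 'e metric"
    and n :: nat and t :: real
    and c :: "('m, 'e) chart" and p :: 'm
    and \<Gamma> :: "'e \<Rightarrow> 'e \<Rightarrow> 'e \<Rightarrow> 'e"
    and V :: "'e set" and E :: "nat \<Rightarrow> 'e vfield"
  assumes "n \<ge> 2" and "DIM('e) = 2 * n"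
    and "almost_hermitian_manifold M \<A> J h"
    and "c \<in> \<A>" and "p \<in> fst c"
    and "levi_civita (chart_image c) (h c) \<Gamma>"
    and "open V" and "V \<subseteq> chart_image c" and "snd c p \<in> V"
    and "adapted_frame n V (h c) (J c) E"
  defines "x \<equiv> snd c p"
  defines "s \<equiv> riemann_scalar n (h c) \<Gamma> E x"
    and "dFm2 \<equiv> form_norm_sq n E 3 (dF_minus (h c) (J c)) x"
    and "dFp02 \<equiv> form_norm_sq n E 3 (dF_plus_prim n (h c) (J c) E) x"
    and "N02 \<equiv> nijenhuis_0_norm_sq n (h c) (J c) E x"
    and "\<alpha>2 \<equiv> form_norm_sq n E 1 (lee_form n (h c) (J c) E) x"
    and "\<delta>\<alpha> \<equiv> codiff n (h c) E (lee_form n (h c) (J c) E) x []"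
  shows "hermitian_scalar_1 n (h c) (J c) \<Gamma> E t x = complex_of_real
           (s / 2 - 5/12 * dFm2 + 1/16 * N02 + 1/4 * dFp02
            + (1 / (4 * (real n - 1)) + (t - 1) / 2) * \<alpha>2 + (t - 2) / 2 * \<delta>\<alpha>)
       \<and> hermitian_scalar_2 n (h c) (J c) \<Gamma> E t x = complex_of_real
           (s / 2 - 1/12 * dFm2 + 1/32 * N02 - (t\<^sup>2 - 2 * t) / 4 * dFp02
            - ((t\<^sup>2 - 2 * t) / (4 * (real n - 1)) + (t + 1)\<^sup>2 / 8) * \<alpha>2 - (t + 1) / 2 * \<delta>\<alpha>)"
proof -
  let ?U = "chart_image c"
  have hm: "riemannian_metric \<A> h" and Jm: "almost_complex_structure \<A> J"
    and hJ: "\<And>y v w. y \<in> ?U \<Longrightarrow> h c y (J c y v) (J c y w) = h c y v w"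
    using assms(3,4) unfolding almost_hermitian_manifold_def by blast+
  have h: "smooth_on ?U (\<lambda>y. h c y v w)" "y \<in> ?U \<Longrightarrow> bilinear (h c y)" "y \<in> ?U \<Longrightarrow> h c y v w = h c y w v" for y v w
    using hm assms(4) unfolding riemannian_metric_def by blast+
  have J: "smooth_on ?U (\<lambda>y. J c y v)" "y \<in> ?U \<Longrightarrow> linear (J c y)" "y \<in> ?U \<Longrightarrow> J c y (J c y v) = - v" for y v
    using Jm assms(4) unfolding almost_complex_structure_def by blast+
  have G: "smooth_on ?U (\<lambda>y. \<Gamma> y v w)" "y \<in> ?U \<Longrightarrow> bilinear (\<Gamma> y)" for y v w
    using assms(6) unfolding levi_civita_def by blast+
  \<comment> \<open>Constant fields have vanishing derivatives and brackets, so on them the two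
    properties of the Levi-Civita connection become pointwise statements about \<Gamma>.\<close>
  have tors: "cov \<Gamma> (\<lambda>_. v) (\<lambda>_. w) y - cov \<Gamma> (\<lambda>_. w) (\<lambda>_. v) y = lie_bracket (\<lambda>_. v) (\<lambda>_. w) y" if "y \<in> ?U" for y v w
    using assms(6) that smooth_on_const unfolding levi_civita_def by blast
  have metric: "fder (\<lambda>y. h c y v w) y u = h c y (cov \<Gamma> (\<lambda>_. u) (\<lambda>_. v) y) w + h c y v (cov \<Gamma> (\<lambda>_. u) (\<lambda>_. w) y)"
    if "y \<in> ?U" for y u v w
  proof -
    have "\<forall>X Y Z. smooth_on ?U X \<longrightarrow> smooth_on ?U Y \<longrightarrow> smooth_on ?U Z \<longrightarrow>
        (\<forall>x\<in>?U. fder (\<lambda>y. h c y (Y y) (Z y)) x (X x) = h c x (cov \<Gamma> X Y x) (Z x) + h c x (Y x) (cov \<Gamma> X Z x))"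
      using assms(6) unfolding levi_civita_def by blast
    from this[rule_format, OF smooth_on_const smooth_on_const smooth_on_const that, of v w u]
    show ?thesis .
  qed
  have E: "\<And>A. A < 2*n \<Longrightarrow> smooth_on V (E A)" "\<And>y i. y \<in> V \<Longrightarrow> i < n \<Longrightarrow> E (n + i) y = J c y (E i y)"
    "\<And>y A B. y \<in> V \<Longrightarrow> A < 2*n \<Longrightarrow> B < 2*n \<Longrightarrow> h c y (E A y) (E B y) = (if A = B then 1 else 0)"
    using assms(10) unfolding adapted_frame_def by blast+
  have VU: "y \<in> V \<Longrightarrow> y \<in> ?U" for y using assms(8) by blast
  interpret hermitian_chart n V "h c" "J c" \<Gamma> E
  proof (rule hermitian_chart.intro)
    show "DIM('e) = 2 * n" "open V" by (rule assms)+
    fix y u v w assume "y \<in> V"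
    then have y: "y \<in> ?U" by (rule VU)
    show "bilinear (h c y)" "linear (J c y)" "bilinear (\<Gamma> y)" by (rule h(2) J(2) G(2), rule y)+
    show "h c y v w = h c y w v" by (rule h(3)[OF y])
    show "J c y (J c y v) = - v" by (rule J(3)[OF y])
    show "h c y (J c y v) (J c y w) = h c y v w" by (rule hJ[OF y])
    show "(\<lambda>z. h c z v w) differentiable at y" by (rule smooth_on_differentiable[OF h(1) y])
    show "(\<lambda>z. J c z v) differentiable at y" by (rule smooth_on_differentiable[OF J(1) y])
    show "(\<lambda>z. \<Gamma> z v w) differentiable at y" by (rule smooth_on_differentiable[OF G(1) y])
    show "\<Gamma> y v w = \<Gamma> y w v"
      using tors[OF y, of v w] by (simp add: cov_def lie_bracket_def fder_const)
    show "fder (\<lambda>z. h c z v w) y u = h c y (\<Gamma> y u v) w + h c y v (\<Gamma> y u w)"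
      using metric[OF y, of v w u] by (simp add: cov_def fder_const)
  qed (fact E)+
  have x: "x \<in> V" unfolding x_def by (rule assms(9))
  show ?thesis
    unfolding s_def dFm2_def dFp02_def N02_def \<alpha>2_def \<delta>\<alpha>_def
    by (rule conjI[OF hermitian_scalar_curvatures[OF x assms(1)]])
qed

end
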